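(* Let $$\gamma=E(q)^2E(q^{10}),\qquad \delta=E(q^2)E(q^5)^2,\qquad \xi=q\,\frac{E(q^2)E(q^{10})^3}{E(q)^3E(q^5)},$$ regarded as formal power series in $q$. Let $A=(\alpha_{i,j})_{i,j\ge 1}$ and $B=(\beta_{i,j})_{i,j\ge 1}$ be the infinite matrices determined by $$\sum_{i=1}^\infty\sum_{j=1}^\infty \alpha_{i,j}x^iy^j=\frac{N_\alpha}{D},\qquad \sum_{i=1}^\infty\sum_{j=1}^\infty \beta_{i,j}x^iy^j=\frac{N_\beta}{D},$$ where $N_\alpha,N_\beta,D\in\mathbb{Z}[x,y]$ are the explicit polynomials given in the context. Define the coefficient vectors $\mathbf{x}_m=(x_{m,1},x_{m,2},\ldots)$, $m\ge 1$, recursively by $$\mathbf{x}_1=(18,720,7625,32500,50000,0,0,\ldots),$$ and, for any $m\ge 1$, $$\mathbf{x}_{2m}=\mathbf{x}_{2m-1}A,\qquad \mathbf{x}_{2m+1}=\mathbf{x}_{2m}B.$$ Then for any $m\ge 1$, $$\sum_{n=0}^\infty\overline{\mathrm{spt}}_\omega\left(2\times5^{2m-1}n+5^{2m-1}\right)q^n=\gamma\sum_{i=1}^\infty x_{2m-1,i}\,\xi^{i-1},$$ $$\sum_{n=0}^\infty\overline{\mathrm{spt}}_\omega\left(2\times5^{2m}n+5^{2m}\right)q^n=\delta\sum_{i=1}^\infty x_{2m,i}\,\xi^{i-1}.$$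
   Context: Notation: $(a;q)_n=\prod_{j=1}^n(1-aq^{j-1})$ for $n\in\mathbb{N}\cup\{\infty\}$, and $E(q^j)=(q^j;q^j)_\infty=\prod_{k\ge1}(1-q^{jk})$. An overpartition of $n$ is a finite weakly decreasing sequence of positive integers with sum $n$ in which the first occurrence of each number may (or may not) be overlined. The function $\overline{\mathrm{spt}}_\omega(n)$ denotes the number of smallest parts (i.e. the total number of appearances of the smallest part, summed over all the overpartitions considered) in the overpartitions of $n$ in which the smallest part is always overlined (i.e. its first occurrence is overlined) and all odd parts are less than twice the smallest part. Its generating function is $$\sum_{n=0}^\infty\overline{\mathrm{spt}}_\omega(n)q^n=\sum_{n=1}^\infty\frac{q^n(-q^{n+1};q)_n(-q^{2n+2};q^2)_\infty}{(1-q^n)^2(q^{n+1};q)_n(q^{2n+2};q^2)_\infty}.$$ The polynomials are $$\begin{aligned}N_\alpha&=-yx+(y+210y^2+4300y^3+34000y^4+120000y^5+160000y^6)x^2\\&\quad+(y+180y^2+3575y^3+27500y^4+94000y^5+120000y^6)x^3\\&\quad+(50y^2+1000y^3+7450y^4+24500y^5+30000y^6)x^4\\&\quad+(5y^2+95y^3+675y^4+2125y^5+2500y^6)x^5,\end{aligned}$$ $$\begin{aligned}N_\beta&=-yx+(3y+320y^2+5520y^3+39200y^4+128000y^5+160000y^6)x^2\\&\quad+(y+226y^2+4185y^3+30200y^4+98000y^5+120000y^6)x^3\\&\quad+(56y^2+1080y^3+7800y^4+25000y^5+30000y^6)x^4\\&\quad+(5y^2+95y^3+675y^4+2125y^5+2500y^6)x^5,\end{aligned}$$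 $$\begin{aligned}D&=1-(205y+4300y^2+34000y^3+120000y^4+160000y^5)x\\&\quad-(215y+4475y^2+35000y^3+122000y^4+160000y^5)x^2\\&\quad-(85y+1750y^2+13525y^3+46500y^4+60000y^5)x^3\\&\quad-(15y+305y^2+2325y^3+7875y^4+10000y^5)x^4\\&\quad-(y+20y^2+150y^3+500y^4+625y^5)x^5.\end{aligned}$$ The quotients $N_\alpha/D$ and $N_\beta/D$ are expanded as formal power series in $x,y$. The vectors $\mathbf{x}_m$ are row vectors, so $x_{2m,j}=\sum_{i\ge1}x_{2m-1,i}\alpha_{i,j}$ and $x_{2m+1,j}=\sum_{i\ge1}x_{2m,i}\beta_{i,j}$ (all these sums are finite). *)

theory Defs
  imports
    "HOL-Computational_Algebra.Formal_Power_Series"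
    "HOL-Analysis.Infinite_Products"
begin

section \<open>Overpartitions and the function \<open>spt_omega\<close>\<close>

text \<open>
  An entry \<open>(k, b)\<close> is a part of size \<open>k\<close>, overlined iff \<open>b\<close>.  The last
  condition says that only the first occurrence of a number may be overlined.
\<close>

definition overpartitions :: "nat \<Rightarrow> (nat \<times> bool) list set" where
  "overpartitions n = {ps.
     sorted_wrt (\<ge>) (map fst ps) \<and>
     (\<forall>p \<in> set ps. fst p > 0) \<and>
     sum_list (map fst ps) = n \<and>
     (\<forall>i < length ps. snd (ps ! i) \<longrightarrow> (\<forall>j < i. fst (ps ! j) \<noteq> fst (ps ! i)))}"

definition smallest_part :: "(nat \<times> bool) list \<Rightarrow> nat" where
  "smallest_part ps = Min (fst ` set ps)"

text \<open>
  The empty overpartition has no smallest part; the condition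
  \<open>(smallest_part ps, True) \<in> set ps\<close> excludes it, so \<open>spt_omega 0 = 0\<close>.
\<close>

definition spt_omega_overpartitions :: "nat \<Rightarrow> (nat \<times> bool) list set" where
  "spt_omega_overpartitions n = {ps \<in> overpartitions n.
     (smallest_part ps, True) \<in> set ps \<and>
     (\<forall>p \<in> set ps. odd (fst p) \<longrightarrow> fst p < 2 * smallest_part ps)}"

definition spt_omega :: "nat \<Rightarrow> nat" where
  "spt_omega n =
     (\<Sum>ps \<in> spt_omega_overpartitions n. count_list (map fst ps) (smallest_part ps))"

lemma finite_overpartitions: "finite (overpartitions n)"
proof (rule finite_subset)
  have len: "length ps \<le> sum_list (map fst ps)"
    if "\<forall>p \<in> set ps. fst p > 0" for ps :: "(nat \<times> bool) list"
    using that by (induction ps) (auto simp: Suc_le_eq)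
  have "fst p \<le> sum_list (map fst ps)" if "p \<in> set ps" for p and ps :: "(nat \<times> bool) list"
    using that by (intro member_le_sum_list) auto
  then show "overpartitions n \<subseteq> {ps. set ps \<subseteq> {..n} \<times> UNIV \<and> length ps \<le> n}"
    using len by (fastforce simp: overpartitions_def)
  show "finite {ps. set ps \<subseteq> {..n} \<times> (UNIV :: bool set) \<and> length ps \<le> n}"
    by (intro finite_lists_length_le) auto
qed


section \<open>The \<open>q\<close>-series\<close>

text \<open>
  \<open>E f\<close> is the product of \<open>1 - f ^ k\<close> over \<open>k \<ge> 1\<close>, with respect to the usual
  (\<open>X\<close>-adic) metric on formal power series.
\<close>

definition E :: "rat fps \<Rightarrow> rat fps" where
  "E f = prodinf (\<lambda>k. 1 - f ^ Suc k)"

abbreviation q :: "rat fps" where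
  "q \<equiv> fps_X"

definition gamma_q :: "rat fps" where
  "gamma_q = E q ^ 2 * E (q ^ 10)"

definition delta_q :: "rat fps" where
  "delta_q = E (q ^ 2) * E (q ^ 5) ^ 2"

definition xi_q :: "rat fps" where
  "xi_q = q * (E (q ^ 2) * E (q ^ 10) ^ 3 / (E q ^ 3 * E (q ^ 5)))"

lemma E_has_prod:
  assumes "fps_nth f 0 = 0"
  shows   "(\<lambda>k. 1 - f ^ Suc k) has_prod E f"
proof -
  define P where "P = (\<lambda>n. \<Prod>k\<le>n. 1 - f ^ Suc k)"
  have step: "fps_nth (P (Suc n)) m = fps_nth (P n) m" if "m \<le> n" for m n
  proof -
    have "fps_nth (P n * f ^ Suc (Suc n)) m = 0"
      unfolding fps_mult_nth
      by (rule sum.neutral)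
        (use that assms startsby_zero_power_prefix[of f "Suc (Suc n)"] in auto)
    moreover have "P (Suc n) = P n - P n * f ^ Suc (Suc n)"
      unfolding P_def by (simp add: algebra_simps)
    ultimately show ?thesis by simp
  qed
  have stable: "fps_nth (P n) m = fps_nth (P m) m" if "m \<le> n" for m n
    using that by (induction n rule: dec_induct) (auto simp: step)
  define L where "L = Abs_fps (\<lambda>m. fps_nth (P m) m)"
  have "P \<longlonglongrightarrow> L"
    by (rule tendsto_fpsI)
      (auto simp: L_def eventually_sequentially intro: stable)
  moreover have "L \<noteq> 0"
  proof -
    have "fps_nth L 0 = 1"
      using assms by (simp add: L_def P_def)
    then show ?thesis by auto
  qed
  ultimately have "(\<lambda>k. 1 - f ^ Suc k) has_prod L"
    by (auto simp: has_prod_def raw_has_prod_def P_def)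
  then show ?thesis
    using has_prod_unique unfolding E_def by metis
qed


section \<open>The matrices and the coefficient vectors\<close>

text \<open>
  Power series in \<open>x\<close> and \<open>y\<close> are power series in \<open>x\<close> whose coefficients are
  power series in \<open>y\<close>: the coefficient of \<open>x ^ i * y ^ j\<close> in \<open>F\<close> is
  \<open>fps_nth (fps_nth F i) j\<close>.
\<close>

abbreviation x_var :: "rat fps fps" where
  "x_var \<equiv> fps_X"

abbreviation y_var :: "rat fps fps" where
  "y_var \<equiv> fps_const fps_X"

definition N_alpha :: "rat fps fps" where
  "N_alpha = (let x = x_var; y = y_var in
     - y * x
     + (y + 210 * y^2 + 4300 * y^3 + 34000 * y^4 + 120000 * y^5 + 160000 * y^6) * x^2
     + (y + 180 * y^2 + 3575 * y^3 + 27500 * y^4 + 94000 * y^5 + 120000 * y^6) * x^3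
     + (50 * y^2 + 1000 * y^3 + 7450 * y^4 + 24500 * y^5 + 30000 * y^6) * x^4
     + (5 * y^2 + 95 * y^3 + 675 * y^4 + 2125 * y^5 + 2500 * y^6) * x^5)"

definition N_beta :: "rat fps fps" where
  "N_beta = (let x = x_var; y = y_var in
     - y * x
     + (3 * y + 320 * y^2 + 5520 * y^3 + 39200 * y^4 + 128000 * y^5 + 160000 * y^6) * x^2
     + (y + 226 * y^2 + 4185 * y^3 + 30200 * y^4 + 98000 * y^5 + 120000 * y^6) * x^3
     + (56 * y^2 + 1080 * y^3 + 7800 * y^4 + 25000 * y^5 + 30000 * y^6) * x^4
     + (5 * y^2 + 95 * y^3 + 675 * y^4 + 2125 * y^5 + 2500 * y^6) * x^5)"

definition D_poly :: "rat fps fps" where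
  "D_poly = (let x = x_var; y = y_var in
     1
     - (205 * y + 4300 * y^2 + 34000 * y^3 + 120000 * y^4 + 160000 * y^5) * x
     - (215 * y + 4475 * y^2 + 35000 * y^3 + 122000 * y^4 + 160000 * y^5) * x^2
     - (85 * y + 1750 * y^2 + 13525 * y^3 + 46500 * y^4 + 60000 * y^5) * x^3
     - (15 * y + 305 * y^2 + 2325 * y^3 + 7875 * y^4 + 10000 * y^5) * x^4
     - (y + 20 * y^2 + 150 * y^3 + 500 * y^4 + 625 * y^5) * x^5)"

definition alpha :: "nat \<Rightarrow> nat \<Rightarrow> rat" where
  "alpha i j = fps_nth (fps_nth (N_alpha / D_poly) i) j"

definition beta :: "nat \<Rightarrow> nat \<Rightarrow> rat" where
  "beta i j = fps_nth (fps_nth (N_beta / D_poly) i) j"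

text \<open>
  Row vector times matrix, with indices starting from 1.  The sum ranges over the
  nonzero terms only; there are finitely many of them for the matrices at hand
  (lemmas \<open>finite_column_alpha\<close> and \<open>finite_column_beta\<close> below).
\<close>

definition vec_mat :: "(nat \<Rightarrow> rat) \<Rightarrow> (nat \<Rightarrow> nat \<Rightarrow> rat) \<Rightarrow> nat \<Rightarrow> rat" where
  "vec_mat v M j = (\<Sum>i | i \<ge> 1 \<and> v i * M i j \<noteq> 0. v i * M i j)"

text \<open>
  \<open>coeff_vec m j\<close> is the \<open>j\<close>-th entry of the \<open>m\<close>-th vector; only \<open>m \<ge> 1\<close> and
  \<open>j \<ge> 1\<close> are meaningful.
\<close>

fun coeff_vec :: "nat \<Rightarrow> nat \<Rightarrow> rat" where
  "coeff_vec 0 = (\<lambda>_. 0)"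
| "coeff_vec (Suc 0) =
     (\<lambda>j. if 1 \<le> j \<and> j \<le> 5 then [18, 720, 7625, 32500, 50000] ! (j - 1) else 0)"
| "coeff_vec (Suc (Suc m)) =
     vec_mat (coeff_vec (Suc m)) (if even (Suc (Suc m)) then alpha else beta)"

lemma coeff_vec_rec:
  assumes "m \<ge> 1"
  shows "coeff_vec (2 * m) = vec_mat (coeff_vec (2 * m - 1)) alpha"
    and "coeff_vec (2 * m + 1) = vec_mat (coeff_vec (2 * m)) beta"
proof -
  obtain k where k: "m = Suc k" using assms by (cases m) auto
  show "coeff_vec (2 * m) = vec_mat (coeff_vec (2 * m - 1)) alpha"
    and "coeff_vec (2 * m + 1) = vec_mat (coeff_vec (2 * m)) beta"
    by (simp_all add: k)
qed

lemma D_poly_nth_0: "fps_nth D_poly 0 = 1"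
  by (simp add: D_poly_def Let_def)

lemma quotient_times_D: "(N / D_poly) * D_poly = N"
proof -
  have "fps_right_inverse D_poly (inverse (fps_nth D_poly 0)) = inverse D_poly"
    by (simp add: fps_inverse_def)
  then have inv: "D_poly * inverse D_poly = 1"
    using fps_right_inverse[of D_poly 1] by (simp add: D_poly_nth_0)
  have "subdegree D_poly = 0"
    by (simp add: D_poly_nth_0)
  then have "N / D_poly = N * inverse D_poly"
    by (simp add: fps_divide_def fps_unit_factor_def)
  then show ?thesis
    using inv by (simp add: mult.assoc mult.commute[of "inverse D_poly"])
qed

text \<open>
  Every monomial \<open>x ^ i * y ^ j\<close> occurring in the quotients satisfies \<open>i \<le> 5 * j\<close>,
  so that the columns of both matrices have finite support.
\<close>

definition steep :: "rat fps fps \<Rightarrow> bool" where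
  "steep F \<longleftrightarrow> (\<forall>i j. i > 5 * j \<longrightarrow> fps_nth (fps_nth F i) j = 0)"

lemma steep_add: "steep F \<Longrightarrow> steep G \<Longrightarrow> steep (F + G)"
  and steep_diff: "steep F \<Longrightarrow> steep G \<Longrightarrow> steep (F - G)"
  and steep_uminus: "steep F \<Longrightarrow> steep (- F)"
  by (simp_all add: steep_def)

lemma steep_monom: "k \<le> 5 * e \<Longrightarrow> steep (fps_const (fps_const c * fps_X ^ e) * x_var ^ k)"
  by (auto simp: steep_def fps_X_power_mult_right_nth)

lemma steep_monoms:
  "e \<ge> 1 \<Longrightarrow> k \<le> 5 \<Longrightarrow> steep (numeral c * y_var ^ e * x_var ^ k)"
  "k \<le> 5 \<Longrightarrow> steep (numeral c * y_var * x_var ^ k)"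
  "e \<ge> 1 \<Longrightarrow> steep (numeral c * y_var ^ e * x_var)"
  "steep (numeral c * y_var * x_var)"
  "k \<le> 5 \<Longrightarrow> steep (y_var * x_var ^ k)"
  "steep (y_var * x_var)"
  "steep 1"
  using steep_monom[of k e "numeral c"] steep_monom[of k 1 "numeral c"]
    steep_monom[of 1 e "numeral c"] steep_monom[of 1 1 "numeral c"]
    steep_monom[of k 1 1] steep_monom[of 1 1 1] steep_monom[of 0 0 1]
  by (simp_all add: numeral_fps_const fps_const_power)

lemma steep_polys: "steep N_alpha" "steep N_beta" "steep D_poly"
  unfolding N_alpha_def N_beta_def D_poly_def Let_def distrib_right mult_minus_left
  by (intro steep_add steep_diff steep_uminus steep_monoms; simp)+

lemma steep_quotient:
  assumes "steep N"
  shows   "steep (N / D_poly)"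
proof -
  define F where "F = N / D_poly"
  have FD: "F * D_poly = N"
    unfolding F_def by (rule quotient_times_D)
  have "fps_nth (fps_nth F i) j = 0" if "i > 5 * j" for i j
    using that
  proof (induction i arbitrary: j rule: less_induct)
    case (less i)
    have "fps_nth N i = (\<Sum>k=0..i. fps_nth F k * fps_nth D_poly (i - k))"
      using FD by (metis fps_mult_nth)
    also have "\<dots> = fps_nth F i + (\<Sum>k<i. fps_nth F k * fps_nth D_poly (i - k))"
      by (simp add: atLeast0AtMost lessThan_Suc_atMost[symmetric] D_poly_nth_0)
    finally have "fps_nth (fps_nth F i) j =
        fps_nth (fps_nth N i) j - (\<Sum>k<i. fps_nth (fps_nth F k * fps_nth D_poly (i - k)) j)"
      by (simp add: fps_sum_nth)
    moreover have "fps_nth (fps_nth F k * fps_nth D_poly (i - k)) j = 0" if "k < i" for k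
      unfolding fps_mult_nth
    proof (rule sum.neutral, rule ballI)
      fix l assume l: "l \<in> {0..j}"
      show "fps_nth (fps_nth F k) l * fps_nth (fps_nth D_poly (i - k)) (j - l) = 0"
      proof (cases "k > 5 * l")
        case True
        then show ?thesis using less.IH[of k l] \<open>k < i\<close> by simp
      next
        case False
        then have "i - k > 5 * (j - l)" using less.prems l by auto
        then show ?thesis using steep_polys(3) by (auto simp: steep_def)
      qed
    qed
    moreover have "fps_nth (fps_nth N i) j = 0"
      using assms less.prems by (auto simp: steep_def)
    ultimately show ?case by simp
  qed
  then show ?thesis by (simp add: steep_def F_def)
qed

lemma finite_column_alpha: "finite {i. i \<ge> 1 \<and> v i * alpha i j \<noteq> 0}"
  and finite_column_beta: "finite {i. i \<ge> 1 \<and> v i * beta i j \<noteq> 0}"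
proof -
  have "alpha i j = 0" "beta i j = 0" if "i > 5 * j" for i
    using that steep_polys(1,2)[THEN steep_quotient]
    by (auto simp: steep_def alpha_def beta_def)
  then have "{i. i \<ge> 1 \<and> v i * alpha i j \<noteq> 0} \<subseteq> {..5 * j}"
    and "{i. i \<ge> 1 \<and> v i * beta i j \<noteq> 0} \<subseteq> {..5 * j}"
    by (auto simp: not_less[symmetric])
  then show "finite {i. i \<ge> 1 \<and> v i * alpha i j \<noteq> 0}"
    and "finite {i. i \<ge> 1 \<and> v i * beta i j \<noteq> 0}"
    by (auto intro: finite_subset)
qed

lemma summable_xi: "summable (\<lambda>i. fps_const (c i) * xi_q ^ i)"
proof -
  define S where "S = (\<lambda>n. \<Sum>i<n. fps_const (c i) * xi_q ^ i)"
  have xi0: "fps_nth xi_q 0 = 0"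
    by (simp add: xi_q_def)
  have stable: "fps_nth (S n) k = fps_nth (S (Suc k)) k" if "Suc k \<le> n" for n k
    using that
    by (induction n rule: dec_induct)
      (use startsby_zero_power_prefix[OF xi0] in \<open>auto simp: S_def\<close>)
  have "S \<longlonglongrightarrow> Abs_fps (\<lambda>k. fps_nth (S (Suc k)) k)"
    by (rule tendsto_fpsI) (auto simp: eventually_sequentially intro: stable)
  then show ?thesis
    by (auto simp: summable_def sums_def S_def)
qed

end

theory Submission
  imports Defs "HOL-Computational_Algebra.Polynomial"
begin

text \<open>
  Write \<open>U F\<close> for the series with coefficients \<open>F_(5n+2)\<close>.  Since
  \<open>2 * 5^k * (5n + 2) + 5^k = 2 * 5^(k+1) * n + 5^(k+1)\<close>, the operator \<open>U\<close> sends the generating function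
  of \<open>spt_omega\<close> along the progression for \<open>5^k\<close> to the one for \<open>5^(k+1)\<close>.  The theorem therefore
  follows by induction from three facts: the series for \<open>k = 0\<close>, the value of \<open>U\<close> on it, and the action
  of \<open>U\<close> on \<open>gamma_q * xi_q^i\<close> and \<open>delta_q * xi_q^i\<close>.

  For the series with \<open>k = 0\<close> (\<open>spt_omega_odd\<close>), split every overpartition into its smallest part
  \<open>m\<close> and the larger parts.  This writes the generating function of \<open>spt_omega\<close> as a product over the
  even numbers times the sum over \<open>m\<close> of \<open>q^m / (1 - q^m)^2\<close> times a weight \<open>W m\<close>.  The weight
  belongs to a Bailey pair: it expands into terms \<open>t m r\<close> with coefficients that vanish for odd \<open>r\<close>,
  and the sum over \<open>m\<close> of \<open>q^m / (1 - q^m)^2 * t m r\<close> telescopes (\<open>bailey_telescope\<close>).  The term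
  \<open>r = 0\<close> contributes the generating function of the sum of divisors, and every other term is a series in
  \<open>q^2\<close>, so that only the sum of divisors survives at odd exponents.  At odd arguments its generating
  function is an eta quotient (\<open>sigma_odd\<close>), because the Wronskian of the theta series \<open>phi(q)\<close> and
  \<open>phi(-q)\<close> is \<open>4 * q * E(q^4)^6\<close>, by Jacobi's series for the cube of \<open>E\<close>.  Altogether the
  series for \<open>k = 0\<close> is \<open>E(q^2)^9 / E(q)^6\<close>.

  The action of \<open>U\<close> rests on a modular equation (\<open>modular_equation\<close>): \<open>xi_q\<close> is a root of a
  polynomial of degree five whose coefficients are polynomials in \<open>Y = xi_q(q^5)\<close>.  A factor \<open>Y\<close> can be
  moved out of \<open>U\<close>, where it becomes \<open>xi_q\<close>.  Hence, for every series \<open>F\<close>, the sequence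
  \<open>U (F * xi_q^j)\<close> satisfies a linear recurrence of order five with coefficients in \<open>Z[xi_q]\<close>, and the
  denominator \<open>D\<close> is its reversed characteristic polynomial.  The numerators encode five initial
  values.  Running the recurrence backwards, these are taken at \<open>F = Y * G / xi_q^4\<close> for \<open>G = gamma_q\<close> and \<open>G = delta_q\<close>: up to
  series in \<open>q^5\<close>, the products of \<open>F\<close> with suitable monomials in \<open>xi_q\<close> and \<open>1 + 4 * xi_q\<close> are
  then monomials of degree at most four in \<open>E(q)\<close> and \<open>E(q^2)\<close>, whose sections can be read off the
  five-dissections of \<open>E(q)\<close> and \<open>E(q^2)\<close> (\<open>delta_values\<close>, \<open>gamma_values\<close>).  The same values also
  give \<open>U\<close> of the series for \<open>k = 0\<close> (\<open>section_start\<close>).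

  Both the modular equation and the values need relations between \<open>E(q)\<close>, \<open>E(q^2)\<close>, \<open>E(q^5)\<close>,
  \<open>E(q^10)\<close> and the Rogers-Ramanujan quotient (\<open>level10_relations\<close>).  They are polynomial consequences
  of product formulas for theta series, which are proved by rearranging double sums over the integer lattice
  along sublattices of index two, three and five; the Jacobi triple product turns theta series into
  infinite products.
\<close>

section \<open>Infinite products in the powers of \<open>q\<close>\<close>

text \<open>
  The product of \<open>(1 - q^k) ^ e k\<close> over \<open>k \<ge> 1\<close>.  The factors with \<open>k > n\<close> do not affect the
  coefficient of \<open>q^n\<close>.  Encoding a product by its exponents reduces an identity between infinite products
  to an identity between functions on the naturals.
\<close>
definition eprod :: "(nat \<Rightarrow> nat) \<Rightarrow> rat fps" where
  "eprod e = Abs_fps (\<lambda>n. fps_nth (\<Prod>k=1..n. (1 - q ^ k) ^ e k) n)"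

lemma nth_mult_one_minus_power:
  fixes F :: "rat fps"
  assumes "n < k"
  shows   "fps_nth (F * (1 - q ^ k) ^ e) n = fps_nth F n"
proof (induction e)
  case (Suc e)
  have "F * (1 - q ^ k) ^ Suc e = F * (1 - q ^ k) ^ e - q ^ k * (F * (1 - q ^ k) ^ e)"
    by (simp add: algebra_simps)
  then show ?case using Suc assms by (simp add: fps_X_power_mult_nth)
qed auto

lemma eprod_nth:
  assumes "n \<le> N"
  shows   "fps_nth (eprod e) n = fps_nth (\<Prod>k=1..N. (1 - q ^ k) ^ e k) n"
  using assms
proof (induction N rule: dec_induct)
  case base
  then show ?case by (simp add: eprod_def)
next
  case (step N)
  have "(\<Prod>k=1..Suc N. (1 - q ^ k) ^ e k) = (\<Prod>k=1..N. (1 - q ^ k) ^ e k) * (1 - q ^ Suc N) ^ e (Suc N)"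
    by simp
  then show ?case using step nth_mult_one_minus_power[of n "Suc N"] by simp
qed

lemma eprod_nth_0 [simp]: "fps_nth (eprod e) 0 = 1"
  by (simp add: eprod_def)

lemma eprod_nonzero [simp]: "eprod e \<noteq> 0"
  using eprod_nth_0[of e] by (metis fps_zero_nth zero_neq_one)

lemma eprod_mult: "eprod e * eprod f = eprod (\<lambda>k. e k + f k)"
proof (rule fps_ext)
  fix n
  define P where "P = (\<lambda>e. \<Prod>k=1..n. (1 - q ^ k) ^ e k)"
  have "fps_nth (eprod e * eprod f) n = fps_nth (P e * P f) n"
    unfolding fps_mult_nth P_def
    by (intro sum.cong refl arg_cong2[of _ _ _ _ "(*)"] eprod_nth) auto
  also have "P e * P f = P (\<lambda>k. e k + f k)"
    by (simp add: P_def power_add prod.distrib)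
  also have "fps_nth \<dots> n = fps_nth (eprod (\<lambda>k. e k + f k)) n"
    by (simp add: P_def eprod_nth[of n n])
  finally show "fps_nth (eprod e * eprod f) n = fps_nth (eprod (\<lambda>k. e k + f k)) n" .
qed

lemma eprod_power: "eprod e ^ m = eprod (\<lambda>k. m * e k)"
proof (induction m)
  case 0
  show ?case by (auto simp: eprod_def fps_eq_iff)
qed (simp add: eprod_mult)

lemma eprod_cong: "(\<And>k. k > 0 \<Longrightarrow> e k = f k) \<Longrightarrow> eprod e = eprod f"
  by (auto simp: eprod_def fps_eq_iff intro!: arg_cong2[of _ _ _ _ fps_nth] prod.cong)

text \<open>
  The partial products of both sides are the same polynomials, so convergence in the \<open>q\<close>-adic metric
  identifies the limits.
\<close>
lemma E_eq_eprod:
  assumes "j > 0"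
  shows   "E (q ^ j) = eprod (\<lambda>k. of_bool (j dvd k))"
proof -
  define L where "L = eprod (\<lambda>k. of_bool (j dvd k))"
  have partial: "(\<Prod>k\<le>n. 1 - (q ^ j) ^ Suc k) = (\<Prod>k=1..j * Suc n. (1 - q ^ k) ^ of_bool (j dvd k))" for n
  proof -
    have "(\<Prod>k=1..j * Suc n. (1 - q ^ k) ^ of_bool (j dvd k)) =
        (\<Prod>k\<in>{k \<in> {1..j * Suc n}. j dvd k}. 1 - q ^ k)"
      by (subst prod.inter_filter) (auto intro: prod.cong)
    also have "\<dots> = (\<Prod>k\<le>n. 1 - (q ^ j) ^ Suc k)"
    proof (rule prod.reindex_bij_witness[of _ "\<lambda>k. j * Suc k" "\<lambda>k. k div j - 1"])
      fix k assume k: "k \<in> {k \<in> {1..j * Suc n}. j dvd k}"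
      then obtain i where i: "k = j * i" by auto
      with k have "j * i \<le> j * Suc n" "i \<ge> 1" by auto
      then have "i \<ge> 1" "i \<le> Suc n" using assms by (auto simp del: mult_Suc_right)
      then show "j * Suc (k div j - 1) = k" "k div j - 1 \<in> {..n}"
        "1 - (q ^ j) ^ Suc (k div j - 1) = 1 - q ^ k"
        using i assms by (auto simp: power_mult [symmetric] simp del: power_Suc)
    next
      fix k assume "k \<in> {..n}"
      then show "j * Suc k div j - 1 = k" "j * Suc k \<in> {k \<in> {1..j * Suc n}. j dvd k}"
        using assms by (auto simp: Suc_le_eq)
    qed
    finally show ?thesis by simp
  qed
  have "(\<lambda>n. \<Prod>k\<le>n. 1 - (q ^ j) ^ Suc k) \<longlonglongrightarrow> L"
  proof (rule tendsto_fpsI)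
    fix m
    have "fps_nth (\<Prod>k\<le>n. 1 - (q ^ j) ^ Suc k) m = fps_nth L m" if "n \<ge> m" for n
    proof -
      have "m \<le> j * Suc n" using that assms
        by (metis le_SucI le_trans mult_le_mono1 nat_mult_1 Suc_leI One_nat_def)
      then show ?thesis unfolding partial L_def by (simp add: eprod_nth)
    qed
    then show "\<forall>\<^sub>F n in sequentially. fps_nth (\<Prod>k\<le>n. 1 - (q ^ j) ^ Suc k) m = fps_nth L m"
      by (auto simp: eventually_sequentially)
  qed
  then have "(\<lambda>k. 1 - (q ^ j) ^ Suc k) has_prod L"
    by (auto simp: has_prod_def raw_has_prod_def L_def)
  then show ?thesis
    using has_prod_unique unfolding E_def L_def by metis
qed

section \<open>Substituting \<open>q ^ d\<close> for \<open>q\<close> and extracting progressions\<close>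

lemma nth_compose_power:
  fixes F :: "rat fps"
  assumes "d > 0"
  shows   "fps_nth (F oo q ^ d) n = (if d dvd n then fps_nth F (n div d) else 0)"
proof -
  have "fps_nth (F oo q ^ d) n = (\<Sum>i=0..n. if n = d * i then fps_nth F i else 0)"
    unfolding fps_compose_nth
    by (intro sum.cong refl) (simp add: power_mult [symmetric] fps_X_power_nth)
  also have "\<dots> = (if d dvd n then fps_nth F (n div d) else 0)"
  proof (cases "d dvd n")
    case True
    then obtain i where i: "n = d * i" by auto
    have "(\<Sum>j=0..n. if n = d * j then fps_nth F j else 0) = (\<Sum>j=0..n. if i = j then fps_nth F j else 0)"
      using i assms by (intro sum.cong) auto
    then show ?thesis using i assms by simp
  qed (auto intro!: sum.neutral)
  finally show ?thesis .
qed

lemma compose_power_mult: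
  "d > 0 \<Longrightarrow> (F * G) oo (q ^ d) = (F oo q ^ d) * (G oo q ^ d)"
  by (rule fps_compose_mult_distrib) simp

lemma compose_power_power:
  "d > 0 \<Longrightarrow> (F ^ n) oo (q ^ d) = (F oo q ^ d) ^ n"
  by (induction n) (simp_all add: compose_power_mult)

lemma compose_power_prod:
  "d > 0 \<Longrightarrow> (\<Prod>i\<in>I. F i) oo (q ^ d) = (\<Prod>i\<in>I. F i oo q ^ d)"
  by (induction I rule: infinite_finite_induct) (simp_all add: compose_power_mult)

lemma eprod_compose_power:
  assumes "d > 0"
  shows   "eprod e oo q ^ d = eprod (\<lambda>k. if d dvd k then e (k div d) else 0)"
proof (rule fps_ext)
  fix n
  define N where "N = n * d"
  have "n \<le> N" using assms by (simp add: N_def)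
  have "fps_nth (eprod e oo q ^ d) n = fps_nth ((\<Prod>k=1..n. (1 - q ^ k) ^ e k) oo q ^ d) n"
    using assms by (auto simp: nth_compose_power eprod_nth[of "n div d" n])
  also have "(\<Prod>k=1..n. (1 - q ^ k) ^ e k) oo q ^ d = (\<Prod>k=1..n. (1 - q ^ (d * k)) ^ e k)"
    using assms
    by (simp add: compose_power_prod compose_power_power fps_compose_sub_distrib power_mult)
  also have "\<dots> = (\<Prod>k\<in>{k \<in> {1..N}. d dvd k}. (1 - q ^ k) ^ e (k div d))"
    using assms
    by (intro prod.reindex_bij_witness[of _ "\<lambda>k. k div d" "\<lambda>k. d * k"])
      (auto simp: N_def Suc_le_eq)
  also have "\<dots> = (\<Prod>k=1..N. (1 - q ^ k) ^ (if d dvd k then e (k div d) else 0))"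
    by (subst prod.inter_filter) (auto intro: prod.cong)
  also have "fps_nth \<dots> n = fps_nth (eprod (\<lambda>k. if d dvd k then e (k div d) else 0)) n"
    using \<open>n \<le> N\<close> by (simp add: eprod_nth)
  finally show "fps_nth (eprod e oo q ^ d) n =
      fps_nth (eprod (\<lambda>k. if d dvd k then e (k div d) else 0)) n" .
qed

lemma E_compose_power:
  assumes "j > 0" "d > 0"
  shows   "E (q ^ j) oo q ^ d = E (q ^ (j * d))"
proof -
  have "(if d dvd k then of_bool (j dvd k div d) else (0::nat)) = of_bool (j * d dvd k)" for k
    using assms by (auto simp: dvd_div_iff_mult mult.commute dest: dvd_mult_left)
  then show ?thesis using assms
    by (simp add: E_eq_eprod eprod_compose_power)
qed

definition section_fps :: "nat \<Rightarrow> nat \<Rightarrow> rat fps \<Rightarrow> rat fps" where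
  "section_fps d r F = Abs_fps (\<lambda>n. fps_nth F (d * n + r))"

lemma section_fps_add: "section_fps d r (F + G) = section_fps d r F + section_fps d r G"
  and section_fps_diff: "section_fps d r (F - G) = section_fps d r F - section_fps d r G"
  and section_fps_const_mult: "section_fps d r (fps_const c * F) = fps_const c * section_fps d r F"
  by (auto simp: section_fps_def fps_eq_iff)

text \<open>
  A series in \<open>q^d\<close> moves no exponent to another residue class.
\<close>
lemma section_fps_compose_mult:
  assumes "d > 0" "r < d"
  shows   "section_fps d r ((G oo q ^ d) * F) = G * section_fps d r F"
proof (rule fps_ext)
  fix n
  have "fps_nth (section_fps d r ((G oo q ^ d) * F)) n =
      (\<Sum>i=0..d * n + r. if d dvd i then fps_nth G (i div d) * fps_nth F (d * n + r - i) else 0)"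
    using assms unfolding section_fps_def fps_mult_nth
    by (auto simp: nth_compose_power intro!: sum.cong)
  also have "\<dots> = (\<Sum>i | i \<in> {0..d * n + r} \<and> d dvd i. fps_nth G (i div d) * fps_nth F (d * n + r - i))"
    by (subst sum.inter_filter) auto
  also have "\<dots> = (\<Sum>i=0..n. fps_nth G i * fps_nth F (d * (n - i) + r))"
  proof (rule sum.reindex_bij_witness[of _ "\<lambda>i. d * i" "\<lambda>i. i div d"])
    fix i assume "i \<in> {i. i \<in> {0..d * n + r} \<and> d dvd i}"
    then obtain j where j: "i = d * j" and le: "d * j \<le> d * n + r" by auto
    have "j \<le> n"
    proof (rule ccontr)
      assume "\<not> j \<le> n"
      then have "d * Suc n \<le> d * j" by (intro mult_le_mono2) auto
      then show False using le assms by simp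
    qed
    then show "d * (i div d) = i" "i div d \<in> {0..n}"
      "fps_nth G (i div d) * fps_nth F (d * (n - i div d) + r) =
        fps_nth G (i div d) * fps_nth F (d * n + r - i)"
      using j assms by (auto simp: diff_mult_distrib2)
  qed (use assms in \<open>auto intro: trans_le_add1\<close>)
  also have "\<dots> = fps_nth (G * section_fps d r F) n"
    by (simp add: fps_mult_nth section_fps_def)
  finally show "fps_nth (section_fps d r ((G oo q ^ d) * F)) n = fps_nth (G * section_fps d r F) n" .
qed

section \<open>Agreement of power series up to a given order\<close>

definition eq_upto :: "nat \<Rightarrow> rat fps \<Rightarrow> rat fps \<Rightarrow> bool" where
  "eq_upto m F G \<longleftrightarrow> (\<forall>i\<le>m. fps_nth F i = fps_nth G i)"

lemma eq_upto_refl [simp]: "eq_upto m F F"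
  by (simp add: eq_upto_def)

lemma eq_upto_sym: "eq_upto m F G \<Longrightarrow> eq_upto m G F"
  and eq_upto_trans [trans]: "eq_upto m F G \<Longrightarrow> eq_upto m G H \<Longrightarrow> eq_upto m F H"
  by (auto simp: eq_upto_def)

lemma eq_upto_add: "eq_upto m F G \<Longrightarrow> eq_upto m F' G' \<Longrightarrow> eq_upto m (F + F') (G + G')"
  by (auto simp: eq_upto_def)

lemma eq_upto_mult: "eq_upto m F G \<Longrightarrow> eq_upto m F' G' \<Longrightarrow> eq_upto m (F * F') (G * G')"
  by (auto simp: eq_upto_def fps_mult_nth intro!: sum.cong)

lemma eq_upto_sum: "(\<And>i. i \<in> I \<Longrightarrow> eq_upto m (F i) (G i)) \<Longrightarrow> eq_upto m (sum F I) (sum G I)"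
  by (auto simp: eq_upto_def fps_sum_nth intro!: sum.cong)

lemma eq_upto_power: "eq_upto m F G \<Longrightarrow> eq_upto m (F ^ n) (G ^ n)"
  by (induction n) (auto intro: eq_upto_mult)

lemma eq_upto_shift: "eq_upto (m - k) F G \<Longrightarrow> eq_upto m (q ^ k * F) (q ^ k * G)"
  by (auto simp: eq_upto_def fps_X_power_mult_nth)

lemma eq_upto_one_minus_power: "m < k \<Longrightarrow> eq_upto m (1 - q ^ k) 1"
  by (auto simp: eq_upto_def fps_X_power_nth)

lemma eq_upto_cancel:
  assumes "eq_upto m (F * H) (G * H)" "fps_nth H 0 \<noteq> 0"
  shows   "eq_upto m F G"
proof -
  have "eq_upto m (F * H * inverse H) (G * H * inverse H)"
    by (rule eq_upto_mult[OF assms(1) eq_upto_refl])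
  then show ?thesis
    by (simp only: mult.assoc inverse_mult_eq_1'[OF assms(2)] mult_1_right)
qed

lemma eq_upto_inverse:
  assumes "eq_upto m F G" "fps_nth F 0 \<noteq> 0" "fps_nth G 0 \<noteq> 0"
  shows   "eq_upto m (inverse F) (inverse G)"
proof (rule eq_upto_cancel[of _ _ "F * G"])
  have "inverse F * (F * G) = G" "inverse G * (F * G) = F"
    using inverse_mult_eq_1[OF assms(2)] inverse_mult_eq_1[OF assms(3)]
    by (metis mult.assoc mult_1, metis mult.assoc mult.commute mult_1)
  then show "eq_upto m (inverse F * (F * G)) (inverse G * (F * G))"
    using assms(1) by (simp only: eq_upto_sym)
qed (use assms in auto)

section \<open>Sums of weighted powers of \<open>q\<close>\<close>

text \<open>
  The sum of \<open>c i * q ^ e i\<close> over \<open>i \<in> I\<close>.  The exponents are integers because they come from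
  quadratic forms on the integers; each coefficient sums over a fibre of \<open>e\<close>, and \<open>gsummable\<close> says that
  all exponents are nonnegative and all fibres finite.
\<close>
definition gsum :: "'i set \<Rightarrow> ('i \<Rightarrow> rat) \<Rightarrow> ('i \<Rightarrow> int) \<Rightarrow> rat fps" where
  "gsum I c e = Abs_fps (\<lambda>n. \<Sum>i | i \<in> I \<and> e i = int n. c i)"

definition gsummable :: "'i set \<Rightarrow> ('i \<Rightarrow> int) \<Rightarrow> bool" where
  "gsummable I e \<longleftrightarrow> (\<forall>i\<in>I. 0 \<le> e i) \<and> (\<forall>n. finite {i \<in> I. e i \<le> n})"

lemma gsummable_fibre: "gsummable I e \<Longrightarrow> finite {i. i \<in> I \<and> e i = n}"
  unfolding gsummable_def by (rule finite_subset[of _ "{i \<in> I. e i \<le> n}"]) auto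

lemma gsum_cong:
  "(\<And>i. i \<in> I \<Longrightarrow> c i = c' i) \<Longrightarrow> (\<And>i. i \<in> I \<Longrightarrow> e i = e' i) \<Longrightarrow> gsum I c e = gsum I c' e'"
  by (auto simp: gsum_def fps_eq_iff intro!: sum.cong)

lemma gsum_reindex:
  assumes "bij_betw h I J"
  shows   "gsum J c e = gsum I (\<lambda>i. c (h i)) (\<lambda>i. e (h i))"
proof (rule fps_ext)
  fix n
  have "bij_betw h {i. i \<in> I \<and> e (h i) = int n} {j. j \<in> J \<and> e j = int n}"
    using assms by (auto simp: bij_betw_def inj_on_def)
  then show "fps_nth (gsum J c e) n = fps_nth (gsum I (\<lambda>i. c (h i)) (\<lambda>i. e (h i))) n"
    by (simp add: gsum_def sum.reindex_bij_betw)
qed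

lemma gsum_partition:
  assumes "gsummable I e" "finite K" "g ` I \<subseteq> K"
  shows   "gsum I c e = (\<Sum>k\<in>K. gsum {i \<in> I. g i = k} c e)"
proof (rule fps_ext)
  fix n
  have "fps_nth (gsum I c e) n = (\<Sum>k\<in>K. \<Sum>i | i \<in> {i. i \<in> I \<and> e i = int n} \<and> g i = k. c i)"
    unfolding gsum_def fps_nth_Abs_fps
    using assms by (subst sum.group[symmetric]) (auto intro: gsummable_fibre)
  also have "\<dots> = fps_nth (\<Sum>k\<in>K. gsum {i \<in> I. g i = k} c e) n"
    by (auto simp: gsum_def fps_sum_nth intro!: sum.cong)
  finally show "fps_nth (gsum I c e) n = fps_nth (\<Sum>k\<in>K. gsum {i \<in> I. g i = k} c e) n" .
qed

lemma gsummable_times: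
  assumes "gsummable I e" "gsummable J f"
  shows   "gsummable (I \<times> J) (\<lambda>(i, j). e i + f j)"
proof -
  have nonneg: "0 \<le> e i" "0 \<le> f j" if "i \<in> I" "j \<in> J" for i j
    using assms that by (auto simp: gsummable_def)
  have "finite {x \<in> I \<times> J. (case x of (i, j) \<Rightarrow> e i + f j) \<le> n}" for n
  proof (rule finite_subset)
    show "{x \<in> I \<times> J. (case x of (i, j) \<Rightarrow> e i + f j) \<le> n} \<subseteq>
        {i \<in> I. e i \<le> n} \<times> {j \<in> J. f j \<le> n}"
    proof clarsimp
      fix i j assume "i \<in> I" "j \<in> J" "e i + f j \<le> n"
      then show "e i \<le> n \<and> f j \<le> n" using nonneg[of i j] by linarith
    qed
    show "finite ({i \<in> I. e i \<le> n} \<times> {j \<in> J. f j \<le> n})"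
      using assms by (simp add: gsummable_def)
  qed
  then show ?thesis using nonneg by (auto simp: gsummable_def)
qed

lemma gsum_mult:
  assumes "gsummable I e" "gsummable J f"
  shows   "gsum I c e * gsum J d f = gsum (I \<times> J) (\<lambda>(i, j). c i * d j) (\<lambda>(i, j). e i + f j)"
proof (rule fps_ext)
  fix n
  define S where "S = {x. x \<in> I \<times> J \<and> (case x of (i, j) \<Rightarrow> e i + f j) = int n}"
  have fin: "finite S"
    unfolding S_def using gsummable_fibre[OF gsummable_times[OF assms]] by simp
  have nonneg: "e i \<ge> 0" "f j \<ge> 0" if "i \<in> I" "j \<in> J" for i j
    using assms that by (auto simp: gsummable_def)
  have fibre: "{x. x \<in> S \<and> nat (e (fst x)) = a} =
      {i. i \<in> I \<and> e i = int a} \<times> {j. j \<in> J \<and> f j = int (n - a)}" if "a \<in> {0..n}" for a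
    using that nonneg by (fastforce simp: S_def)
  have "fps_nth (gsum I c e * gsum J d f) n =
      (\<Sum>a=0..n. \<Sum>(i, j)\<in>{i. i \<in> I \<and> e i = int a} \<times> {j. j \<in> J \<and> f j = int (n - a)}. c i * d j)"
    by (simp add: fps_mult_nth gsum_def sum_product sum.cartesian_product)
  also have "\<dots> = (\<Sum>a=0..n. \<Sum>(i, j)\<in>{x. x \<in> S \<and> nat (e (fst x)) = a}. c i * d j)"
    using fibre by (intro sum.cong) auto
  also have "\<dots> = (\<Sum>(i, j)\<in>S. c i * d j)"
  proof (rule sum.group)
    show "(\<lambda>x. nat (e (fst x))) ` S \<subseteq> {0..n}"
    proof (clarsimp simp: S_def)
      fix i j assume "e i + f j = int n" "i \<in> I" "j \<in> J"
      then show "nat (e i) \<le> n" using nonneg(2)[of i j] by linarith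
    qed
  qed (use fin in auto)
  finally show "fps_nth (gsum I c e * gsum J d f) n =
      fps_nth (gsum (I \<times> J) (\<lambda>(i, j). c i * d j) (\<lambda>(i, j). e i + f j)) n"
    by (simp add: gsum_def S_def)
qed

lemma gsum_shift:
  assumes "\<And>i. i \<in> I \<Longrightarrow> 0 \<le> e i"
  shows   "gsum I c (\<lambda>i. e i + int d) = q ^ d * gsum I c e"
proof (rule fps_ext)
  fix n
  show "fps_nth (gsum I c (\<lambda>i. e i + int d)) n = fps_nth (q ^ d * gsum I c e) n"
  proof (cases "n < d")
    case True
    then have none: "{i. i \<in> I \<and> e i + int d = int n} = {}" using assms by fastforce
    show ?thesis using True unfolding gsum_def fps_nth_Abs_fps none
      by (simp add: fps_X_power_mult_nth)
  next
    case False
    then have "{i. i \<in> I \<and> e i + int d = int n} = {i. i \<in> I \<and> e i = int (n - d)}" by auto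
    then show ?thesis using False by (simp add: gsum_def fps_X_power_mult_nth)
  qed
qed

lemma gsum_uminus: "gsum I (\<lambda>i. - c i) e = - gsum I c e"
  by (simp add: gsum_def fps_eq_iff sum_negf)

lemma gsum_add: "gsum I (\<lambda>i. c i + d i) e = gsum I c e + gsum I d e"
  by (simp add: gsum_def fps_eq_iff sum.distrib)

lemma gsum_const_mult: "gsum I (\<lambda>i. a * c i) e = fps_const a * gsum I c e"
  by (simp add: gsum_def fps_eq_iff sum_distrib_left)

lemma gsum_compose_power:
  assumes "d > 0"
  shows   "gsum I c e oo q ^ d = gsum I c (\<lambda>i. int d * e i)"
proof (rule fps_ext)
  fix n
  show "fps_nth (gsum I c e oo q ^ d) n = fps_nth (gsum I c (\<lambda>i. int d * e i)) n"
  proof (cases "d dvd n")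
    case True
    then obtain k where k: "n = d * k" by auto
    then show ?thesis using assms by (simp add: nth_compose_power gsum_def)
  next
    case False
    then have "int d * e i \<noteq> int n" for i
      by (metis dvd_triv_left int_dvd_int_iff)
    then show ?thesis using assms False by (simp add: nth_compose_power gsum_def)
  qed
qed

text \<open>
  An involution of the index set that preserves exponents and reverses signs cancels the sum.
\<close>
lemma gsum_eq_zero:
  assumes "bij_betw h I I" "\<And>i. i \<in> I \<Longrightarrow> c (h i) = - c i" "\<And>i. i \<in> I \<Longrightarrow> e (h i) = e i"
  shows   "gsum I c e = 0"
proof -
  have "gsum I c e = gsum I (\<lambda>i. - c i) e"
    using gsum_reindex[OF assms(1), of c e] assms(2,3) by (simp cong: gsum_cong)
  then show ?thesis by (simp add: gsum_uminus)
qed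

text \<open>
  The tool for double theta series: on a coset of a sublattice, parametrised by \<open>h\<close>, the exponent and the
  sign separate into the two coordinates.
\<close>
lemma gsum_reindex_product:
  assumes "bij_betw h (UNIV \<times> UNIV) J" "gsummable UNIV e1" "gsummable UNIV e2"
  assumes c: "\<And>u v. c (h (u, v)) = s * (c1 u * c2 v)"
  assumes e: "\<And>u v. e (h (u, v)) = e1 u + e2 v + int d"
  shows   "gsum J c e = fps_const s * q ^ d * (gsum UNIV c1 e1 * gsum UNIV c2 e2)"
proof -
  have "gsum J c e = gsum (UNIV \<times> UNIV) (\<lambda>x. s * (case x of (u, v) \<Rightarrow> c1 u * c2 v))
      (\<lambda>x. (case x of (u, v) \<Rightarrow> e1 u + e2 v) + int d)"
    unfolding gsum_reindex[OF assms(1)] by (intro gsum_cong) (auto simp: c e)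
  also have "\<dots> = q ^ d * gsum (UNIV \<times> UNIV) (\<lambda>x. s * (case x of (u, v) \<Rightarrow> c1 u * c2 v))
      (\<lambda>x. case x of (u, v) \<Rightarrow> e1 u + e2 v)"
    by (rule gsum_shift) (use assms(2,3) in \<open>auto simp: gsummable_def\<close>)
  also have "\<dots> = q ^ d * (fps_const s * gsum (UNIV \<times> UNIV) (\<lambda>x. case x of (u, v) \<Rightarrow> c1 u * c2 v)
      (\<lambda>x. case x of (u, v) \<Rightarrow> e1 u + e2 v))"
    by (simp add: gsum_const_mult)
  finally show ?thesis
    using gsum_mult[OF assms(2,3), of c1 c2] by (simp add: mult_ac)
qed

section \<open>Theta series\<close>

definition int_sign :: "int \<Rightarrow> rat" where
  "int_sign n = (if even n then 1 else -1)"

lemma int_sign_add: "int_sign (m + n) = int_sign m * int_sign n"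
  and int_sign_diff: "int_sign (m - n) = int_sign m * int_sign n"
  and int_sign_uminus [simp]: "int_sign (- n) = int_sign n"
  by (auto simp: int_sign_def)

text \<open>
  The division by two is exact when \<open>A + B\<close> is even, which is the case in all applications.
\<close>
definition half_quad :: "int \<Rightarrow> int \<Rightarrow> int \<Rightarrow> int" where
  "half_quad A B n = (A * n\<^sup>2 + B * n) div 2"

text \<open>
  In Ramanujan's notation, \<open>theta_plus A B\<close> is \<open>f(a, b)\<close> and \<open>theta_minus A B\<close> is \<open>f(-a, -b)\<close>
  for \<open>a = q^((A+B)/2)\<close> and \<open>b = q^((A-B)/2)\<close>.
\<close>
definition theta_minus :: "int \<Rightarrow> int \<Rightarrow> rat fps" where
  "theta_minus A B = gsum UNIV int_sign (half_quad A B)"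

definition theta_plus :: "int \<Rightarrow> int \<Rightarrow> rat fps" where
  "theta_plus A B = gsum UNIV (\<lambda>_. 1) (half_quad A B)"

lemma double_half_quad:
  assumes "even (A + B)"
  shows   "2 * half_quad A B n = A * n\<^sup>2 + B * n"
proof -
  have "even (A * n\<^sup>2 + B * n)" using assms by auto
  then show ?thesis by (simp add: half_quad_def)
qed

text \<open>
  The linear lower bound makes the fibres finite, and it tells how many terms of a truncated theta series
  determine a given coefficient.
\<close>
lemma half_quad_bounds:
  assumes "even (A + B)" "\<bar>B\<bar> \<le> A" "0 < A"
  shows   "0 \<le> half_quad A B n" "\<bar>n\<bar> - 1 \<le> half_quad A B n"
proof -
  define t where "t = \<bar>n\<bar>"
  have t: "t \<ge> 0" "t \<noteq> 1 \<longrightarrow> t = 0 \<or> t \<ge> 2" "n\<^sup>2 = t * t" by (auto simp: t_def power2_eq_square)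
  have "\<bar>B * n\<bar> \<le> A * t" using assms by (simp add: abs_mult t_def mult_right_mono)
  then have "2 * half_quad A B n \<ge> A * (t * t) - A * t"
    using double_half_quad[OF assms(1), of n] t(3) by auto
  moreover have "A * (t * t) - A * t \<ge> t * t - t"
  proof -
    have "(A - 1) * (t * (t - 1)) \<ge> 0"
      using assms(3) t(1) by (cases "t = 0") auto
    then show ?thesis by (simp add: algebra_simps)
  qed
  moreover have "t * t - t \<ge> 0" using t(1) by (cases "t = 0") (auto simp: algebra_simps)
  moreover have "(t - 1) * (t - 2) \<ge> 0" using t by (cases "t = 0 \<or> t = 1") auto
  ultimately show "0 \<le> half_quad A B n" "\<bar>n\<bar> - 1 \<le> half_quad A B n"
    by (auto simp: t_def[symmetric] algebra_simps)
qed

lemma gsummable_half_quad: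
  assumes "even (A + B)" "\<bar>B\<bar> \<le> A" "0 < A"
  shows   "gsummable I (half_quad A B)"
proof -
  have "finite {i \<in> I. half_quad A B i \<le> n}" for n
    by (rule finite_subset[of _ "{- \<bar>n + 1\<bar>..\<bar>n + 1\<bar>}"])
      (use half_quad_bounds(2)[OF assms] in \<open>auto, smt+\<close>)
  then show ?thesis
    using half_quad_bounds(1)[OF assms] by (simp add: gsummable_def)
qed

lemma bij_uminus_int: "bij_betw uminus (UNIV :: int set) UNIV"
  by (rule bij_betw_byWitness[of _ uminus]) auto

lemma theta_minus_sym: "theta_minus A (- B) = theta_minus A B"
  and theta_plus_sym: "theta_plus A (- B) = theta_plus A B"
  using gsum_reindex[OF bij_uminus_int, of int_sign "half_quad A B"]
    gsum_reindex[OF bij_uminus_int, of "\<lambda>_. 1" "half_quad A B"]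
  by (simp_all add: theta_minus_def theta_plus_def half_quad_def[abs_def])

lemma bij_sum_diff:
  "bij_betw (\<lambda>(u, v). (u + v, u - v)) (UNIV \<times> UNIV :: (int \<times> int) set)
     {x \<in> UNIV \<times> UNIV. (fst x + snd x) mod 2 = 0}"
  by (rule bij_betw_byWitness[of _ "\<lambda>(m, n). ((m + n) div 2, (m - n) div 2)"])
    (auto; presburger)+

lemma bij_swap_odd:
  "bij_betw (\<lambda>(m, n). (n, m)) {x \<in> UNIV \<times> UNIV :: (int \<times> int) set. (fst x + snd x) mod 2 = 1}
     {x \<in> UNIV \<times> UNIV. (fst x + snd x) mod 2 = 1}"
  by (rule bij_betw_byWitness[of _ "\<lambda>(m, n). (n, m)"]) (auto simp: add.commute)

text \<open>
  The exponent \<open>e(m) + e(n)\<close> is symmetric while the sign \<open>(-1)^n\<close> is not: pairs with \<open>m + n\<close> odd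
  cancel against their mirror images, and on pairs with \<open>m + n\<close> even the form separates in
  \<open>u = (m + n) / 2\<close> and \<open>v = (m - n) / 2\<close>.
\<close>
lemma theta_plus_mult_minus:
  assumes "even (A + B)" "\<bar>B\<bar> \<le> A" "0 < A"
  shows   "theta_plus A B * theta_minus A B = theta_minus (2 * A) (2 * B) * theta_minus (2 * A) 0"
proof -
  define e where "e = (\<lambda>(m, n). half_quad A B m + half_quad A B n)"
  define c where "c = (\<lambda>(m :: int, n). 1 * int_sign n)"
  have summable: "gsummable (UNIV \<times> UNIV) e"
    unfolding e_def by (intro gsummable_times gsummable_half_quad assms)
  have e_split: "e (u + v, u - v) = half_quad (2 * A) (2 * B) u + half_quad (2 * A) 0 v" for u v
    using double_half_quad[OF assms(1), of "u + v"] double_half_quad[OF assms(1), of "u - v"]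
      double_half_quad[of "2 * A" "2 * B" u] double_half_quad[of "2 * A" 0 v]
    by (auto simp: e_def power2_eq_square algebra_simps)
  have "theta_plus A B * theta_minus A B = gsum (UNIV \<times> UNIV) c e"
    unfolding theta_plus_def theta_minus_def c_def e_def
    by (intro gsum_mult gsummable_half_quad assms)
  also have "\<dots> = (\<Sum>k\<in>{0, 1}. gsum {x \<in> UNIV \<times> UNIV. (fst x + snd x) mod 2 = k} c e)"
    by (rule gsum_partition[OF summable]) auto
  also have "\<dots> = gsum {x \<in> UNIV \<times> UNIV. (fst x + snd x) mod 2 = 0} c e +
      gsum {x \<in> UNIV \<times> UNIV. (fst x + snd x) mod 2 = 1} c e"
    by simp
  also have "gsum {x \<in> UNIV \<times> UNIV. (fst x + snd x) mod 2 = 1} c e = 0"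
    by (rule gsum_eq_zero[OF bij_swap_odd]) (auto simp: c_def e_def int_sign_def, presburger+)
  also have "gsum {x \<in> UNIV \<times> UNIV. (fst x + snd x) mod 2 = 0} c e =
      theta_minus (2 * A) (2 * B) * theta_minus (2 * A) 0"
    unfolding theta_minus_def using assms
    by (subst gsum_reindex_product[OF bij_sum_diff, of "half_quad (2 * A) (2 * B)"
          "half_quad (2 * A) 0" c 1 int_sign int_sign e 0])
      (auto intro!: gsummable_half_quad simp: c_def e_split int_sign_diff)
  finally show ?thesis by simp
qed

section \<open>Gaussian binomial coefficients\<close>

fun qbinom :: "'a :: comm_ring_1 \<Rightarrow> nat \<Rightarrow> nat \<Rightarrow> 'a" where
  "qbinom p n 0 = 1"
| "qbinom p 0 (Suc j) = 0"
| "qbinom p (Suc n) (Suc j) = qbinom p n j + p ^ Suc j * qbinom p n (Suc j)"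

definition qpoch :: "'a :: comm_ring_1 \<Rightarrow> nat \<Rightarrow> 'a" where
  "qpoch p n = (\<Prod>k=1..n. 1 - p ^ k)"

lemma qpoch_0 [simp]: "qpoch p 0 = 1"
  and qpoch_Suc: "qpoch p (Suc n) = qpoch p n * (1 - p ^ Suc n)"
  by (simp_all add: qpoch_def)

lemma qbinom_eq_0: "n < j \<Longrightarrow> qbinom p n j = 0"
  by (induction p n j rule: qbinom.induct) auto

lemma qbinom_self [simp]: "qbinom p n n = 1"
  by (induction n) (auto simp: qbinom_eq_0)

text \<open>
  The second Pascal rule, obtained from the defining one by induction.
\<close>
lemma qbinom_Suc_Suc':
  assumes "j \<le> n"
  shows   "qbinom p (Suc n) (Suc j) = qbinom p n (Suc j) + p ^ (n - j) * qbinom p n j"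
  using assms
proof (induction n arbitrary: j)
  case (Suc n)
  show ?case
  proof (cases j)
    case 0
    have "qbinom p (Suc (Suc n)) 1 = 1 + p * qbinom p (Suc n) 1" by simp
    also have "qbinom p (Suc n) 1 = qbinom p n 1 + p ^ n" using Suc.IH[of 0] by simp
    also have "1 + p * (qbinom p n 1 + p ^ n) = qbinom p (Suc n) 1 + p ^ Suc n"
      by (simp add: algebra_simps)
    finally show ?thesis using 0 by simp
  next
    case (Suc i)
    show ?thesis
    proof (cases "j = Suc n")
      case True
      then show ?thesis by (simp add: qbinom_eq_0)
    next
      case False
      with Suc.prems have "j \<le> n" by simp
      with Suc have i: "i \<le> n" "n - i = Suc (n - j)" by auto
      have "qbinom p (Suc (Suc n)) (Suc j) = qbinom p (Suc n) j + p ^ Suc j * qbinom p (Suc n) (Suc j)"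
        by simp
      also have "qbinom p (Suc n) j = qbinom p n j + p ^ (n - i) * qbinom p n i"
        using Suc.IH[of i] i Suc by simp
      also have "qbinom p (Suc n) (Suc j) = qbinom p n (Suc j) + p ^ (n - j) * qbinom p n j"
        using Suc.IH[of j] \<open>j \<le> n\<close> by simp
      also have "qbinom p n j + p ^ (n - i) * qbinom p n i +
            p ^ Suc j * (qbinom p n (Suc j) + p ^ (n - j) * qbinom p n j) =
          (qbinom p n j + p ^ Suc j * qbinom p n (Suc j)) +
            p ^ (Suc n - j) * (qbinom p n i + p ^ j * qbinom p n j)"
        using i \<open>j \<le> n\<close> by (simp add: algebra_simps Suc_diff_le)
      also have "qbinom p n i + p ^ j * qbinom p n j = qbinom p (Suc n) j"
        using Suc by simp
      finally show ?thesis by simp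
    qed
  qed
qed simp

lemma qbinom_qpoch:
  assumes "j \<le> n"
  shows   "qbinom p n j * qpoch p j * qpoch p (n - j) = qpoch p n"
  using assms
proof (induction n arbitrary: j)
  case (Suc n)
  show ?case
  proof (cases j)
    case (Suc i)
    show ?thesis
    proof (cases "i = n")
      case True
      then show ?thesis using Suc by (simp add: qbinom_eq_0 del: qbinom.simps(3))
    next
      case False
      with Suc Suc.prems have i: "i < n" by simp
      then obtain d where d: "n = Suc (i + d)" using less_imp_Suc_add by blast
      have 1: "qbinom p n i * qpoch p i * qpoch p (Suc d) = qpoch p n"
        using Suc.IH[of i] d by (simp add: Suc_diff_le)
      have 2: "qbinom p n (Suc i) * qpoch p (Suc i) * qpoch p d = qpoch p n"
        using Suc.IH[of "Suc i"] d by simp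
      have "qbinom p (Suc n) j * qpoch p j * qpoch p (Suc n - j) =
          (qbinom p n i * qpoch p i * qpoch p (Suc d)) * (1 - p ^ Suc i) +
          p ^ Suc i * (qbinom p n (Suc i) * qpoch p (Suc i) * qpoch p d) * (1 - p ^ Suc d)"
        using Suc d by (simp add: qpoch_Suc algebra_simps)
      also have "\<dots> = qpoch p n * (1 - p ^ Suc n)"
        unfolding 1 2 using d by (simp add: algebra_simps power_add)
      finally show ?thesis by (simp add: qpoch_Suc)
    qed
  qed simp
qed simp

lemma Suc_choose_2: "Suc j choose 2 = (j choose 2) + j"
  by (simp add: numeral_2_eq_2)

lemma double_choose_2: "2 * int (j choose 2) = int j * (int j - 1)"
  by (induction j) (simp_all add: Suc_choose_2 algebra_simps)

text \<open>
  Stated homogeneously, so that \<open>x\<close> can later be a power of \<open>q\<close> or a constant polynomial and no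
  negative exponents occur.
\<close>
lemma qbinomial_theorem:
  "(\<Prod>k<n. x + z * p ^ k) = (\<Sum>j\<le>n. p ^ (j choose 2) * qbinom p n j * z ^ j * x ^ (n - j))"
proof (induction n arbitrary: z)
  case (Suc n)
  define P where "P = (\<lambda>j. p ^ (j choose 2))"
  have P: "P (Suc j) = P j * p ^ j" for j
    by (simp add: P_def Suc_choose_2 power_add)
  define S where "S = (\<Sum>j\<le>n. P j * qbinom p n j * (z * p) ^ j * x ^ (n - j))"
  have "(\<Prod>k<Suc n. x + z * p ^ k) = (x + z) * (\<Prod>k<n. x + (z * p) * p ^ k)"
    by (subst prod.lessThan_Suc_shift) (simp add: mult.assoc)
  also have "(\<Prod>k<n. x + (z * p) * p ^ k) = S"
    by (simp add: Suc.IH S_def P_def)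
  also have "(x + z) * S = x * S + z * S"
    by (simp add: algebra_simps)
  also have "x * S = (\<Sum>j\<le>n. P j * p ^ j * qbinom p n j * z ^ j * x ^ (Suc n - j))"
    unfolding S_def sum_distrib_left
    by (intro sum.cong) (auto simp: power_mult_distrib Suc_diff_le mult_ac)
  also have "\<dots> = (\<Sum>j\<le>Suc n. P j * p ^ j * qbinom p n j * z ^ j * x ^ (Suc n - j))"
    by (simp add: qbinom_eq_0)
  also have "\<dots> = x ^ Suc n +
      (\<Sum>j\<le>n. P (Suc j) * p ^ Suc j * qbinom p n (Suc j) * z ^ Suc j * x ^ (n - j))"
    by (subst sum.atMost_Suc_shift) (simp add: P_def numeral_2_eq_2)
  also have "z * S = (\<Sum>j\<le>n. P (Suc j) * qbinom p n j * z ^ Suc j * x ^ (n - j))"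
    unfolding S_def sum_distrib_left
    by (intro sum.cong) (auto simp: power_mult_distrib P mult_ac)
  also have "x ^ Suc n +
      (\<Sum>j\<le>n. P (Suc j) * p ^ Suc j * qbinom p n (Suc j) * z ^ Suc j * x ^ (n - j)) + \<dots> =
      x ^ Suc n + (\<Sum>j\<le>n. P (Suc j) * qbinom p (Suc n) (Suc j) * z ^ Suc j * x ^ (n - j))"
    by (simp add: sum.distrib[symmetric] algebra_simps)
  also have "\<dots> = (\<Sum>j\<le>Suc n. P j * qbinom p (Suc n) j * z ^ j * x ^ (Suc n - j))"
    by (subst sum.atMost_Suc_shift) (simp add: P_def numeral_2_eq_2)
  finally show ?case by (simp add: P_def)
qed (simp add: numeral_2_eq_2)

section \<open>The Jacobi triple product\<close>

lemma eq_upto_qpoch: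
  assumes "A > 0" "m \<le> K"
  shows   "eq_upto m (qpoch (q ^ A) K) (qpoch (q ^ A) m)"
  using assms(2)
proof (induction K rule: dec_induct)
  case (step K)
  have "1 * Suc K \<le> A * Suc K" using assms by (intro mult_le_mono1) auto
  then have "m < A * Suc K" using step by simp
  then have "eq_upto m (qpoch (q ^ A) K * (1 - q ^ (A * Suc K))) (qpoch (q ^ A) m * 1)"
    using step by (intro eq_upto_mult eq_upto_one_minus_power) auto
  then show ?case by (simp add: qpoch_Suc power_mult[symmetric] del: mult_Suc_right power_Suc)
qed auto

lemma qpoch_nth_0: "A > 0 \<Longrightarrow> fps_nth (qpoch (q ^ A) K) 0 = 1"
  by (induction K) (auto simp: qpoch_Suc power_mult[symmetric] simp del: power_Suc)

text \<open>
  In the middle of a long row, a Gaussian binomial coefficient agrees with \<open>1 / qpoch\<close> up to an order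
  that tends to infinity.
\<close>
lemma qbinom_limit:
  assumes "A > 0" "m \<le> j" "m + j \<le> n" "m \<le> K"
  shows   "eq_upto m (qbinom (q ^ A) n j * qpoch (q ^ A) K) 1"
proof -
  let ?P = "qpoch (q ^ A)"
  have P: "eq_upto m (?P k) (?P l)" if "m \<le> k" "m \<le> l" for k l
    using eq_upto_trans[OF eq_upto_qpoch eq_upto_sym[OF eq_upto_qpoch]] assms(1) that by blast
  have "eq_upto m (qbinom (q ^ A) n j * ?P K * ?P K) (qbinom (q ^ A) n j * ?P j * ?P (n - j))"
    using assms by (intro eq_upto_mult[OF eq_upto_mult[OF eq_upto_refl]] P) auto
  also have "qbinom (q ^ A) n j * ?P j * ?P (n - j) = ?P n"
    using assms by (intro qbinom_qpoch) auto
  also have "eq_upto m (?P n) (1 * ?P K)"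
    using assms P[of n K] by simp
  finally show ?thesis
    by (rule eq_upto_cancel) (use assms in \<open>simp add: qpoch_nth_0\<close>)
qed

lemma prod_lessThan_add:
  fixes f :: "nat \<Rightarrow> 'a :: comm_monoid_mult"
  shows "(\<Prod>k<m + n. f k) = (\<Prod>k<m. f k) * (\<Prod>k<n. f (m + k))"
  by (induction n) (simp_all add: mult_ac)

text \<open>
  The \<open>q\<close>-binomial theorem with \<open>2 * N\<close> factors, \<open>x = q^(A * N)\<close> and \<open>z = - q^a\<close>: the factors
  with index below \<open>N\<close> give the progression of \<open>b\<close>, the others that of \<open>a\<close>, after a common
  monomial \<open>q^C\<close> has been cancelled.
\<close>
lemma finite_triple_product:
  fixes a b N :: nat
  assumes "0 < a + b"
  defines "A \<equiv> a + b" and "e \<equiv> half_quad (int (a + b)) (int a - int b)"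
  shows   "(\<Prod>k<N. 1 - q ^ (a + A * k)) * (\<Prod>k<N. 1 - q ^ (b + A * k)) =
    (\<Sum>j\<le>2 * N. fps_const (int_sign (int j - int N)) * q ^ nat (e (int j - int N)) *
       qbinom (q ^ A) (2 * N) j)"
proof -
  define p :: "rat fps" where "p = q ^ A"
  define C where "C = a * N + A * (N choose 2) + A * N * N"
  have p_pow: "p ^ k = q ^ (A * k)" for k by (simp add: p_def power_mult)
  have sign: "(- 1 :: rat fps) ^ k = fps_const (int_sign (int k))" for k
    by (induction k) (auto simp: int_sign_def)
  have e: "e n \<ge> 0" "2 * e n = int A * n\<^sup>2 + (int a - int b) * n" for n
    using half_quad_bounds(1)[of "int A" "int a - int b" n]
      double_half_quad[of "int A" "int a - int b" n] assms
    by (auto simp: A_def e_def)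
  have "(\<Prod>k<2 * N. p ^ N + (- (q ^ a)) * p ^ k) =
      (\<Prod>k<N. p ^ N + (- (q ^ a)) * p ^ k) * (\<Prod>k<N. p ^ N + (- (q ^ a)) * p ^ (N + k))"
    by (simp add: mult_2 prod_lessThan_add)
  also have "(\<Prod>k<N. p ^ N + (- (q ^ a)) * p ^ (N + k)) = (\<Prod>k<N. p ^ N * (1 - q ^ (a + A * k)))"
    by (intro prod.cong refl) (simp add: p_pow power_add algebra_simps)
  also have "\<dots> = q ^ (A * N * N) * (\<Prod>k<N. 1 - q ^ (a + A * k))"
    by (simp add: prod.distrib p_pow power_mult)
  also have "(\<Prod>k<N. p ^ N + (- (q ^ a)) * p ^ k) =
      (\<Prod>k<N. (- 1) * q ^ a * p ^ k * (1 - q ^ (b + A * (N - Suc k))))"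
  proof (intro prod.cong refl)
    fix k assume "k \<in> {..<N}"
    then obtain d where d: "N = Suc (k + d)" using less_imp_Suc_add by blast
    show "p ^ N + (- (q ^ a)) * p ^ k = (- 1) * q ^ a * p ^ k * (1 - q ^ (b + A * (N - Suc k)))"
      by (simp add: d p_def A_def power_add power_mult algebra_simps)
  qed
  also have "\<dots> = (\<Prod>k<N. (- 1) * q ^ a * p ^ k) * (\<Prod>k<N. 1 - q ^ (b + A * (N - Suc k)))"
    by (rule prod.distrib)
  also have "(\<Prod>k<N. (- 1) * q ^ a * p ^ k) = fps_const (int_sign (int N)) * q ^ (a * N + A * (N choose 2))"
  proof (induction N)
    case (Suc N)
    show ?case unfolding prod.lessThan_Suc Suc sign[symmetric]
      by (simp add: Suc_choose_2 p_pow power_add algebra_simps)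
  qed (simp add: int_sign_def numeral_2_eq_2)
  also have "(\<Prod>k<N. 1 - q ^ (b + A * (N - Suc k))) = (\<Prod>k<N. 1 - q ^ (b + A * k))"
    by (rule prod.nat_diff_reindex)
  finally have lhs: "(\<Prod>k<2 * N. p ^ N + (- (q ^ a)) * p ^ k) =
      fps_const (int_sign (int N)) * q ^ C *
        ((\<Prod>k<N. 1 - q ^ (a + A * k)) * (\<Prod>k<N. 1 - q ^ (b + A * k)))"
    by (simp add: C_def power_add mult_ac)
  have "(\<Prod>k<2 * N. p ^ N + (- (q ^ a)) * p ^ k) =
      (\<Sum>j\<le>2 * N. p ^ (j choose 2) * qbinom p (2 * N) j * (- (q ^ a)) ^ j * (p ^ N) ^ (2 * N - j))"
    by (rule qbinomial_theorem)
  also have "\<dots> = (\<Sum>j\<le>2 * N. fps_const (int_sign (int N)) * q ^ C *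
      (fps_const (int_sign (int j - int N)) * q ^ nat (e (int j - int N)) * qbinom p (2 * N) j))"
  proof (intro sum.cong refl)
    fix j assume j: "j \<in> {..2 * N}"
    have "int (A * (j choose 2) + a * j + A * N * (2 * N - j)) = int (C + nat (e (int j - int N)))"
    proof -
      have diff: "int (2 * N - j) = 2 * int N - int j" using j by auto
      have "2 * int (A * (j choose 2) + a * j + A * N * (2 * N - j)) =
          int A * (2 * int (j choose 2)) + 2 * int a * int j + 2 * int A * int N * (2 * int N - int j)"
        by (simp only: of_nat_add of_nat_mult diff) (simp add: algebra_simps)
      also have "\<dots> = 2 * int a * int N + int A * (2 * int (N choose 2)) + 2 * int A * int N * int N
          + 2 * e (int j - int N)"
        unfolding double_choose_2 e(2) A_def by (simp add: algebra_simps power2_eq_square)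
      also have "\<dots> = 2 * int (C + nat (e (int j - int N)))"
        using e(1) by (simp add: C_def algebra_simps)
      finally show ?thesis by simp
    qed
    then have exp: "A * (j choose 2) + a * j + A * N * (2 * N - j) = C + nat (e (int j - int N))"
      by linarith
    have "int_sign (int j) = int_sign (int N) * int_sign (int j - int N)"
      by (auto simp: int_sign_def)
    then have "(- (q ^ a)) ^ j = fps_const (int_sign (int N)) * fps_const (int_sign (int j - int N)) * q ^ (a * j)"
      by (subst power_minus) (simp add: sign power_mult)
    then have "p ^ (j choose 2) * qbinom p (2 * N) j * (- (q ^ a)) ^ j * (p ^ N) ^ (2 * N - j) =
        fps_const (int_sign (int N)) * fps_const (int_sign (int j - int N)) *
        q ^ (A * (j choose 2) + a * j + A * N * (2 * N - j)) * qbinom p (2 * N) j"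
      by (simp add: p_pow power_add power_mult mult_ac)
    then show "p ^ (j choose 2) * qbinom p (2 * N) j * (- (q ^ a)) ^ j * (p ^ N) ^ (2 * N - j) =
      fps_const (int_sign (int N)) * q ^ C *
      (fps_const (int_sign (int j - int N)) * q ^ nat (e (int j - int N)) * qbinom p (2 * N) j)"
      unfolding exp by (simp add: power_add mult_ac flip: fps_const_mult)
  qed
  also have "\<dots> = fps_const (int_sign (int N)) * q ^ C *
      (\<Sum>j\<le>2 * N. fps_const (int_sign (int j - int N)) * q ^ nat (e (int j - int N)) * qbinom p (2 * N) j)"
    by (simp add: sum_distrib_left)
  finally show ?thesis
    unfolding lhs by (simp add: p_def int_sign_def split: if_splits)
qed

lemma prod_progression:
  assumes "0 < a" "a < A"
  shows   "(\<Prod>k=1..A * N. (1 - q ^ k) ^ of_bool (k mod A = a)) = (\<Prod>k<N. 1 - q ^ (a + A * k))"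
proof -
  have "(\<Prod>k=1..A * N. (1 - q ^ k) ^ of_bool (k mod A = a)) =
      (\<Prod>k\<in>{k \<in> {1..A * N}. k mod A = a}. 1 - q ^ k)"
    by (subst prod.inter_filter) (auto intro: prod.cong)
  also have "\<dots> = (\<Prod>k<N. 1 - q ^ (a + A * k))"
  proof (rule prod.reindex_bij_witness[of _ "\<lambda>k. a + A * k" "\<lambda>k. k div A"])
    fix k assume k: "k \<in> {k \<in> {1..A * N}. k mod A = a}"
    then have "a + A * (k div A) = k" using mult_div_mod_eq[of A k] by simp
    moreover have "k div A < N"
    proof (rule ccontr)
      assume "\<not> k div A < N"
      then have "A * N \<le> A * (k div A)" by (intro mult_le_mono2) simp
      moreover have "k \<le> A * N" using k by simp
      ultimately show False using \<open>a + A * (k div A) = k\<close> assms(1) by linarith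
    qed
    ultimately show "a + A * (k div A) = k" "k div A \<in> {..<N}" "1 - q ^ (a + A * (k div A)) = 1 - q ^ k"
      by auto
  next
    fix k assume k: "k \<in> {..<N}"
    then have "A * Suc k \<le> A * N" by (intro mult_le_mono2) auto
    then show "(a + A * k) div A = k" "a + A * k \<in> {k \<in> {1..A * N}. k mod A = a}"
      using assms by auto
  qed
  finally show ?thesis .
qed

lemma prod_multiples:
  assumes "0 < A"
  shows   "(\<Prod>k=1..A * N. (1 - q ^ k) ^ of_bool (A dvd k)) = qpoch (q ^ A) N"
proof -
  have "(\<Prod>k=1..A * N. (1 - q ^ k) ^ of_bool (A dvd k)) =
      (\<Prod>k\<in>{k \<in> {1..A * N}. A dvd k}. 1 - q ^ k)"
    by (subst prod.inter_filter) (auto intro: prod.cong)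
  also have "\<dots> = qpoch (q ^ A) N"
    unfolding qpoch_def
    using assms
    by (intro prod.reindex_bij_witness[of _ "\<lambda>k. A * k" "\<lambda>k. k div A"])
      (auto simp: power_mult Suc_le_eq)
  finally show ?thesis .
qed

text \<open>
  The limit of the finite form: a coefficient is determined by finitely many indices near the middle, where
  the Gaussian binomial coefficients have reached their limit.
\<close>
theorem jacobi_triple_product:
  assumes "0 < a" "0 < b"
  shows   "theta_minus (int (a + b)) (int a - int b) =
    eprod (\<lambda>k. of_bool (k mod (a + b) = a) + of_bool (k mod (a + b) = b) + of_bool ((a + b) dvd k))"
proof (rule fps_ext)
  fix n :: nat
  \<comment> \<open>\<open>N = 2 * n + 2\<close> puts all indices with exponent at most \<open>n\<close> at distance at least \<open>n\<close> from
    both ends of the row\<close>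
  define A e N where "A = a + b" and "e = half_quad (int (a + b)) (int a - int b)" and "N = 2 * n + 2"
  have A: "0 < A" "a < A" "b < A" using assms by (auto simp: A_def)
  have e: "e i \<ge> 0" "\<bar>i\<bar> - 1 \<le> e i" for i
    using half_quad_bounds[of "int A" "int a - int b" i] assms by (auto simp: A_def e_def)
  have "n \<le> A * N" using A by (simp add: N_def trans_le_add2)
  then have "fps_nth (eprod (\<lambda>k. of_bool (k mod A = a) + of_bool (k mod A = b) + of_bool (A dvd k))) n =
      fps_nth ((\<Prod>k<N. 1 - q ^ (a + A * k)) * (\<Prod>k<N. 1 - q ^ (b + A * k)) * qpoch (q ^ A) N) n"
    using A assms
    by (simp only: eprod_nth[OF \<open>n \<le> A * N\<close>] power_add prod.distrib prod_progression prod_multiples)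
  also have "\<dots> = (\<Sum>j\<le>2 * N. int_sign (int j - int N) *
      fps_nth (q ^ nat (e (int j - int N)) * (qbinom (q ^ A) (2 * N) j * qpoch (q ^ A) N)) n)"
    unfolding A_def e_def using assms
    by (simp add: finite_triple_product sum_distrib_right fps_sum_nth mult.assoc)
  also have "\<dots> = (\<Sum>j\<le>2 * N. if e (int j - int N) = int n then int_sign (int j - int N) else 0)"
  proof (intro sum.cong refl)
    fix j assume j: "j \<in> {..2 * N}"
    define i where "i = int j - int N"
    show "int_sign (int j - int N) *
        fps_nth (q ^ nat (e (int j - int N)) * (qbinom (q ^ A) (2 * N) j * qpoch (q ^ A) N)) n =
      (if e (int j - int N) = int n then int_sign (int j - int N) else 0)"
    proof (cases "\<bar>i\<bar> \<le> int n + 1")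
      case True
      have "eq_upto n (qbinom (q ^ A) (2 * N) j * qpoch (q ^ A) N) 1"
        by (rule qbinom_limit) (use True A in \<open>auto simp: i_def N_def\<close>)
      then have "fps_nth (q ^ nat (e i) * (qbinom (q ^ A) (2 * N) j * qpoch (q ^ A) N)) n =
          fps_nth (q ^ nat (e i) * 1) n"
        using eq_upto_mult[OF eq_upto_refl] unfolding eq_upto_def by blast
      then show ?thesis
        using e(1)[of i] by (auto simp: i_def[symmetric] fps_X_power_nth)
    next
      case False
      then have "int n < e i" using e(2)[of i] by linarith
      then show ?thesis by (auto simp: i_def[symmetric] fps_X_power_mult_nth)
    qed
  qed
  also have "\<dots> = (\<Sum>j\<in>{j \<in> {..2 * N}. e (int j - int N) = int n}. int_sign (int j - int N))"
    by (subst sum.inter_filter) auto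
  also have "\<dots> = (\<Sum>i | i \<in> UNIV \<and> e i = int n. int_sign i)"
  proof (rule sum.reindex_bij_witness[of _ "\<lambda>i. nat (i + int N)" "\<lambda>j. int j - int N"])
    fix i assume i: "i \<in> {i. i \<in> UNIV \<and> e i = int n}"
    then have "\<bar>i\<bar> \<le> int N" using e(2)[of i] by (auto simp: N_def)
    then show "int (nat (i + int N)) - int N = i"
      "nat (i + int N) \<in> {j \<in> {..2 * N}. e (int j - int N) = int n}"
      using i by auto
  qed auto
  finally show "fps_nth (theta_minus (int (a + b)) (int a - int b)) n = fps_nth
      (eprod (\<lambda>k. of_bool (k mod (a + b) = a) + of_bool (k mod (a + b) = b) + of_bool ((a + b) dvd k))) n"
    by (simp add: theta_minus_def gsum_def A_def e_def)
qed

section \<open>Products of two theta series\<close>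

lemma bij_sum_diff_odd:
  "bij_betw (\<lambda>(u, v). (u + v + 1, u - v)) (UNIV \<times> UNIV :: (int \<times> int) set)
     {x \<in> UNIV \<times> UNIV. (fst x + snd x) mod 2 = 1}"
  by (rule bij_betw_byWitness[of _ "\<lambda>(m, n). ((m + n) div 2, (m - n) div 2)"])
    (auto, (presburger+)?)

text \<open>
  Split the double sum by the parity of \<open>m + n\<close> and use the coordinates \<open>m + n\<close> and \<open>m - n\<close>; the
  sign is constant on either half, so two products of \<open>theta_plus\<close> result.
\<close>
lemma theta_minus_mult:
  assumes "even (A + B)" "even (A + C)" "\<bar>C\<bar> \<le> - B" "- B \<le> A" "0 < A" "A + B = 2 * int d"
  shows   "theta_minus A B * theta_minus A C =
    theta_plus (2 * A) (B + C) * theta_plus (2 * A) (B - C) -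
    q ^ d * (theta_plus (2 * A) (2 * A + B + C) * theta_plus (2 * A) (2 * A + B - C))"
proof -
  define e where "e = (\<lambda>(m, n). half_quad A B m + half_quad A C n)"
  define c where "c = (\<lambda>(m, n). int_sign m * int_sign n)"
  have summable: "gsummable (UNIV \<times> UNIV) e"
    unfolding e_def using assms by (intro gsummable_times gsummable_half_quad) auto
  have ev: "even (2 * A + (B + C))" "even (2 * A + (B - C))"
      "even (2 * A + (2 * A + B + C))" "even (2 * A + (2 * A + B - C))"
    using assms(1,2) by auto
  have e0: "e (u + v, u - v) = half_quad (2 * A) (B + C) u + half_quad (2 * A) (B - C) v + int 0" for u v
    using double_half_quad[OF assms(1), of "u + v"] double_half_quad[OF assms(2), of "u - v"]
      double_half_quad[OF ev(1), of u] double_half_quad[OF ev(2), of v]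
    unfolding e_def prod.case by (simp add: power2_eq_square algebra_simps)
  have e1: "e (u + v + 1, u - v) =
      half_quad (2 * A) (2 * A + B + C) u + half_quad (2 * A) (2 * A + B - C) v + int d" for u v
    using assms(6) double_half_quad[OF assms(1), of "u + v + 1"]
      double_half_quad[OF assms(2), of "u - v"]
      double_half_quad[OF ev(3), of u] double_half_quad[OF ev(4), of v]
    unfolding e_def prod.case by (simp add: power2_eq_square algebra_simps)
  have "theta_minus A B * theta_minus A C = gsum (UNIV \<times> UNIV) c e"
    unfolding theta_minus_def c_def e_def
    using assms by (intro gsum_mult gsummable_half_quad) auto
  also have "\<dots> = (\<Sum>k\<in>{0, 1}. gsum {x \<in> UNIV \<times> UNIV. (fst x + snd x) mod 2 = k} c e)"
    by (rule gsum_partition[OF summable]) auto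
  also have "\<dots> = gsum {x \<in> UNIV \<times> UNIV. (fst x + snd x) mod 2 = 0} c e +
      gsum {x \<in> UNIV \<times> UNIV. (fst x + snd x) mod 2 = 1} c e"
    by simp
  also have "gsum {x \<in> UNIV \<times> UNIV. (fst x + snd x) mod 2 = 0} c e =
      fps_const 1 * q ^ 0 * (theta_plus (2 * A) (B + C) * theta_plus (2 * A) (B - C))"
    unfolding theta_plus_def using assms(1-5) ev
    by (intro gsum_reindex_product[OF bij_sum_diff] gsummable_half_quad)
      (auto simp: c_def e0 int_sign_def)
  also have "gsum {x \<in> UNIV \<times> UNIV. (fst x + snd x) mod 2 = 1} c e =
      fps_const (- 1) * q ^ d *
        (theta_plus (2 * A) (2 * A + B + C) * theta_plus (2 * A) (2 * A + B - C))"
    unfolding theta_plus_def using assms(1-5) ev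
    by (intro gsum_reindex_product[OF bij_sum_diff_odd] gsummable_half_quad)
      (auto simp: c_def e1 int_sign_def)
  finally show ?thesis by (simp flip: fps_const_neg)
qed

lemma mod_3_cases: "(n :: int) mod 3 \<in> {0, 1, 2}"
  and mod_5_cases: "(n :: int) mod 5 \<in> {0, 1, 2, 3, 4}"
  by (simp; presburger)+

text \<open>
  A coset of the lattice \<open>m \<equiv> c * n\<close> modulo \<open>M\<close> is the image of \<open>f\<close> if every pair with
  \<open>m - c * n = M * k + r\<close> can be recovered from \<open>k\<close> and \<open>n\<close>.
\<close>
lemma bij_residue_class:
  fixes f :: "int \<times> int \<Rightarrow> int \<times> int" and c M r :: int
  assumes r: "0 \<le> r" "r < M"
    and form: "\<And>x. fst (f x) - c * snd (f x) = M * \<kappa> x + r"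
    and left: "\<And>x. g (\<kappa> x) (snd (f x)) = x"
    and right: "\<And>k n. f (g k n) = (c * n + M * k + r, n)"
  shows "bij_betw f (UNIV \<times> UNIV) {x \<in> UNIV \<times> UNIV. (fst x - c * snd x) mod M = r}"
proof (rule bij_betw_byWitness[of _ "\<lambda>x. g ((fst x - c * snd x) div M) (snd x)"])
  have "(M * k + r) div M = k" "(M * k + r) mod M = r" for k
    using r by simp_all
  then show "\<forall>x\<in>UNIV \<times> UNIV. g ((fst (f x) - c * snd (f x)) div M) (snd (f x)) = x"
    and "f ` (UNIV \<times> UNIV) \<subseteq> {x \<in> UNIV \<times> UNIV. (fst x - c * snd x) mod M = r}"
    by (auto simp: form left)
  have "c * n + M * ((m - c * n) div M) + (m - c * n) mod M = m" for m n
    using mult_div_mod_eq[of M "m - c * n"] by linarith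
  then show "\<forall>x\<in>{x \<in> UNIV \<times> UNIV. (fst x - c * snd x) mod M = r}.
      f (g ((fst x - c * snd x) div M) (snd x)) = x"
    by (auto simp: right)
qed simp

text \<open>
  The pairs \<open>(2a - b, a + 2b)\<close> are the Gaussian integers divisible by \<open>2 + i\<close>, a lattice of index five;
  the four other cosets are obtained from each other by multiplication with powers of \<open>i\<close>, which preserves the norm.
\<close>
lemma bij_gauss:
  "bij_betw (\<lambda>(a, b). (2 * a - b, a + 2 * b)) (UNIV \<times> UNIV :: (int \<times> int) set)
     {x \<in> UNIV \<times> UNIV. (fst x - 2 * snd x) mod 5 = 0}"
  "bij_betw (\<lambda>(a, b). (2 * a - b + 1, a + 2 * b)) (UNIV \<times> UNIV :: (int \<times> int) set)
     {x \<in> UNIV \<times> UNIV. (fst x - 2 * snd x) mod 5 = 1}"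
  "bij_betw (\<lambda>(a, b). (a + 2 * b, - (2 * a - b + 1))) (UNIV \<times> UNIV :: (int \<times> int) set)
     {x \<in> UNIV \<times> UNIV. (fst x - 2 * snd x) mod 5 = 2}"
  "bij_betw (\<lambda>(a, b). (- (a + 2 * b), 2 * a - b + 1)) (UNIV \<times> UNIV :: (int \<times> int) set)
     {x \<in> UNIV \<times> UNIV. (fst x - 2 * snd x) mod 5 = 3}"
  "bij_betw (\<lambda>(a, b). (- (2 * a - b + 1), - (a + 2 * b))) (UNIV \<times> UNIV :: (int \<times> int) set)
     {x \<in> UNIV \<times> UNIV. (fst x - 2 * snd x) mod 5 = 4}"
  subgoal
    by (rule bij_residue_class[where \<kappa> = "\<lambda>(a, b). - b" and g = "\<lambda>k n. (n + 2 * k, - k)"]) auto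
  subgoal
    by (rule bij_residue_class[where \<kappa> = "\<lambda>(a, b). - b" and g = "\<lambda>k n. (n + 2 * k, - k)"]) auto
  subgoal
    by (rule bij_residue_class[where \<kappa> = "\<lambda>(a, b). a" and g = "\<lambda>k n. (k, n + 2 * k + 1)"]) auto
  subgoal
    by (rule bij_residue_class[where \<kappa> = "\<lambda>(a, b). - a - 1" and g = "\<lambda>k n. (- k - 1, - n - 2 * k - 1)"]) auto
  subgoal
    by (rule bij_residue_class[where \<kappa> = "\<lambda>(a, b). b - 1" and g = "\<lambda>k n. (- n - 2 * k - 2, k + 1)"]) auto
  done

text \<open>
  The norm form \<open>m^2 + n^2\<close> summed over the cosets of the ideal \<open>(2 + i)\<close>: the ideal itself gives
  \<open>phi(-q^5)^2\<close>, and the four remaining cosets contribute equally.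
\<close>
lemma phi_squared:
  "theta_minus 2 0 ^ 2 = theta_minus 10 0 ^ 2 - 4 * q * (theta_minus 10 8 * theta_minus 10 (- 4))"
proof -
  define e where "e = (\<lambda>(m, n). half_quad 2 0 m + half_quad 2 0 n)"
  define c where "c = (\<lambda>(m, n). int_sign m * int_sign n)"
  define G where "G = (\<lambda>k. gsum {x \<in> UNIV \<times> UNIV. (fst x - 2 * snd x) mod 5 = k} c e)"
  have e: "e (m, n) = m\<^sup>2 + n\<^sup>2" for m n
    using double_half_quad[of 2 0 m] double_half_quad[of 2 0 n] by (simp add: e_def)
  have h: "half_quad 10 0 a = 5 * a\<^sup>2" "half_quad 10 8 a = 5 * a\<^sup>2 + 4 * a"
    "half_quad 10 (- 4) a = 5 * a\<^sup>2 - 2 * a" for a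
    using double_half_quad[of 10 0 a] double_half_quad[of 10 8 a] double_half_quad[of 10 "- 4" a]
    by simp_all
  have summable: "gsummable (UNIV \<times> UNIV) e"
    unfolding e_def by (intro gsummable_times gsummable_half_quad) auto
  have "theta_minus 2 0 ^ 2 = gsum (UNIV \<times> UNIV) c e"
    unfolding theta_minus_def c_def e_def power2_eq_square
    by (intro gsum_mult gsummable_half_quad) auto
  also have "\<dots> = (\<Sum>k\<in>{0, 1, 2, 3, 4}. G k)"
    unfolding G_def by (rule gsum_partition[OF summable]) (simp, use mod_5_cases in blast)
  also have "\<dots> = G 0 + (G 1 + G 2 + G 3 + G 4)" by simp
  also have "G 0 = fps_const 1 * q ^ 0 * (theta_minus 10 0 * theta_minus 10 0)"
    unfolding G_def theta_minus_def
    by (intro gsum_reindex_product[OF bij_gauss(1)] gsummable_half_quad)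
      (auto simp: c_def e h int_sign_def power2_eq_square algebra_simps)
  also have "G 1 = fps_const (- 1) * q ^ 1 * (theta_minus 10 8 * theta_minus 10 (- 4))"
    unfolding G_def theta_minus_def
    by (intro gsum_reindex_product[OF bij_gauss(2)] gsummable_half_quad)
      (auto simp: c_def e h int_sign_def power2_eq_square algebra_simps)
  also have "G 2 = fps_const (- 1) * q ^ 1 * (theta_minus 10 8 * theta_minus 10 (- 4))"
    unfolding G_def theta_minus_def
    by (intro gsum_reindex_product[OF bij_gauss(3)] gsummable_half_quad)
      (auto simp: c_def e h int_sign_def power2_eq_square algebra_simps)
  also have "G 3 = fps_const (- 1) * q ^ 1 * (theta_minus 10 8 * theta_minus 10 (- 4))"
    unfolding G_def theta_minus_def
    by (intro gsum_reindex_product[OF bij_gauss(4)] gsummable_half_quad)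
      (auto simp: c_def e h int_sign_def power2_eq_square algebra_simps)
  also have "G 4 = fps_const (- 1) * q ^ 1 * (theta_minus 10 8 * theta_minus 10 (- 4))"
    unfolding G_def theta_minus_def
    by (intro gsum_reindex_product[OF bij_gauss(5)] gsummable_half_quad)
      (auto simp: c_def e h int_sign_def power2_eq_square algebra_simps)
  finally show ?thesis
    by (simp add: power2_eq_square flip: fps_const_neg)
qed

lemma bij_mod3:
  "bij_betw (\<lambda>(x, y). (x + 2 * y, x - y)) (UNIV \<times> UNIV :: (int \<times> int) set)
     {x \<in> UNIV \<times> UNIV. (fst x - snd x) mod 3 = 0}"
  "bij_betw (\<lambda>(x, y). (x + 2 * y + 1, x - y)) (UNIV \<times> UNIV :: (int \<times> int) set)
     {x \<in> UNIV \<times> UNIV. (fst x - snd x) mod 3 = 1}"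
  "bij_betw (\<lambda>(x, y). (x + 2 * y - 1, x - y)) (UNIV \<times> UNIV :: (int \<times> int) set)
     {x \<in> UNIV \<times> UNIV. (fst x - snd x) mod 3 = 2}"
  "bij_betw (\<lambda>(x, y). (2 * y - x, 1 - x - y)) (UNIV \<times> UNIV :: (int \<times> int) set)
     {x \<in> UNIV \<times> UNIV. (fst x - snd x) mod 3 = 2}"
  subgoal
    by (rule bij_residue_class[where c = 1, simplified mult_1, where \<kappa> = "\<lambda>(x, y). y" and g = "\<lambda>k n. (n + k, k)"]) auto
  subgoal
    by (rule bij_residue_class[where c = 1, simplified mult_1, where \<kappa> = "\<lambda>(x, y). y" and g = "\<lambda>k n. (n + k, k)"]) auto
  subgoal
    by (rule bij_residue_class[where c = 1, simplified mult_1, where \<kappa> = "\<lambda>(x, y). y - 1" and g = "\<lambda>k n. (n + k + 1, k + 1)"]) auto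
  subgoal
    by (rule bij_residue_class[where c = 1, simplified mult_1, where \<kappa> = "\<lambda>(x, y). y - 1" and g = "\<lambda>k n. (- k - n, k + 1)"]) auto
  done

text \<open>
  This is \<open>f(-a, -1)\<close>; the reflection \<open>n \<mapsto> - 1 - n\<close>
  preserves exponents and reverses signs.
\<close>
lemma theta_minus_eq_zero: "A > 0 \<Longrightarrow> theta_minus A A = 0"
  unfolding theta_minus_def
  by (rule gsum_eq_zero[OF bij_betw_byWitness[of _ "\<lambda>n. - 1 - n" "\<lambda>n. - 1 - n"]])
    (auto simp: int_sign_def half_quad_def power2_eq_square algebra_simps)

text \<open>
  An instance of the quintuple product identity.  The form separates on each class of \<open>m - n\<close> modulo
  three; the class of \<open>1\<close> produces a factor \<open>theta_minus 30 30 = 0\<close>, the two others share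
  \<open>theta_minus 30 10\<close>.
\<close>
lemma quintuple_first:
  "theta_plus 5 3 * theta_minus 10 (- 4) =
     (theta_minus 15 (- 1) + q * theta_minus 15 (- 11)) * theta_minus 30 10"
proof -
  define e where "e = (\<lambda>(m, n). half_quad 5 3 m + half_quad 10 (- 4) n)"
  define c where "c = (\<lambda>(m :: int, n). 1 * int_sign n)"
  define G where "G = (\<lambda>k. gsum {x \<in> UNIV \<times> UNIV. (fst x - snd x) mod 3 = k} c e)"
  have dbl: "2 * e (m, n) = 5 * m\<^sup>2 + 3 * m + 10 * n\<^sup>2 - 4 * n" for m n
    using double_half_quad[of 5 3 m] double_half_quad[of 10 "- 4" n] by (simp add: e_def)
  have summable: "gsummable (UNIV \<times> UNIV) e"
    unfolding e_def by (intro gsummable_times gsummable_half_quad) auto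
  have "theta_plus 5 3 * theta_minus 10 (- 4) = gsum (UNIV \<times> UNIV) c e"
    unfolding theta_minus_def theta_plus_def c_def e_def
    by (intro gsum_mult gsummable_half_quad) auto
  also have "\<dots> = (\<Sum>k\<in>{0, 1, 2}. G k)"
    unfolding G_def by (rule gsum_partition[OF summable]) (simp, use mod_3_cases in blast)
  also have "\<dots> = G 0 + G 1 + G 2" by simp
  also have "G 0 = fps_const 1 * q ^ 0 * (theta_minus 15 (- 1) * theta_minus 30 10)"
    unfolding G_def theta_minus_def
  proof (intro gsum_reindex_product[OF bij_mod3(1)] gsummable_half_quad)
    fix u v
    show "e (case (u, v) of (x, y) \<Rightarrow> (x + 2 * y, x - y)) =
        half_quad 15 (- 1) u + half_quad 30 10 v + int 0"
      using dbl[of "u + 2 * v" "u - v"] double_half_quad[of 15 "- 1" u] double_half_quad[of 30 10 v]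
      by (simp add: power2_eq_square algebra_simps)
  qed (auto simp: c_def int_sign_def)
  also have "G 1 = fps_const 1 * q ^ 4 * (theta_minus 15 9 * theta_minus 30 30)"
    unfolding G_def theta_minus_def
  proof (intro gsum_reindex_product[OF bij_mod3(2)] gsummable_half_quad)
    fix u v
    show "e (case (u, v) of (x, y) \<Rightarrow> (x + 2 * y + 1, x - y)) =
        half_quad 15 9 u + half_quad 30 30 v + int 4"
      using dbl[of "u + 2 * v + 1" "u - v"] double_half_quad[of 15 9 u] double_half_quad[of 30 30 v]
      by (simp add: power2_eq_square algebra_simps)
  qed (auto simp: c_def int_sign_def)
  also have "G 2 = fps_const 1 * q ^ 1 * (theta_minus 15 (- 11) * theta_minus 30 (- 10))"
    unfolding G_def theta_minus_def
  proof (intro gsum_reindex_product[OF bij_mod3(3)] gsummable_half_quad)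
    fix u v
    show "e (case (u, v) of (x, y) \<Rightarrow> (x + 2 * y - 1, x - y)) =
        half_quad 15 (- 11) u + half_quad 30 (- 10) v + int 1"
      using dbl[of "u + 2 * v - 1" "u - v"] double_half_quad[of 15 "- 11" u] double_half_quad[of 30 "- 10" v]
      by (simp add: power2_eq_square algebra_simps)
  qed (auto simp: c_def int_sign_def)
  finally show ?thesis
    using theta_minus_sym[of 30 10] by (simp add: theta_minus_eq_zero algebra_simps)
qed

lemma quintuple_second:
  "theta_plus 5 1 * theta_minus 10 (- 8) =
     (theta_minus 15 (- 7) - q * theta_minus 15 (- 13)) * theta_minus 30 10"
proof -
  define e where "e = (\<lambda>(m, n). half_quad 5 1 m + half_quad 10 (- 8) n)"
  define c where "c = (\<lambda>(m :: int, n). 1 * int_sign n)"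
  define G where "G = (\<lambda>k. gsum {x \<in> UNIV \<times> UNIV. (fst x - snd x) mod 3 = k} c e)"
  have dbl: "2 * e (m, n) = 5 * m\<^sup>2 + m + 10 * n\<^sup>2 - 8 * n" for m n
    using double_half_quad[of 5 1 m] double_half_quad[of 10 "- 8" n] by (simp add: e_def)
  have summable: "gsummable (UNIV \<times> UNIV) e"
    unfolding e_def by (intro gsummable_times gsummable_half_quad) auto
  have "theta_plus 5 1 * theta_minus 10 (- 8) = gsum (UNIV \<times> UNIV) c e"
    unfolding theta_minus_def theta_plus_def c_def e_def
    by (intro gsum_mult gsummable_half_quad) auto
  also have "\<dots> = (\<Sum>k\<in>{0, 1, 2}. G k)"
    unfolding G_def by (rule gsum_partition[OF summable]) (simp, use mod_3_cases in blast)
  also have "\<dots> = G 0 + G 1 + G 2" by simp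
  also have "G 0 = fps_const 1 * q ^ 0 * (theta_minus 15 (- 7) * theta_minus 30 10)"
    unfolding G_def theta_minus_def
  proof (intro gsum_reindex_product[OF bij_mod3(1)] gsummable_half_quad)
    fix u v
    show "e (case (u, v) of (x, y) \<Rightarrow> (x + 2 * y, x - y)) =
        half_quad 15 (- 7) u + half_quad 30 10 v + int 0"
      using dbl[of "u + 2 * v" "u - v"] double_half_quad[of 15 "- 7" u] double_half_quad[of 30 10 v]
      by (simp add: power2_eq_square algebra_simps)
  qed (auto simp: c_def int_sign_def)
  also have "G 1 = fps_const 1 * q ^ 3 * (theta_minus 15 3 * theta_minus 30 30)"
    unfolding G_def theta_minus_def
  proof (intro gsum_reindex_product[OF bij_mod3(2)] gsummable_half_quad)
    fix u v
    show "e (case (u, v) of (x, y) \<Rightarrow> (x + 2 * y + 1, x - y)) =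
        half_quad 15 3 u + half_quad 30 30 v + int 3"
      using dbl[of "u + 2 * v + 1" "u - v"] double_half_quad[of 15 3 u] double_half_quad[of 30 30 v]
      by (simp add: power2_eq_square algebra_simps)
  qed (auto simp: c_def int_sign_def)
  also have "G 2 = fps_const (- 1) * q ^ 1 * (theta_minus 15 (- 13) * theta_minus 30 (- 10))"
    unfolding G_def theta_minus_def
  proof (intro gsum_reindex_product[OF bij_mod3(4)] gsummable_half_quad)
    fix u v
    show "e (case (u, v) of (x, y) \<Rightarrow> (2 * y - x, 1 - x - y)) =
        half_quad 15 (- 13) u + half_quad 30 (- 10) v + int 1"
      using dbl[of "2 * v - u" "1 - u - v"] double_half_quad[of 15 "- 13" u] double_half_quad[of 30 "- 10" v]
      by (simp add: power2_eq_square algebra_simps)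
  qed (auto simp: c_def int_sign_def)
  finally show ?thesis
    using theta_minus_sym[of 30 10]
    by (simp add: theta_minus_eq_zero algebra_simps flip: fps_const_neg)
qed

section \<open>The five-dissection of \<open>E q\<close>\<close>

text \<open>
  With the Rogers-Ramanujan quotient \<open>r = (q; q^5)(q^4; q^5) / ((q^2; q^5)(q^3; q^5))\<close>, these two series
  are \<open>E(q^5) / r\<close> and \<open>E(q^5) * r\<close>.
\<close>
definition dissect0 :: "rat fps" where
  "dissect0 = theta_minus 15 (- 1) + q * theta_minus 15 (- 11)"

definition dissect2 :: "rat fps" where
  "dissect2 = theta_minus 15 (- 7) - q * theta_minus 15 (- 13)"

lemma theta_minus_compose_power:
  assumes "d > 0" "even (A + B)"
  shows   "theta_minus A B oo q ^ d = theta_minus (int d * A) (int d * B)"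
proof -
  have "int d * half_quad A B n = half_quad (int d * A) (int d * B) n" for n
  proof -
    have "2 * (int d * half_quad A B n) = int d * (A * n\<^sup>2 + B * n)"
      using double_half_quad[OF assms(2), of n] by simp
    also have "\<dots> = 2 * half_quad (int d * A) (int d * B) n"
      using assms(2) by (subst double_half_quad) (auto simp: algebra_simps)
    finally show ?thesis by simp
  qed
  then show ?thesis
    unfolding theta_minus_def gsum_compose_power[OF assms(1)] by presburger
qed

text \<open>
  Euler's pentagonal number theorem.
\<close>
lemma E_eq_theta: "E q = theta_minus 3 (- 1)"
proof -
  have "E q = eprod (\<lambda>k. of_bool (k mod (1 + 2) = 1) + of_bool (k mod (1 + 2) = 2) + of_bool (1 + 2 dvd k))"
    using E_eq_eprod[of 1] by (auto intro!: eprod_cong simp: dvd_eq_mod_eq_0)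
  then show ?thesis using jacobi_triple_product[of 1 2] by simp
qed

lemma gsum_reindex_shift:
  assumes "bij_betw h UNIV J" "gsummable UNIV e1"
  assumes c: "\<And>u. c (h u) = s * c1 u"
  assumes e: "\<And>u. e (h u) = e1 u + int d"
  shows   "gsum J c e = fps_const s * q ^ d * gsum UNIV c1 e1"
proof -
  have "gsum J c e = gsum UNIV (\<lambda>u. s * c1 u) (\<lambda>u. e1 u + int d)"
    unfolding gsum_reindex[OF assms(1)] by (intro gsum_cong) (auto simp: c e)
  also have "\<dots> = q ^ d * gsum UNIV (\<lambda>u. s * c1 u) e1"
    by (rule gsum_shift) (use assms(2) in \<open>auto simp: gsummable_def\<close>)
  finally show ?thesis by (simp add: gsum_const_mult mult_ac)
qed

lemma bij_mod5:
  fixes r k :: int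
  assumes "r mod 5 = k"
  shows   "bij_betw (\<lambda>m. 5 * m + r) UNIV {n \<in> UNIV. n mod 5 = k}"
  by (rule bij_betw_byWitness[of _ "\<lambda>n. (n - r) div 5"]) (use assms in \<open>auto, (presburger+)?\<close>)

text \<open>
  For exponents that depend on \<open>k\<close> modulo ten only, an identity of products is a finite check.
\<close>
lemma eprod_mod10_cong:
  assumes "\<And>k r. r \<in> {0, 1, 2, 3, 4, 5, 6, 7, 8, 9} \<Longrightarrow> k mod 10 = r \<Longrightarrow>
    k mod 2 = r mod 2 \<Longrightarrow> k mod 5 = r mod 5 \<Longrightarrow> e k = f k"
  shows   "eprod e = eprod f"
proof (rule eprod_cong)
  fix k :: nat
  have "k mod 2 = k mod 10 mod 2" "k mod 5 = k mod 10 mod 5"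
    by (simp_all add: mod_mod_cancel)
  moreover have "k mod 10 \<in> {0, 1, 2, 3, 4, 5, 6, 7, 8, 9}" by (simp; presburger)
  ultimately show "e k = f k" by (intro assms[of "k mod 10" k]) auto
qed

text \<open>
  The pentagonal exponents split by \<open>n\<close> modulo five; the classes of \<open>0\<close> and \<open>2\<close> combine to
  \<open>dissect0\<close>, those of \<open>3\<close> and \<open>4\<close> to \<open>dissect2\<close>.
\<close>
lemma E_dissection:
  "E q = (dissect0 oo q ^ 5) - q * (E (q ^ 5) oo q ^ 5) - q ^ 2 * (dissect2 oo q ^ 5)"
proof -
  define G where "G = (\<lambda>k. gsum {n \<in> UNIV. n mod 5 = k} int_sign (half_quad 3 (- 1)))"
  have dbl: "2 * half_quad 3 (- 1) n = 3 * n\<^sup>2 - n" for n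
    using double_half_quad[of 3 "- 1" n] by simp
  have "E q = gsum UNIV int_sign (half_quad 3 (- 1))"
    by (simp add: E_eq_theta theta_minus_def)
  also have "\<dots> = (\<Sum>k\<in>{0, 1, 2, 3, 4}. G k)"
    unfolding G_def
    by (rule gsum_partition[OF gsummable_half_quad]) (simp_all, use mod_5_cases in blast)
  also have "\<dots> = G 0 + G 1 + G 2 + G 3 + G 4" by simp
  also have "G 0 = fps_const 1 * q ^ 0 * theta_minus 75 (- 5)"
    unfolding G_def theta_minus_def
  proof (intro gsum_reindex_shift[OF bij_mod5] gsummable_half_quad)
    fix u show "half_quad 3 (- 1) (5 * u + 0) = half_quad 75 (- 5) u + int 0"
      using dbl[of "5 * u + 0"] double_half_quad[of 75 "- 5" u]
      by (simp add: power2_eq_square algebra_simps)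
  qed (auto simp: int_sign_def)
  also have "G 1 = fps_const (- 1) * q ^ 1 * theta_minus 75 25"
    unfolding G_def theta_minus_def
  proof (intro gsum_reindex_shift[OF bij_mod5] gsummable_half_quad)
    fix u show "half_quad 3 (- 1) (5 * u + 1) = half_quad 75 25 u + int 1"
      using dbl[of "5 * u + 1"] double_half_quad[of 75 25 u]
      by (simp add: power2_eq_square algebra_simps)
  qed (auto simp: int_sign_def)
  also have "G 2 = fps_const 1 * q ^ 5 * theta_minus 75 55"
    unfolding G_def theta_minus_def
  proof (intro gsum_reindex_shift[OF bij_mod5] gsummable_half_quad)
    fix u show "half_quad 3 (- 1) (5 * u + 2) = half_quad 75 55 u + int 5"
      using dbl[of "5 * u + 2"] double_half_quad[of 75 55 u]
      by (simp add: power2_eq_square algebra_simps)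
  qed (auto simp: int_sign_def)
  also have "G 3 = fps_const 1 * q ^ 7 * theta_minus 75 (- 65)"
    unfolding G_def theta_minus_def
  proof (intro gsum_reindex_shift[OF bij_mod5] gsummable_half_quad)
    fix u show "half_quad 3 (- 1) (5 * u + - 2) = half_quad 75 (- 65) u + int 7"
      using dbl[of "5 * u + - 2"] double_half_quad[of 75 "- 65" u]
      by (simp add: power2_eq_square algebra_simps)
  qed (auto simp: int_sign_def)
  also have "G 4 = fps_const (- 1) * q ^ 2 * theta_minus 75 (- 35)"
    unfolding G_def theta_minus_def
  proof (intro gsum_reindex_shift[OF bij_mod5] gsummable_half_quad)
    fix u show "half_quad 3 (- 1) (5 * u + - 1) = half_quad 75 (- 35) u + int 2"
      using dbl[of "5 * u + - 1"] double_half_quad[of 75 "- 35" u]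
      by (simp add: power2_eq_square algebra_simps)
  qed (auto simp: int_sign_def)
  finally have E: "E q = theta_minus 75 (- 5) - q * theta_minus 75 25 + q ^ 5 * theta_minus 75 55
      + q ^ 7 * theta_minus 75 (- 65) - q ^ 2 * theta_minus 75 (- 35)"
    by (simp flip: fps_const_neg)
  have "theta_minus 15 5 = E (q ^ 5)"
  proof -
    have "eprod (\<lambda>k. of_bool (k mod (10 + 5) = 10) + of_bool (k mod (10 + 5) = 5) + of_bool (10 + 5 dvd k)) =
        eprod (\<lambda>k. of_bool (5 dvd k))"
    proof (rule eprod_cong)
      fix k :: nat
      show "of_bool (k mod (10 + 5) = 10) + of_bool (k mod (10 + 5) = 5) + of_bool (10 + 5 dvd k) =
          (of_bool (5 dvd k) :: nat)"
        by (cases "5 dvd k") (auto; presburger)+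
    qed
    then show ?thesis
      using jacobi_triple_product[of 10 5] E_eq_eprod[of 5] by simp
  qed
  then have "theta_minus 75 25 = E (q ^ 5) oo q ^ 5"
    using theta_minus_compose_power[of 5 15 5] by simp
  moreover have "theta_minus 75 (- 5) + q ^ 5 * theta_minus 75 55 = dissect0 oo q ^ 5"
    using theta_minus_compose_power[of 5 15 "- 1"] theta_minus_compose_power[of 5 15 "- 11"]
      theta_minus_sym[of 75 55]
    by (simp add: dissect0_def fps_compose_add_distrib compose_power_mult)
  moreover have "theta_minus 75 (- 35) - q ^ 5 * theta_minus 75 (- 65) = dissect2 oo q ^ 5"
    using theta_minus_compose_power[of 5 15 "- 7"] theta_minus_compose_power[of 5 15 "- 13"]
    by (simp add: dissect2_def fps_compose_sub_distrib compose_power_mult)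
  ultimately show ?thesis
    unfolding E by (simp add: algebra_simps)
qed

section \<open>Theta functions of level ten\<close>

text \<open>
  The product \<open>(q^a; q^10)(q^(10-a); q^10)\<close>, which for \<open>a = 5\<close> is the square \<open>(q^5; q^10)^2\<close>.
\<close>
definition theta10 :: "nat \<Rightarrow> rat fps" where
  "theta10 a = eprod (\<lambda>k. of_bool (k mod 10 = a) + of_bool (k mod 10 = 10 - a))"

lemma theta10_nonzero [simp]: "theta10 a \<noteq> 0"
  by (simp add: theta10_def)

lemma theta_minus_10:
  assumes "0 < a" "a < 10"
  shows   "theta_minus 10 (2 * int a - 10) = theta10 a * E (q ^ 10)"
  using jacobi_triple_product[of a "10 - a"] assms E_eq_eprod[of 10]
  by (simp add: theta10_def eprod_mult of_nat_diff)

lemma E_1_theta10: "E q = theta10 1 * theta10 2 * theta10 3 * theta10 4 * E (q ^ 5)"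
proof -
  have "eprod (\<lambda>k. of_bool (1 dvd k)) = theta10 1 * theta10 2 * theta10 3 * theta10 4 * eprod (\<lambda>k. of_bool (5 dvd k))"
    unfolding theta10_def eprod_mult eprod_power dvd_eq_mod_eq_0
    by (rule eprod_mod10_cong) (elim insertE emptyE; simp)
  then show ?thesis
    using E_eq_eprod[of 1] E_eq_eprod[of 5] by simp
qed

lemma E_2_theta10: "E (q ^ 2) = theta10 2 * theta10 4 * E (q ^ 10)"
proof -
  have "eprod (\<lambda>k. of_bool (2 dvd k)) = theta10 2 * theta10 4 * eprod (\<lambda>k. of_bool (10 dvd k))"
    unfolding theta10_def eprod_mult eprod_power dvd_eq_mod_eq_0
    by (rule eprod_mod10_cong) (elim insertE emptyE; simp)
  then show ?thesis
    using E_eq_eprod[of 2] E_eq_eprod[of 10] by simp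
qed

lemma E_5_theta10: "E (q ^ 5) ^ 2 = theta10 5 * E (q ^ 10) ^ 2"
proof -
  have "eprod (\<lambda>k. of_bool (5 dvd k)) ^ 2 = theta10 5 * eprod (\<lambda>k. of_bool (10 dvd k)) ^ 2"
    unfolding theta10_def eprod_mult eprod_power dvd_eq_mod_eq_0
    by (rule eprod_mod10_cong) (elim insertE emptyE; simp)
  then show ?thesis
    using E_eq_eprod[of 5] E_eq_eprod[of 10] by simp
qed

lemma theta_minus_5_3: "theta_minus 5 3 = theta10 1 * theta10 4 * E (q ^ 5)"
proof -
  have "eprod (\<lambda>k. of_bool (k mod 5 = 4) + of_bool (k mod 5 = 1) + of_bool (5 dvd k)) = theta10 1 * theta10 4 * eprod (\<lambda>k. of_bool (5 dvd k))"
    unfolding theta10_def eprod_mult eprod_power dvd_eq_mod_eq_0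
    by (rule eprod_mod10_cong) (elim insertE emptyE; simp)
  then show ?thesis
    using jacobi_triple_product[of 4 1] E_eq_eprod[of 5] by simp
qed

lemma theta_minus_5_1: "theta_minus 5 1 = theta10 2 * theta10 3 * E (q ^ 5)"
proof -
  have "eprod (\<lambda>k. of_bool (k mod 5 = 3) + of_bool (k mod 5 = 2) + of_bool (5 dvd k)) = theta10 2 * theta10 3 * eprod (\<lambda>k. of_bool (5 dvd k))"
    unfolding theta10_def eprod_mult eprod_power dvd_eq_mod_eq_0
    by (rule eprod_mod10_cong) (elim insertE emptyE; simp)
  then show ?thesis
    using jacobi_triple_product[of 3 2] E_eq_eprod[of 5] by simp
qed

lemma theta_minus_2_0: "theta_minus 2 0 * E (q ^ 2) = E q ^ 2"
proof -
  have "eprod (\<lambda>k. of_bool (k mod 2 = 1) + of_bool (k mod 2 = 1) + of_bool (2 dvd k)) * eprod (\<lambda>k. of_bool (2 dvd k)) = eprod (\<lambda>k. of_bool (1 dvd k)) ^ 2"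
    unfolding theta10_def eprod_mult eprod_power dvd_eq_mod_eq_0
    by (rule eprod_mod10_cong) (elim insertE emptyE; simp)
  then show ?thesis
    using jacobi_triple_product[of 1 1, unfolded one_add_one] E_eq_eprod[of 1] E_eq_eprod[of 2] by simp
qed

lemma theta_minus_30_10: "theta_minus 30 10 = E (q ^ 10)"
proof -
  have "eprod (\<lambda>k. of_bool (k mod (20 + 10) = 20) + of_bool (k mod (20 + 10) = 10) + of_bool (20 + 10 dvd k)) =
      eprod (\<lambda>k. of_bool (10 dvd k))"
  proof (rule eprod_cong)
    fix k :: nat
    show "of_bool (k mod (20 + 10) = 20) + of_bool (k mod (20 + 10) = 10) + of_bool (20 + 10 dvd k) =
        (of_bool (10 dvd k) :: nat)"
    proof -
      define u where "u = k mod 30"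
      have u: "u < 30" "u mod 10 = k mod 10" by (simp_all add: u_def mod_mod_cancel)
      have "of_bool (u = 20) + of_bool (u = 10) + of_bool (u = 0) = (of_bool (u mod 10 = 0) :: nat)"
      proof (cases "u mod 10 = 0")
        case True
        then have "u = 20 \<or> u = 10 \<or> u = 0" using u(1) by presburger
        then show ?thesis by (elim disjE) simp_all
      qed auto
      then show ?thesis by (simp add: u(2) dvd_eq_mod_eq_0 flip: u_def)
    qed
  qed
  then show ?thesis
    using jacobi_triple_product[of 20 10] E_eq_eprod[of 10] by simp
qed

lemma E_nonzero [simp]: "j > 0 \<Longrightarrow> E (q ^ j) \<noteq> 0" "E q \<noteq> 0"
  using E_eq_eprod[of j] E_eq_eprod[of 1] by auto

context
  fixes B1 B2 B3 B4 B5 J :: "rat fps"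
  assumes B: "B1 = theta10 1" "B2 = theta10 2" "B3 = theta10 3" "B4 = theta10 4" "B5 = theta10 5"
    "J = E (q ^ 10)"
begin

text \<open>
  All ten products are quadratic in the nine series \<open>theta_plus 20 (2 * p)\<close>, by \<open>theta_minus_mult\<close>.
\<close>
lemma theta10_products:
  defines "e \<equiv> \<lambda>p. theta_plus 20 (2 * p)"
  shows "B1 * B2 * J\<^sup>2 = e 1 * e 7 - q * (e 3 * e 9)"
    "B1 * B3 * J\<^sup>2 = e 2 * e 6 - q * (e 4 * e 8)"
    "B1 * B4 * J\<^sup>2 = e 3 * e 5 - q * (e 5 * e 7)"
    "B1 * B5 * J\<^sup>2 = e 4 * e 4 - q * (e 6 * e 6)"
    "B2 * B3 * J\<^sup>2 = e 1 * e 5 - q ^ 2 * (e 5 * e 9)"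
    "B2 * B4 * J\<^sup>2 = e 2 * e 4 - q ^ 2 * (e 6 * e 8)"
    "B2 * B5 * J\<^sup>2 = e 3 * e 3 - q ^ 2 * (e 7 * e 7)"
    "B3 * B4 * J\<^sup>2 = e 1 * e 3 - q ^ 3 * (e 7 * e 9)"
    "B3 * B5 * J\<^sup>2 = e 2 * e 2 - q ^ 3 * (e 8 * e 8)"
    "B4 * B5 * J\<^sup>2 = e 1 * e 1 - q ^ 4 * (e 9 * e 9)"
proof -
  have e: "theta_plus 20 2 = e 1" "theta_plus 20 4 = e 2" "theta_plus 20 6 = e 3"
    "theta_plus 20 8 = e 4" "theta_plus 20 10 = e 5" "theta_plus 20 12 = e 6"
    "theta_plus 20 14 = e 7" "theta_plus 20 16 = e 8" "theta_plus 20 18 = e 9"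
    by (simp_all add: e_def)
  have t: "theta_minus 10 (- 8) = B1 * J" "theta_minus 10 (- 6) = B2 * J" "theta_minus 10 (- 4) = B3 * J"
    "theta_minus 10 (- 2) = B4 * J" "theta_minus 10 0 = B5 * J"
    using theta_minus_10[of 1] theta_minus_10[of 2] theta_minus_10[of 3] theta_minus_10[of 4]
      theta_minus_10[of 5] by (simp_all add: B)
  show "B1 * B2 * J\<^sup>2 = e 1 * e 7 - q * (e 3 * e 9)"
    using theta_minus_mult[of 10 "- 8" "- 6" 1] by (simp add: t e theta_plus_sym power2_eq_square mult_ac)
  show "B1 * B3 * J\<^sup>2 = e 2 * e 6 - q * (e 4 * e 8)"
    using theta_minus_mult[of 10 "- 8" "- 4" 1] by (simp add: t e theta_plus_sym power2_eq_square mult_ac)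
  show "B1 * B4 * J\<^sup>2 = e 3 * e 5 - q * (e 5 * e 7)"
    using theta_minus_mult[of 10 "- 8" "- 2" 1] by (simp add: t e theta_plus_sym power2_eq_square mult_ac)
  show "B1 * B5 * J\<^sup>2 = e 4 * e 4 - q * (e 6 * e 6)"
    using theta_minus_mult[of 10 "- 8" 0 1] by (simp add: t e theta_plus_sym power2_eq_square mult_ac)
  show "B2 * B3 * J\<^sup>2 = e 1 * e 5 - q ^ 2 * (e 5 * e 9)"
    using theta_minus_mult[of 10 "- 6" "- 4" 2] by (simp add: t e theta_plus_sym power2_eq_square mult_ac)
  show "B2 * B4 * J\<^sup>2 = e 2 * e 4 - q ^ 2 * (e 6 * e 8)"
    using theta_minus_mult[of 10 "- 6" "- 2" 2] by (simp add: t e theta_plus_sym power2_eq_square mult_ac)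
  show "B2 * B5 * J\<^sup>2 = e 3 * e 3 - q ^ 2 * (e 7 * e 7)"
    using theta_minus_mult[of 10 "- 6" 0 2] by (simp add: t e theta_plus_sym power2_eq_square mult_ac)
  show "B3 * B4 * J\<^sup>2 = e 1 * e 3 - q ^ 3 * (e 7 * e 9)"
    using theta_minus_mult[of 10 "- 4" "- 2" 3] by (simp add: t e theta_plus_sym power2_eq_square mult_ac)
  show "B3 * B5 * J\<^sup>2 = e 2 * e 2 - q ^ 3 * (e 8 * e 8)"
    using theta_minus_mult[of 10 "- 4" 0 3] by (simp add: t e theta_plus_sym power2_eq_square mult_ac)
  show "B4 * B5 * J\<^sup>2 = e 1 * e 1 - q ^ 4 * (e 9 * e 9)"
    using theta_minus_mult[of 10 "- 2" 0 4] by (simp add: t e theta_plus_sym power2_eq_square mult_ac)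
qed

text \<open>
  After multiplication by \<open>J^4\<close>, each relation becomes a polynomial identity in the nine series of
  \<open>theta10_products\<close>.
\<close>
lemma theta10_relations:
  "B1 * B4 * (B3 * B4 + q * (B1 * B2)) = B2 ^ 2 * B3 * B5"
  "B2 * B3 * (B3 * B4 - q * (B1 * B2)) = B1 * B4 ^ 2 * B5"
  "B5 ^ 2 * B1 * B3 + q * (B1 * B3) ^ 2 = (B2 * B4) ^ 2"
proof -
  note P = theta10_products
  have J: "J \<noteq> 0" by (simp add: B)
  have "J ^ 4 * (B1 * B4 * (B3 * B4 + q * (B1 * B2))) = J ^ 4 * (B2 ^ 2 * B3 * B5)"
    using P(1,3,5,7,8) by algebra
  then show "B1 * B4 * (B3 * B4 + q * (B1 * B2)) = B2 ^ 2 * B3 * B5" using J by simp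
  have "J ^ 4 * (B2 * B3 * (B3 * B4 - q * (B1 * B2))) = J ^ 4 * (B1 * B4 ^ 2 * B5)"
    using P(1,3,5,8,10) by algebra
  then show "B2 * B3 * (B3 * B4 - q * (B1 * B2)) = B1 * B4 ^ 2 * B5" using J by simp
  have "J ^ 4 * (B5 ^ 2 * B1 * B3 + q * (B1 * B3) ^ 2) = J ^ 4 * (B2 * B4) ^ 2"
    using P(2,4,6,9) by algebra
  then show "B5 ^ 2 * B1 * B3 + q * (B1 * B3) ^ 2 = (B2 * B4) ^ 2" using J by simp
qed

end

section \<open>Eta quotients of level ten\<close>

lemma theta_minus_10_minus:
  "theta_minus 10 (- 8) = theta10 1 * E (q ^ 10)" "theta_minus 10 (- 6) = theta10 2 * E (q ^ 10)"
  "theta_minus 10 (- 4) = theta10 3 * E (q ^ 10)" "theta_minus 10 (- 2) = theta10 4 * E (q ^ 10)"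
  "theta_minus 10 0 = theta10 5 * E (q ^ 10)"
  using theta_minus_10[of 1] theta_minus_10[of 2] theta_minus_10[of 3] theta_minus_10[of 4]
    theta_minus_10[of 5] by simp_all

text \<open>
  The series \<open>theta_plus 5 3\<close> links the two sides: by the quintuple product it divides \<open>dissect0\<close>, and
  its product with \<open>theta_minus 5 3\<close> is a product of theta series of level ten.
\<close>
lemma dissect0_theta10: "dissect0 * theta10 1 * theta10 4 = theta10 2 * theta10 3 * E (q ^ 5)"
proof -
  have "theta_plus 5 3 * (theta10 3 * E (q ^ 10)) = dissect0 * E (q ^ 10)"
    using quintuple_first by (simp add: theta_minus_10_minus dissect0_def theta_minus_30_10)
  then have 1: "theta_plus 5 3 * theta10 3 = dissect0"
    by (simp add: mult.assoc[symmetric])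
  have "theta_plus 5 3 * (theta10 1 * theta10 4 * E (q ^ 5)) = theta10 2 * (theta10 5 * E (q ^ 10) ^ 2)"
    using theta_plus_mult_minus[of 5 3] theta_minus_sym[of 10 6]
    by (simp add: theta_minus_10_minus theta_minus_5_3 power2_eq_square mult_ac)
  also have "\<dots> = theta10 2 * E (q ^ 5) ^ 2"
    by (simp only: E_5_theta10)
  finally have "(theta_plus 5 3 * theta10 1 * theta10 4) * E (q ^ 5) = (theta10 2 * E (q ^ 5)) * E (q ^ 5)"
    by (simp add: power2_eq_square mult_ac)
  then have "theta_plus 5 3 * theta10 1 * theta10 4 = theta10 2 * E (q ^ 5)" by simp
  moreover have "dissect0 * theta10 1 * theta10 4 = theta10 3 * (theta_plus 5 3 * theta10 1 * theta10 4)"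
    by (simp add: 1[symmetric] mult_ac)
  ultimately show ?thesis by (simp add: mult_ac)
qed

lemma dissect2_theta10: "dissect2 * theta10 2 * theta10 3 = theta10 1 * theta10 4 * E (q ^ 5)"
proof -
  have "theta_plus 5 1 * (theta10 1 * E (q ^ 10)) = dissect2 * E (q ^ 10)"
    using quintuple_second by (simp add: theta_minus_10_minus dissect2_def theta_minus_30_10)
  then have 1: "theta_plus 5 1 * theta10 1 = dissect2"
    by (simp add: mult.assoc[symmetric])
  have "theta_plus 5 1 * (theta10 2 * theta10 3 * E (q ^ 5)) = theta10 4 * (theta10 5 * E (q ^ 10) ^ 2)"
    using theta_plus_mult_minus[of 5 1] theta_minus_sym[of 10 2]
    by (simp add: theta_minus_10_minus theta_minus_5_1 power2_eq_square mult_ac)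
  also have "\<dots> = theta10 4 * E (q ^ 5) ^ 2"
    by (simp only: E_5_theta10)
  finally have "(theta_plus 5 1 * theta10 2 * theta10 3) * E (q ^ 5) = (theta10 4 * E (q ^ 5)) * E (q ^ 5)"
    by (simp add: power2_eq_square mult_ac)
  then have "theta_plus 5 1 * theta10 2 * theta10 3 = theta10 4 * E (q ^ 5)" by simp
  moreover have "dissect2 * theta10 2 * theta10 3 = theta10 1 * (theta_plus 5 1 * theta10 2 * theta10 3)"
    by (simp add: 1[symmetric] mult_ac)
  ultimately show ?thesis by (simp add: mult_ac)
qed

lemma compose_power_compose:
  "a > 0 \<Longrightarrow> b > 0 \<Longrightarrow> (F oo q ^ a) oo q ^ b = (F :: rat fps) oo q ^ (a * b)"
  by (rule fps_ext)
    (auto simp: nth_compose_power div_mult2_eq mult.commute dvd_div_iff_mult dest: dvd_mult_left)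

lemma theta10_compose_square:
  "theta10 1 * theta10 4 oo q ^ 2 = theta10 2" "theta10 2 * theta10 3 oo q ^ 2 = theta10 4"
proof -
  have cases: "j mod 10 \<in> {0, 1, 2, 3, 4, 5, 6, 7, 8, 9}" for j :: nat by (simp; presburger)
  have double: "2 * j mod 10 = 2 * (j mod 10) mod 10" for j :: nat by (simp add: mod_mult_right_eq)
  show "theta10 1 * theta10 4 oo q ^ 2 = theta10 2"
    unfolding theta10_def eprod_mult eprod_compose_power[OF zero_less_numeral]
  proof (rule eprod_cong, goal_cases)
    case (1 k)
    show ?case
    proof (cases "even k")
      case True
      then obtain j where j: "k = 2 * j" by blast
      show ?thesis using cases[of j] double[of j] unfolding j
        by (elim insertE emptyE) simp_all
    next
      case False
      then have "k mod 10 \<noteq> 2" "k mod 10 \<noteq> 8" by presburger+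
      then show ?thesis using False by simp
    qed
  qed
  show "theta10 2 * theta10 3 oo q ^ 2 = theta10 4"
    unfolding theta10_def eprod_mult eprod_compose_power[OF zero_less_numeral]
  proof (rule eprod_cong, goal_cases)
    case (1 k)
    show ?case
    proof (cases "even k")
      case True
      then obtain j where j: "k = 2 * j" by blast
      show ?thesis using cases[of j] double[of j] unfolding j
        by (elim insertE emptyE) simp_all
    next
      case False
      then have "k mod 10 \<noteq> 4" "k mod 10 \<noteq> 6" by presburger+
      then show ?thesis using False by simp
    qed
  qed
qed

abbreviation dissect0_sq :: "rat fps" where "dissect0_sq \<equiv> dissect0 oo q ^ 2"
abbreviation dissect2_sq :: "rat fps" where "dissect2_sq \<equiv> dissect2 oo q ^ 2"

lemma dissect0_sq_theta10: "dissect0_sq * theta10 2 = theta10 4 * E (q ^ 10)"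
proof -
  have "dissect0 * (theta10 1 * theta10 4) oo q ^ 2 = (theta10 2 * theta10 3) * E (q ^ 5) oo q ^ 2"
    using dissect0_theta10 by (simp add: mult.assoc)
  then show ?thesis
    by (simp only: compose_power_mult[OF zero_less_numeral, of dissect0]
        compose_power_mult[OF zero_less_numeral, of _ "E (q ^ 5)"] theta10_compose_square)
      (simp add: E_compose_power)
qed

lemma dissect2_sq_theta10: "dissect2_sq * theta10 4 = theta10 2 * E (q ^ 10)"
proof -
  have "dissect2 * (theta10 2 * theta10 3) oo q ^ 2 = (theta10 1 * theta10 4) * E (q ^ 5) oo q ^ 2"
    using dissect2_theta10 by (simp add: mult.assoc)
  then show ?thesis
    by (simp only: compose_power_mult[OF zero_less_numeral, of dissect2]
        compose_power_mult[OF zero_less_numeral, of _ "E (q ^ 5)"] theta10_compose_square)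
      (simp add: E_compose_power)
qed

text \<open>
  The unit part of \<open>xi_q = q * eta_q\<close>, which can be inverted.
\<close>
definition eta_q :: "rat fps" where
  "eta_q = E (q ^ 2) * E (q ^ 10) ^ 3 / (E q ^ 3 * E (q ^ 5))"

lemma E_nth_0: "j > 0 \<Longrightarrow> fps_nth (E (q ^ j)) 0 = 1" "fps_nth (E q) 0 = 1"
  using E_eq_eprod[of j] E_eq_eprod[of 1] by auto

lemma xi_eta: "xi_q = q * eta_q"
  by (simp add: xi_q_def eta_q_def)

lemma eta_q: "eta_q * (E q ^ 3 * E (q ^ 5)) = E (q ^ 2) * E (q ^ 10) ^ 3"
proof -
  have "E q ^ 3 * E (q ^ 5) dvd 1"
    by (simp add: fps_is_unit_iff fps_mult_nth_0 E_nth_0)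
  then show ?thesis unfolding eta_q_def
    by (intro dvd_div_mult_self) (meson dvd_trans one_dvd)
qed

lemma xi_eq: "xi_q * (E q ^ 3 * E (q ^ 5)) = q * (E (q ^ 2) * E (q ^ 10) ^ 3)"
  unfolding xi_eta mult.assoc eta_q ..

context
  fixes e1 e2 e5 e10 \<xi> C0 C2 D0 D2 :: "rat fps"
  assumes defs: "e1 = E q" "e2 = E (q ^ 2)" "e5 = E (q ^ 5)" "e10 = E (q ^ 10)" "\<xi> = xi_q"
    "C0 = dissect0" "C2 = dissect2" "D0 = dissect0_sq" "D2 = dissect2_sq"
begin

text \<open>
  The relations between the eta quotients of level ten and the components of the dissections.  In terms of the
  products \<open>B1, ..., B5\<close>, all series involved are monomials, apart from
  \<open>P, M = B3 * B4 \<plusminus> q * B1 * B2\<close>, which \<open>theta10_relations\<close> turns into monomials too; \<open>phi_squared\<close>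
  gives the value of \<open>1 + 4 * xi_q\<close>.
\<close>
lemma level10_relations:
  shows one_plus_4_xi: "(1 + 4 * \<xi>) * (e1 ^ 4 * e10 ^ 2) = e2 ^ 2 * e5 ^ 4"
    and one_plus_5_xi: "(1 + 5 * \<xi>) * (e1 ^ 5 * e10) = e2 ^ 5 * e5"
    and C0_C2: "C0 * C2 = e5 ^ 2"
    and D0_D2: "D0 * D2 = e10 ^ 2"
    and C0_D2_diff: "(1 + 4 * \<xi>) * (C0 ^ 2 * D2 - C2 ^ 2 * D0) = 4 * \<xi> * e5 ^ 2 * e10"
    and C0_D0_diff: "\<xi> * (C0 * D0 ^ 2 - q ^ 2 * (C2 * D2 ^ 2)) = q * (1 + 4 * \<xi>) * e5 * e10 ^ 2"
    and C0_D0_sum: "\<xi> * (1 + 4 * \<xi>) * (C0 ^ 3 * D0 + q ^ 2 * (C2 ^ 3 * D2)) =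
      q * ((1 + 4 * \<xi>) ^ 2 + 2 * \<xi> * (1 + 4 * \<xi>) + 4 * \<xi> ^ 2) * e5 ^ 3 * e10"
    and rogers_ramanujan_doubling:
      "q * (C2 * D2 ^ 2) * (D2 * e5 ^ 2 + C2 ^ 2 * e10) = (D2 * e5 ^ 2 - C2 ^ 2 * e10) * e5 * e10 ^ 2"
proof -
  obtain B1 B2 B3 B4 B5 where B: "B1 = theta10 1" "B2 = theta10 2" "B3 = theta10 3"
    "B4 = theta10 4" "B5 = theta10 5" by simp
  have nz: "B1 \<noteq> 0" "B2 \<noteq> 0" "B3 \<noteq> 0" "B4 \<noteq> 0" "B5 \<noteq> 0" "e1 \<noteq> 0" "e2 \<noteq> 0" "e5 \<noteq> 0" "e10 \<noteq> 0"
    by (simp_all add: B defs)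
  have e: "e1 = B1 * B2 * B3 * B4 * e5" "e2 = B2 * B4 * e10" "e5 ^ 2 = B5 * e10 ^ 2"
    using E_1_theta10 E_2_theta10 E_5_theta10 by (simp_all add: B defs)
  have C: "C0 * B1 * B4 = B2 * B3 * e5" "C2 * B2 * B3 = B1 * B4 * e5"
    "D0 * B2 = B4 * e10" "D2 * B4 = B2 * e10"
    using dissect0_theta10 dissect2_theta10 dissect0_sq_theta10 dissect2_sq_theta10
    by (simp_all add: B defs)
  have xi: "\<xi> * (e1 ^ 3 * e5) = q * (e2 * e10 ^ 3)"
    using xi_eq by (simp add: defs)
  define P M where "P = B3 * B4 + q * (B1 * B2)" and "M = B3 * B4 - q * (B1 * B2)"
  have I: "B1 * B4 * P = B2 ^ 2 * B3 * B5" "B2 * B3 * M = B1 * B4 ^ 2 * B5"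
    "B5 ^ 2 * B1 * B3 + q * (B1 * B3) ^ 2 = (B2 * B4) ^ 2"
    using theta10_relations by (simp_all add: B P_def M_def)
  obtain t where t: "t = theta_minus 2 0" by simp
  have "t ^ 2 = (B5 * e10) ^ 2 - 4 * q * (B1 * e10 * (B3 * e10))" "t * e2 = e1 ^ 2"
    using phi_squared theta_minus_2_0 theta_minus_sym[of 10 8]
    by (simp_all add: theta_minus_10_minus B defs t)
  then have phi: "e1 ^ 4 = (B5 ^ 2 - 4 * q * (B1 * B3)) * e10 ^ 2 * e2 ^ 2"
    by algebra
  have e1e10: "e1 * e10 = e2 * e5 * (B1 * B3)"
    using e by algebra
  have "e5 * ((1 + 4 * \<xi>) * (e1 ^ 4 * e10 ^ 2)) = e5 * (e2 ^ 2 * e5 ^ 4)"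
    using xi phi e(3) e1e10 by algebra
  then show x4: "(1 + 4 * \<xi>) * (e1 ^ 4 * e10 ^ 2) = e2 ^ 2 * e5 ^ 4"
    using nz by simp
  have "(e1 ^ 4 * e10 ^ 6) * (\<xi> * B5 ^ 2) = (e1 ^ 4 * e10 ^ 6) * (q * (1 + 4 * \<xi>) * (B1 * B3))"
    using x4 xi e(3) e1e10 by algebra
  then have xg: "\<xi> * B5 ^ 2 = q * (1 + 4 * \<xi>) * (B1 * B3)"
    using nz by simp
  show "C0 * C2 = e5 ^ 2"
  proof -
    have "(B1 * B2 * B3 * B4) * (C0 * C2) = (B1 * B2 * B3 * B4) * e5 ^ 2" using C by algebra
    then show ?thesis using nz by simp
  qed
  show D: "D0 * D2 = e10 ^ 2"
  proof -
    have "(B2 * B4) * (D0 * D2) = (B2 * B4) * e10 ^ 2" using C by algebra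
    then show ?thesis using nz by simp
  qed
  have "q * (1 + 5 * \<xi>) * (B1 * B3) ^ 2 = \<xi> * (B2 * B4) ^ 2"
    using xg I(3) by algebra
  then have "(q * (B1 * B3) ^ 2 * e5) * ((1 + 5 * \<xi>) * (e1 ^ 5 * e10)) =
      (q * (B1 * B3) ^ 2 * e5) * (e2 ^ 5 * e5)"
    using xi e1e10 e(2) by algebra
  then show "(1 + 5 * \<xi>) * (e1 ^ 5 * e10) = e2 ^ 5 * e5"
    using nz by simp
  have PM: "P * M = B2 * B4 * B5 ^ 2"
  proof -
    have "(B1 * B2 * B3 * B4) * (P * M) = (B1 * B2 * B3 * B4) * (B2 * B4 * B5 ^ 2)"
      using I(1,2) by algebra
    then show ?thesis using nz by simp
  qed
  have PMnz: "P \<noteq> 0" "M \<noteq> 0" using PM nz by auto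
  have 1: "C0 ^ 2 * D2 * M = P * e5 ^ 2 * e10"
  proof -
    have "(B1 ^ 2 * B2 * B3 * B4 ^ 3) * (C0 ^ 2 * D2 * M) = (B1 ^ 2 * B2 * B3 * B4 ^ 3) * (P * e5 ^ 2 * e10)"
      using C(1,4) I(1,2) by algebra
    then show ?thesis using nz by simp
  qed
  have 2: "C2 ^ 2 * D0 * P = M * e5 ^ 2 * e10"
  proof -
    have "(B2 ^ 3 * B3 ^ 2 * B1 * B4) * (C2 ^ 2 * D0 * P) = (B2 ^ 3 * B3 ^ 2 * B1 * B4) * (M * e5 ^ 2 * e10)"
      using C(2,3) I(1,2) by algebra
    then show ?thesis using nz by simp
  qed
  show "(1 + 4 * \<xi>) * (C0 ^ 2 * D2 - C2 ^ 2 * D0) = 4 * \<xi> * e5 ^ 2 * e10"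
  proof -
    have "P * M * (C0 ^ 2 * D2 - C2 ^ 2 * D0) = (P ^ 2 - M ^ 2) * e5 ^ 2 * e10"
      using 1 2 by algebra
    then have "B5 ^ 2 * (B2 * B4) * (C0 ^ 2 * D2 - C2 ^ 2 * D0) = 4 * q * (B1 * B2 * B3 * B4) * e5 ^ 2 * e10"
      unfolding PM by (simp add: P_def M_def power2_eq_square algebra_simps)
    then have "(B2 * B4) * (B5 ^ 2 * (C0 ^ 2 * D2 - C2 ^ 2 * D0)) = (B2 * B4) * (4 * q * (B1 * B3) * e5 ^ 2 * e10)"
      by (simp add: mult_ac)
    then have "B5 ^ 2 * (C0 ^ 2 * D2 - C2 ^ 2 * D0) = 4 * q * (B1 * B3) * e5 ^ 2 * e10"
      using nz by simp
    then have "B5 ^ 2 * ((1 + 4 * \<xi>) * (C0 ^ 2 * D2 - C2 ^ 2 * D0)) = B5 ^ 2 * (4 * \<xi> * e5 ^ 2 * e10)"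
      using xg by algebra
    then show ?thesis using nz by simp
  qed
  have 3: "C0 * D0 ^ 2 * (B1 * B2) = B3 * B4 * e5 * e10 ^ 2"
  proof -
    have "(B4 * B2) * (C0 * D0 ^ 2 * (B1 * B2)) = (B4 * B2) * (B3 * B4 * e5 * e10 ^ 2)"
      using C(1,3) by algebra
    then show ?thesis using nz by simp
  qed
  have 4: "C2 * D2 ^ 2 * (B3 * B4) = B1 * B2 * e5 * e10 ^ 2"
  proof -
    have "(B4 * B2) * (C2 * D2 ^ 2 * (B3 * B4)) = (B4 * B2) * (B1 * B2 * e5 * e10 ^ 2)"
      using C(2,4) by algebra
    then show ?thesis using nz by simp
  qed
  show "\<xi> * (C0 * D0 ^ 2 - q ^ 2 * (C2 * D2 ^ 2)) = q * (1 + 4 * \<xi>) * e5 * e10 ^ 2"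
  proof -
    have "(B1 * B2 * B3 * B4) * (C0 * D0 ^ 2 - q ^ 2 * (C2 * D2 ^ 2)) = (P * M) * e5 * e10 ^ 2"
      unfolding P_def M_def using 3 4 by algebra
    then have "(B2 * B4) * (B1 * B3 * (C0 * D0 ^ 2 - q ^ 2 * (C2 * D2 ^ 2))) = (B2 * B4) * (B5 ^ 2 * e5 * e10 ^ 2)"
      unfolding PM by (simp add: mult_ac)
    then have "B1 * B3 * (C0 * D0 ^ 2 - q ^ 2 * (C2 * D2 ^ 2)) = B5 ^ 2 * e5 * e10 ^ 2"
      using nz by simp
    then have "(B1 * B3) * (\<xi> * (C0 * D0 ^ 2 - q ^ 2 * (C2 * D2 ^ 2))) = (B1 * B3) * (q * (1 + 4 * \<xi>) * e5 * e10 ^ 2)"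
      using xg by algebra
    then show ?thesis using nz by simp
  qed
  show "\<xi> * (1 + 4 * \<xi>) * (C0 ^ 3 * D0 + q ^ 2 * (C2 ^ 3 * D2)) =
      q * ((1 + 4 * \<xi>) ^ 2 + 2 * \<xi> * (1 + 4 * \<xi>) + 4 * \<xi> ^ 2) * e5 ^ 3 * e10"
  proof -
    have 5: "C0 ^ 3 * D0 * (B1 * B2) * M = P * (B3 * B4) * e5 ^ 3 * e10"
    proof -
      have "(B4 * B2) * (C0 * D0 * (B1 * B2)) = (B4 * B2) * (D2 * (B3 * B4) * e5)"
        using C(1,3,4) by algebra
      then have "C0 * D0 * (B1 * B2) = D2 * (B3 * B4) * e5" using nz by simp
      then show ?thesis using 1 by algebra
    qed
    have 6: "C2 ^ 3 * D2 * (B3 * B4) * P = M * (B1 * B2) * e5 ^ 3 * e10"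
    proof -
      have "(B4 * B2) * (C2 * D2 * (B3 * B4)) = (B4 * B2) * (D0 * (B1 * B2) * e5)"
        using C(2,3,4) by algebra
      then have "C2 * D2 * (B3 * B4) = D0 * (B1 * B2) * e5" using nz by simp
      then show ?thesis using 2 by algebra
    qed
    obtain w N where w: "w = B1 * B2 * B3 * B4" and N: "N = P * M" by simp
    have "(C0 ^ 3 * D0 + q ^ 2 * (C2 ^ 3 * D2)) * (w * N) =
        (P ^ 2 * (B3 * B4) ^ 2 + q ^ 2 * (M ^ 2 * (B1 * B2) ^ 2)) * e5 ^ 3 * e10"
      unfolding w N using 5 6 by algebra
    also have "P ^ 2 * (B3 * B4) ^ 2 + q ^ 2 * (M ^ 2 * (B1 * B2) ^ 2) =
        N ^ 2 + 2 * q * (w * N) + 4 * q ^ 2 * w ^ 2"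
      unfolding N P_def M_def w by algebra
    finally have sum: "(C0 ^ 3 * D0 + q ^ 2 * (C2 ^ 3 * D2)) * (w * N) =
        (N ^ 2 + 2 * q * (w * N) + 4 * q ^ 2 * w ^ 2) * e5 ^ 3 * e10" .
    have "\<xi> * N = q * (1 + 4 * \<xi>) * w"
      unfolding N PM w using xg by algebra
    then have "(\<xi> * (w * N)) * (\<xi> * (1 + 4 * \<xi>) * (C0 ^ 3 * D0 + q ^ 2 * (C2 ^ 3 * D2))) =
        (\<xi> * (w * N)) * (q * ((1 + 4 * \<xi>) ^ 2 + 2 * \<xi> * (1 + 4 * \<xi>) + 4 * \<xi> ^ 2) * e5 ^ 3 * e10)"
      using sum by algebra
    moreover have "\<xi> \<noteq> 0" "w \<noteq> 0" "N \<noteq> 0" using xi nz PMnz by (auto simp: w N)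
    ultimately show ?thesis by simp
  qed
  show "q * (C2 * D2 ^ 2) * (D2 * e5 ^ 2 + C2 ^ 2 * e10) = (D2 * e5 ^ 2 - C2 ^ 2 * e10) * e5 * e10 ^ 2"
  proof -
    have "e10 * (C2 ^ 2 * e10 * P) = e10 * (M * e5 ^ 2 * D2)"
      using 2 D by algebra
    then have "C2 ^ 2 * e10 * P = M * e5 ^ 2 * D2" using nz by simp
    then have "P * (q * (C2 * D2 ^ 2) * (D2 * e5 ^ 2 + C2 ^ 2 * e10)) =
        P * ((D2 * e5 ^ 2 - C2 ^ 2 * e10) * e5 * e10 ^ 2)"
      using 4 P_def M_def by algebra
    then show ?thesis using PMnz by simp
  qed
qed

end

section \<open>The modular equation of degree five\<close>

text \<open>
  The modular equation in parametrised form.  For \<open>s\<close> and \<open>v\<close> as in the proof of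
  \<open>modular_equation\<close>, the first factor on the right vanishes; \<open>A\<close> and \<open>B\<close> are proportional to
  \<open>E(q)\<close> and \<open>E(q^2)\<close>.  The second factor is the quotient of a polynomial division.
\<close>
lemma modular_polynomial_factor:
  fixes s v :: "'a :: idom"
  defines "A \<equiv> s * v * (1 - v - v ^ 2)" and "B \<equiv> 1 - s * v ^ 2 - s ^ 2 * v ^ 4"
  shows "(1 + s - s ^ 2) * (s ^ 2 - 1) * B ^ 5
    - 5 * s * (s ^ 2 - 1) * (B ^ 4 * A - B ^ 3 * A ^ 2 + B ^ 2 * A ^ 3 - B * A ^ 4)
    - s * (s ^ 2 + 4 * s - 1) * A ^ 5 =
   (s ^ 2 * (s + 1) * v ^ 5 - (s - 1)) *
   ((s ^ 3 - 2 * s - 1)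
    + (5 * s ^ 2 + 5 * s ^ 3) * v
    + (5 * s + 5 * s ^ 2 - 10 * s ^ 3 - 10 * s ^ 4) * v ^ 2
    + (- 5 * s ^ 2 - 15 * s ^ 3 - 5 * s ^ 4 + 5 * s ^ 5) * v ^ 3
    + (- 5 * s ^ 2 + 15 * s ^ 3 + 25 * s ^ 4 - 5 * s ^ 6) * v ^ 4
    + (s ^ 2 + 14 * s ^ 3 - 4 * s ^ 4 - 5 * s ^ 5 + 15 * s ^ 6 + s ^ 7) * v ^ 5
    + (- 15 * s ^ 3 - 30 * s ^ 4 + 5 * s ^ 5 + 10 * s ^ 6) * v ^ 6
    + (- 5 * s ^ 3 + 5 * s ^ 4 + 10 * s ^ 5 - 10 * s ^ 6 - 20 * s ^ 7) * v ^ 7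
    + (20 * s ^ 4 - 10 * s ^ 5 - 10 * s ^ 6 + 5 * s ^ 7 + 5 * s ^ 8) * v ^ 8
    + (- 10 * s ^ 5 + 5 * s ^ 6 + 30 * s ^ 7 - 15 * s ^ 8) * v ^ 9
    + (- (s ^ 4) + 15 * s ^ 5 + 5 * s ^ 6 - 4 * s ^ 7 - 14 * s ^ 8 + s ^ 9) * v ^ 10
    + (5 * s ^ 5 - 25 * s ^ 7 + 15 * s ^ 8 + 5 * s ^ 9) * v ^ 11
    + (- 5 * s ^ 6 - 5 * s ^ 7 + 15 * s ^ 8 - 5 * s ^ 9) * v ^ 12
    + (10 * s ^ 7 - 10 * s ^ 8 - 5 * s ^ 9 + 5 * s ^ 10) * v ^ 13
    + (5 * s ^ 9 - 5 * s ^ 8) * v ^ 14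
    + (s ^ 8 - 2 * s ^ 10 + s ^ 11) * v ^ 15)"
  unfolding A_def B_def by algebra

text \<open>
  The negated coefficient of \<open>x^k\<close> in the denominator \<open>D\<close>.  It is evaluated at \<open>q\<close>, in its
  role as the variable \<open>y\<close>, at \<open>xi_q\<close> and at \<open>xi_q(q^5)\<close>.
\<close>
definition modular_coeff :: "nat \<Rightarrow> 'a :: comm_ring_1 \<Rightarrow> 'a" where
  "modular_coeff k y =
    (if k = 1 then 205 * y + 4300 * y^2 + 34000 * y^3 + 120000 * y^4 + 160000 * y^5
     else if k = 2 then 215 * y + 4475 * y^2 + 35000 * y^3 + 122000 * y^4 + 160000 * y^5
     else if k = 3 then 85 * y + 1750 * y^2 + 13525 * y^3 + 46500 * y^4 + 60000 * y^5
     else if k = 4 then 15 * y + 305 * y^2 + 2325 * y^3 + 7875 * y^4 + 10000 * y^5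
     else if k = 5 then y + 20 * y^2 + 150 * y^3 + 500 * y^4 + 625 * y^5
     else 0)"

text \<open>
  The parametrisation yields a homogeneous equation for the ratio of \<open>Q = (1 + 5 * Y) * (1 + 4 * X)\<close> and
  \<open>X\<close>.  Clearing this fractional linear substitution gives the polynomial with the coefficients
  \<open>modular_coeff\<close>.
\<close>
lemma modular_equation_moebius:
  fixes X Y :: "'a :: idom"
  defines "Q \<equiv> (1 + 5 * Y) * (1 + 4 * X)"
  shows "Y * Q ^ 5 - 5 * Y * (1 + 4 * Y) * (Q ^ 4 * X - Q ^ 3 * X ^ 2 + Q ^ 2 * X ^ 3 - Q * X ^ 4)
    - (1 + 4 * Y) * (1 + 5 * Y) * X ^ 5 =
    (1 + 5 * Y) * (modular_coeff 1 Y * X ^ 4 + modular_coeff 2 Y * X ^ 3 + modular_coeff 3 Y * X ^ 2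
      + modular_coeff 4 Y * X + modular_coeff 5 Y - X ^ 5)"
  unfolding Q_def modular_coeff_def by simp algebra

lemma E_2_dissection:
  "E (q ^ 2) = (dissect0_sq oo q ^ 5) - q ^ 2 * (E (q ^ 10) oo q ^ 5) - q ^ 4 * (dissect2_sq oo q ^ 5)"
proof -
  have "E q oo q ^ 2 = ((dissect0 oo q ^ 5) - q * (E (q ^ 5) oo q ^ 5) - q ^ 2 * (dissect2 oo q ^ 5)) oo q ^ 2"
    by (subst E_dissection) simp
  also have "\<dots> = (dissect0_sq oo q ^ 5) - q ^ 2 * (E (q ^ 10) oo q ^ 5) - q ^ 4 * (dissect2_sq oo q ^ 5)"
    by (simp add: fps_compose_sub_distrib compose_power_mult compose_power_power compose_power_compose
        E_compose_power flip: power_mult)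
  also have "E q oo q ^ 2 = E (q ^ 2)"
    using E_compose_power[of 1 2] by simp
  finally show ?thesis .
qed

lemma unit_E: "j > 0 \<Longrightarrow> E (q ^ j) * inverse (E (q ^ j)) = 1"
  by (rule inverse_mult_eq_1') (simp add: E_nth_0)

text \<open>
  Everything is expressed by two parameters: the Rogers-Ramanujan quotient \<open>r\<close>, and \<open>s\<close>, the quotient of
  \<open>r(q^2)\<close> and \<open>r(q)^2\<close>.  The doubling relation connects them, and \<open>xi_q\<close> is a rational
  function of \<open>s\<close>.  Replacing \<open>q\<close> by \<open>q^5\<close>, the dissections express \<open>E(q)\<close> and \<open>E(q^2)\<close>
  by the values \<open>S\<close>, \<open>v\<close> of the parameters at \<open>q^5\<close>; these in turn express both \<open>Y\<close> and
  \<open>xi_q\<close>.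
\<close>
lemma modular_equation:
  defines "Y \<equiv> xi_q oo q ^ 5"
  shows "xi_q ^ 5 = modular_coeff 1 Y * xi_q ^ 4 + modular_coeff 2 Y * xi_q ^ 3 +
    modular_coeff 3 Y * xi_q ^ 2 + modular_coeff 4 Y * xi_q + modular_coeff 5 Y"
proof -
  obtain e1 e2 e5 e10 \<xi> C0 C2 D0 D2 where defs: "e1 = E q" "e2 = E (q ^ 2)" "e5 = E (q ^ 5)"
    "e10 = E (q ^ 10)" "\<xi> = xi_q" "C0 = dissect0" "C2 = dissect2" "D0 = dissect0_sq" "D2 = dissect2_sq"
    by simp
  note rel = level10_relations[OF defs]
  have nz: "e1 \<noteq> 0" "e2 \<noteq> 0" "e5 \<noteq> 0" "e10 \<noteq> 0" by (simp_all add: defs)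
  have C2nz: "C2 \<noteq> 0" and C2_unit: "fps_nth C2 0 \<noteq> 0"
  proof -
    have "fps_nth (C0 * C2) 0 = 1" using rel(3) by (simp add: defs fps_power_zeroth E_nth_0)
    then show "fps_nth C2 0 \<noteq> 0" by auto
    then show "C2 \<noteq> 0" by auto
  qed
  \<comment> \<open>the Rogers-Ramanujan quotient and the parameter \<open>s\<close> at level ten\<close>
  define r s where "r = C2 * inverse e5" and "s = D2 * e5 ^ 2 * inverse (e10 * C2 ^ 2)"
  have r: "C2 = r * e5"
    using unit_E[of 5] by (simp add: r_def defs mult_ac)
  have "fps_nth (e10 * C2 ^ 2) 0 \<noteq> 0"
    using C2_unit by (simp add: defs E_nth_0 fps_power_zeroth)
  then have s: "D2 * e5 ^ 2 = s * (e10 * C2 ^ 2)"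
    using inverse_mult_eq_1[of "e10 * C2 ^ 2"] by (simp add: s_def mult.assoc)
  have rnz: "r \<noteq> 0" using r C2nz by auto
  have C0_r: "e5 = C0 * r"
  proof -
    have "e5 * e5 = e5 * (C0 * r)" using r rel(3) by algebra
    then show ?thesis using nz by simp
  qed
  have D2_r: "D2 = s * r ^ 2 * e10"
  proof -
    have "e5 ^ 2 * D2 = e5 ^ 2 * (s * r ^ 2 * e10)" using r s by algebra
    then show ?thesis using nz by simp
  qed
  have D0_r: "e10 = D0 * (s * r ^ 2)"
  proof -
    have "e10 * e10 = e10 * (D0 * (s * r ^ 2))" using D2_r rel(4) by algebra
    then show ?thesis using nz by simp
  qed
  have srel: "s ^ 2 * (s + 1) * (q * r ^ 5) = s - 1"
  proof -
    have "(r ^ 2 * e5 ^ 3 * e10 ^ 3) * (s ^ 2 * (s + 1) * (q * r ^ 5)) = (r ^ 2 * e5 ^ 3 * e10 ^ 3) * (s - 1)"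
      using rel(8) r D2_r by algebra
    then show ?thesis using nz rnz by simp
  qed
  have sxi: "4 * \<xi> * (1 + s - s ^ 2) = s ^ 2 - 1"
  proof -
    have 1: "C0 ^ 2 * D2 = s * (e5 ^ 2 * e10)" using C0_r D2_r by algebra
    have 2: "s * (C2 ^ 2 * D0) = e5 ^ 2 * e10" using r D0_r by algebra
    have "(e5 ^ 2 * e10) * (4 * \<xi> * (1 + s - s ^ 2)) = (e5 ^ 2 * e10) * (s ^ 2 - 1)"
      using rel(5) 1 2 by algebra
    then show ?thesis using nz by simp
  qed
  \<comment> \<open>the same quantities at \<open>q ^ 5\<close>\<close>
  obtain h where h: "h = (\<lambda>F :: rat fps. F oo q ^ 5)" by simp
  have hom: "h (F * G) = h F * h G" "h (F + G) = h F + h G" "h (F - G) = h F - h G"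
    "h (F ^ n) = h F ^ n" "h 1 = 1" "h (numeral k) = numeral k" "h q = q ^ 5" for F G n k
    by (simp_all add: h compose_power_mult compose_power_power fps_compose_add_distrib
        fps_compose_sub_distrib)
  have hnz: "h F \<noteq> 0" if "F \<noteq> 0" for F
  proof
    assume "h F = 0"
    then have "fps_nth (h F) (5 * n) = 0" for n by simp
    then have "fps_nth F n = 0" for n by (simp add: h nth_compose_power)
    then show False using that by (simp add: fps_eq_iff)
  qed
  obtain S u H1 H2 H5 H10 where SU: "S = h s" "u = h r" "H1 = h e1" "H2 = h e2" "H5 = h e5" "H10 = h e10"
    by simp
  have Hnz: "u \<noteq> 0" "H1 \<noteq> 0" "H2 \<noteq> 0" "H5 \<noteq> 0" "H10 \<noteq> 0" using hnz nz rnz by (simp_all add: SU)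
  have Y: "Y = h \<xi>" by (simp add: Y_def h defs)
  have H: "H1 = e5" "H2 = e10"
    using E_compose_power[of 1 5] E_compose_power[of 2 5] by (simp_all add: SU defs h)
  define v where "v = q * u"
  have Srel: "S ^ 2 * (S + 1) * v ^ 5 = S - 1"
    using arg_cong[OF srel, of h] by (simp add: hom SU v_def power_mult_distrib)
  have SY: "4 * Y * (1 + S - S ^ 2) = S ^ 2 - 1"
    using arg_cong[OF sxi, of h] by (simp add: hom SU Y)
  have Y5: "(1 + 5 * Y) * (H1 ^ 5 * H10) = H2 ^ 5 * H5"
    using arg_cong[OF rel(2), of h] by (simp add: hom SU Y)
  have E1: "e1 * u = H5 * (1 - v - v ^ 2)"
  proof -
    have "e1 = h C0 - q * H5 - q ^ 2 * h C2"
      using E_dissection by (simp add: defs h SU)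
    moreover have "H5 = h C0 * u" "h C2 = u * H5"
      using arg_cong[OF C0_r, of h] arg_cong[OF r, of h] by (simp_all add: hom SU)
    ultimately show ?thesis unfolding v_def by algebra
  qed
  have E2: "e2 * (S * u ^ 2) = H10 * (1 - S * v ^ 2 - S ^ 2 * v ^ 4)"
  proof -
    have "e2 = h D0 - q ^ 2 * H10 - q ^ 4 * h D2"
      using E_2_dissection by (simp add: defs h SU)
    moreover have "H10 = h D0 * (S * u ^ 2)" "h D2 = S * u ^ 2 * H10"
      using arg_cong[OF D0_r, of h] arg_cong[OF D2_r, of h] by (simp_all add: hom SU)
    ultimately show ?thesis unfolding v_def by algebra
  qed
  define A B Q where "A = S * v * (1 - v - v ^ 2)" and "B = 1 - S * v ^ 2 - S ^ 2 * v ^ 4"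
    and "Q = (1 + 5 * Y) * (1 + 4 * \<xi>)"
  have xi: "\<xi> * (e1 ^ 3 * e5) = q * (e2 * e10 ^ 3)"
    using xi_eq by (simp add: defs)
  have "(e1 ^ 3 * e10 ^ 2 * e5) * (q * (1 + 4 * \<xi>) * (e1 * e10 ^ 5)) = (e1 ^ 3 * e10 ^ 2 * e5) * (\<xi> * (e2 * e5 ^ 5))"
    using xi rel(1) by algebra
  then have xg: "q * (1 + 4 * \<xi>) * (e1 * e10 ^ 5) = \<xi> * (e2 * e5 ^ 5)"
    using nz by simp
  have "(e5 ^ 5 * e10 ^ 5) * (Q * q * e1 * H10) = (e5 ^ 5 * e10 ^ 5) * (\<xi> * e2 * H5)"
    using xg Y5 unfolding H Q_def by algebra
  then have Qx: "Q * q * e1 * H10 = \<xi> * e2 * H5"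
    using nz by simp
  have "(H5 * H10) * (A * Q) = (H5 * H10) * (B * \<xi>)"
  proof -
    have "(H5 * H10) * (A * Q) = S * v * (e1 * u) * H10 * Q"
      unfolding E1 A_def by (simp add: mult_ac)
    also have "\<dots> = S * u ^ 2 * (Q * q * e1 * H10)"
      unfolding v_def by (simp add: power2_eq_square mult_ac)
    also have "\<dots> = (e2 * (S * u ^ 2)) * \<xi> * H5"
      unfolding Qx by (simp add: mult_ac)
    also have "\<dots> = (H5 * H10) * (B * \<xi>)"
      unfolding E2 B_def by (simp add: mult_ac)
    finally show ?thesis .
  qed
  then have AQ: "A * Q = B * \<xi>"
    using Hnz by simp
  have Snz: "S \<noteq> 0" and Anz: "A \<noteq> 0"
  proof -
    show S: "S \<noteq> 0"
      using D0_r nz by (auto intro!: hnz simp: SU)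
    have "v \<noteq> 0" using Hnz by (simp add: v_def)
    moreover have "1 - v - v ^ 2 \<noteq> 0"
      using E1 nz Hnz by auto
    ultimately show "A \<noteq> 0" using S by (simp add: A_def)
  qed
  define \<kappa> where "\<kappa> = 1 + S - S ^ 2"
  have \<kappa>1: "4 * Y * \<kappa> = S ^ 2 - 1" using SY by (simp add: \<kappa>_def)
  have \<kappa>2: "(1 + 4 * Y) * \<kappa> = S" using SY unfolding \<kappa>_def by algebra
  have \<kappa>3: "4 * (1 + 5 * Y) * \<kappa> = S ^ 2 + 4 * S - 1" using SY unfolding \<kappa>_def by algebra
  \<comment> \<open>the relation \<open>Srel\<close> kills the first factor of \<open>modular_polynomial_factor\<close>\<close>
  have "\<kappa> * (S ^ 2 - 1) * B ^ 5
      - 5 * S * (S ^ 2 - 1) * (B ^ 4 * A - B ^ 3 * A ^ 2 + B ^ 2 * A ^ 3 - B * A ^ 4)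
      - S * (S ^ 2 + 4 * S - 1) * A ^ 5 = 0"
    unfolding \<kappa>_def A_def B_def modular_polynomial_factor by (simp add: Srel)
  then have "4 * \<kappa> ^ 2 * (Y * B ^ 5 - 5 * Y * (1 + 4 * Y) * (B ^ 4 * A - B ^ 3 * A ^ 2 + B ^ 2 * A ^ 3 - B * A ^ 4)
      - (1 + 4 * Y) * (1 + 5 * Y) * A ^ 5) = 0"
    using \<kappa>1 \<kappa>2 \<kappa>3 by algebra
  moreover have "\<kappa> \<noteq> 0" using \<kappa>2 Snz by auto
  ultimately have hom5: "Y * B ^ 5 - 5 * Y * (1 + 4 * Y) * (B ^ 4 * A - B ^ 3 * A ^ 2 + B ^ 2 * A ^ 3 - B * A ^ 4)
      - (1 + 4 * Y) * (1 + 5 * Y) * A ^ 5 = 0"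
    by simp
  \<comment> \<open>\<open>hom5\<close> is homogeneous of degree five in \<open>(A, B)\<close>, and \<open>A * Q = B * xi_q\<close>\<close>
  have "A ^ 5 * (Y * Q ^ 5 - 5 * Y * (1 + 4 * Y) * (Q ^ 4 * \<xi> - Q ^ 3 * \<xi> ^ 2 + Q ^ 2 * \<xi> ^ 3 - Q * \<xi> ^ 4)
      - (1 + 4 * Y) * (1 + 5 * Y) * \<xi> ^ 5) =
    Y * (A * Q) ^ 5 - 5 * Y * (1 + 4 * Y) * ((A * Q) ^ 4 * A * \<xi> - (A * Q) ^ 3 * A ^ 2 * \<xi> ^ 2
        + (A * Q) ^ 2 * A ^ 3 * \<xi> ^ 3 - (A * Q) * A ^ 4 * \<xi> ^ 4)
      - (1 + 4 * Y) * (1 + 5 * Y) * A ^ 5 * \<xi> ^ 5"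
    by algebra
  also have "\<dots> = \<xi> ^ 5 * (Y * B ^ 5 - 5 * Y * (1 + 4 * Y) * (B ^ 4 * A - B ^ 3 * A ^ 2 + B ^ 2 * A ^ 3 - B * A ^ 4)
      - (1 + 4 * Y) * (1 + 5 * Y) * A ^ 5)"
    unfolding AQ by algebra
  also have "\<dots> = 0" by (simp add: hom5)
  finally have "Y * Q ^ 5 - 5 * Y * (1 + 4 * Y) * (Q ^ 4 * \<xi> - Q ^ 3 * \<xi> ^ 2 + Q ^ 2 * \<xi> ^ 3 - Q * \<xi> ^ 4)
      - (1 + 4 * Y) * (1 + 5 * Y) * \<xi> ^ 5 = 0"
    using Anz by simp
  then have "(1 + 5 * Y) * (modular_coeff 1 Y * \<xi> ^ 4 + modular_coeff 2 Y * \<xi> ^ 3 + modular_coeff 3 Y * \<xi> ^ 2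
      + modular_coeff 4 Y * \<xi> + modular_coeff 5 Y - \<xi> ^ 5) = 0"
    unfolding Q_def modular_equation_moebius .
  moreover have "1 + 5 * Y \<noteq> 0" using Y5 Hnz by auto
  ultimately show ?thesis by (simp add: defs)
qed

section \<open>Sections of products\<close>

lemma section_fps_sum: "section_fps d r (sum F I) = (\<Sum>i\<in>I. section_fps d r (F i))"
  by (simp add: section_fps_def fps_eq_iff fps_sum_nth)

lemma section_fps_numeral_mult: "section_fps d r (numeral n * F) = numeral n * section_fps d r F"
  by (simp add: numeral_fps_const section_fps_const_mult)

text \<open>
  Every series is the sum of its five components, so that sections of a product are convolutions.
\<close>
lemma fps_decompose_sections:
  "F = (\<Sum>i<5. (section_fps 5 i F oo q ^ 5) * q ^ i)"
proof (rule fps_ext)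
  fix n
  have "fps_nth (\<Sum>i<5. (section_fps 5 i F oo q ^ 5) * q ^ i) n =
      (\<Sum>i<5. if i = n mod 5 then fps_nth F n else 0)"
    unfolding fps_sum_nth
  proof (intro sum.cong refl)
    fix i :: nat assume "i \<in> {..<5}"
    then have i: "i < 5" by simp
    show "fps_nth ((section_fps 5 i F oo q ^ 5) * q ^ i) n = (if i = n mod 5 then fps_nth F n else 0)"
    proof (cases "i = n mod 5")
      case True
      then have "i \<le> n" "n - i = 5 * (n div 5)" by (auto simp: minus_mod_eq_mult_div)
      then show ?thesis using True
        by (simp add: fps_X_power_mult_right_nth nth_compose_power section_fps_def)
    next
      case False
      have "\<not> 5 dvd n - i" if "i \<le> n"
      proof
        assume "5 dvd n - i"
        then obtain k where "n - i = 5 * k" by auto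
        then have "n = i + 5 * k" using that by simp
        then show False using False i by simp
      qed
      then show ?thesis using False
        by (auto simp: fps_X_power_mult_right_nth nth_compose_power)
    qed
  qed
  then show "fps_nth F n = fps_nth (\<Sum>i<5. (section_fps 5 i F oo q ^ 5) * q ^ i) n"
    by simp
qed

lemma section_fps_X_power_mult:
  assumes "i < 5" "r < 5"
  shows "section_fps 5 r (q ^ i * G) =
    (if i \<le> r then section_fps 5 (r - i) G else q * section_fps 5 (5 + r - i) G)"
proof (rule fps_ext)
  fix n
  show "fps_nth (section_fps 5 r (q ^ i * G)) n =
      fps_nth (if i \<le> r then section_fps 5 (r - i) G else q * section_fps 5 (5 + r - i) G) n"
  proof (cases "i \<le> r")
    case False
    then show ?thesis using assms
      by (cases n) (auto simp: section_fps_def fps_X_power_mult_nth intro!: arg_cong[of _ _ "fps_nth G"])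
  qed (auto simp: section_fps_def fps_X_power_mult_nth)
qed

lemma section_fps_mult:
  assumes "r < 5"
  shows "section_fps 5 r (F * G) = (\<Sum>i<5. section_fps 5 i F *
    (if i \<le> r then section_fps 5 (r - i) G else q * section_fps 5 (5 + r - i) G))"
proof -
  have "section_fps 5 r (F * G) = section_fps 5 r (\<Sum>i<5. (section_fps 5 i F oo q ^ 5) * (q ^ i * G))"
    by (subst fps_decompose_sections[of F]) (simp add: sum_distrib_right mult.assoc)
  also have "\<dots> = (\<Sum>i<5. section_fps 5 i F * section_fps 5 r (q ^ i * G))"
    unfolding section_fps_sum using assms by (intro sum.cong section_fps_compose_mult) auto
  finally show ?thesis
    using assms by (simp add: section_fps_X_power_mult)
qed

lemma section_fps_mult_explicit:
  defines "S \<equiv> section_fps 5"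
  shows "S 0 (F * G) = S 0 F * S 0 G + q * (S 1 F * S 4 G + S 2 F * S 3 G + S 3 F * S 2 G + S 4 F * S 1 G)"
    "S 1 (F * G) = S 0 F * S 1 G + S 1 F * S 0 G + q * (S 2 F * S 4 G + S 3 F * S 3 G + S 4 F * S 2 G)"
    "S 2 (F * G) = S 0 F * S 2 G + S 1 F * S 1 G + S 2 F * S 0 G + q * (S 3 F * S 4 G + S 4 F * S 3 G)"
    "S 3 (F * G) = S 0 F * S 3 G + S 1 F * S 2 G + S 2 F * S 1 G + S 3 F * S 0 G + q * (S 4 F * S 4 G)"
    "S 4 (F * G) = S 0 F * S 4 G + S 1 F * S 3 G + S 2 F * S 2 G + S 3 F * S 1 G + S 4 F * S 0 G"
proof -
  have "(\<Sum>i<5. f i) = f 0 + f 1 + f 2 + f 3 + f 4" for f :: "nat \<Rightarrow> rat fps"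
    by (simp add: eval_nat_numeral)
  then have M: "S r (F * G) = S 0 F * (if 0 \<le> r then S (r - 0) G else q * S (5 + r - 0) G)
      + S 1 F * (if 1 \<le> r then S (r - 1) G else q * S (5 + r - 1) G)
      + S 2 F * (if 2 \<le> r then S (r - 2) G else q * S (5 + r - 2) G)
      + S 3 F * (if 3 \<le> r then S (r - 3) G else q * S (5 + r - 3) G)
      + S 4 F * (if 4 \<le> r then S (r - 4) G else q * S (5 + r - 4) G)" if "r < 5" for r
    using section_fps_mult[OF that] by (simp only: S_def)
  show "S 0 (F * G) = S 0 F * S 0 G + q * (S 1 F * S 4 G + S 2 F * S 3 G + S 3 F * S 2 G + S 4 F * S 1 G)"
    "S 1 (F * G) = S 0 F * S 1 G + S 1 F * S 0 G + q * (S 2 F * S 4 G + S 3 F * S 3 G + S 4 F * S 2 G)"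
    "S 2 (F * G) = S 0 F * S 2 G + S 1 F * S 1 G + S 2 F * S 0 G + q * (S 3 F * S 4 G + S 4 F * S 3 G)"
    "S 3 (F * G) = S 0 F * S 3 G + S 1 F * S 2 G + S 2 F * S 1 G + S 3 F * S 0 G + q * (S 4 F * S 4 G)"
    "S 4 (F * G) = S 0 F * S 4 G + S 1 F * S 3 G + S 2 F * S 2 G + S 3 F * S 1 G + S 4 F * S 0 G"
    by (subst M; simp add: algebra_simps)+
qed

lemma section_fps_X_compose:
  assumes "i < 5" "r < 5"
  shows "section_fps 5 r (q ^ i * (F oo q ^ 5)) = (if i = r then F else 0)"
proof -
  have "section_fps 5 r (q ^ i) = (if i = r then 1 else 0)"
    using assms by (auto simp: section_fps_def fps_eq_iff fps_X_power_nth)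
  then show ?thesis
    using assms section_fps_compose_mult[of 5 r F "q ^ i"] by (simp add: mult.commute)
qed

lemma sections_E1:
  "section_fps 5 0 (E q) = dissect0" "section_fps 5 1 (E q) = - E (q ^ 5)"
  "section_fps 5 2 (E q) = - dissect2" "section_fps 5 3 (E q) = 0" "section_fps 5 4 (E q) = 0"
  using section_fps_X_compose[of 0 _ dissect0] section_fps_X_compose[of 1 _ "E (q ^ 5)"]
    section_fps_X_compose[of 2 _ dissect2]
  by (simp_all add: E_dissection section_fps_diff)

lemma sections_E2:
  "section_fps 5 0 (E (q ^ 2)) = dissect0_sq" "section_fps 5 1 (E (q ^ 2)) = 0"
  "section_fps 5 2 (E (q ^ 2)) = - E (q ^ 10)" "section_fps 5 3 (E (q ^ 2)) = 0"
  "section_fps 5 4 (E (q ^ 2)) = - dissect2_sq"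
  using section_fps_X_compose[of 0 _ dissect0_sq] section_fps_X_compose[of 2 _ "E (q ^ 10)"]
    section_fps_X_compose[of 4 _ dissect2_sq]
  by (simp_all add: E_2_dissection section_fps_diff)

text \<open>
  The sections that will be needed, computed from the dissections of \<open>E(q)\<close> and \<open>E(q^2)\<close>.
  They simplify because \<open>C0 * C2 = e5^2\<close> and \<open>D0 * D2 = e10^2\<close>.
\<close>
lemma sections_E_products:
  fixes e1 e2 e5 e10 \<xi> C0 C2 D0 D2 :: "rat fps"
  assumes defs: "e1 = E q" "e2 = E (q ^ 2)" "e5 = E (q ^ 5)" "e10 = E (q ^ 10)" "\<xi> = xi_q"
    "C0 = dissect0" "C2 = dissect2" "D0 = dissect0_sq" "D2 = dissect2_sq"
  defines "S \<equiv> section_fps 5"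
  shows "S 2 e2 = - e10"
    and "S 3 (e1 ^ 3) = 5 * e5 ^ 3"
    and "S 4 (e1 ^ 2 * e2) = e5 ^ 2 * e10 - (C0 ^ 2 * D2 - C2 ^ 2 * D0)"
    and "S 0 (e1 * e2 ^ 2) = q * (e5 * e10 ^ 2) + (C0 * D0 ^ 2 - q ^ 2 * (C2 * D2 ^ 2))"
    and "S 1 (e2 ^ 3) = 5 * q * e10 ^ 3"
    and "S 2 (e1 ^ 2) = - (e5 ^ 2)"
    and "S 3 (e1 * e2) = e5 * e10"
    and "S 4 (e2 ^ 2) = - (e10 ^ 2)"
    and "S 0 (e1 ^ 3 * e2) = (C0 ^ 3 * D0 + q ^ 2 * (C2 ^ 3 * D2)) +
      3 * q * e5 * (C0 ^ 2 * D2 - C2 ^ 2 * D0) - 5 * q * (e5 ^ 3 * e10)"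
    and "S 1 (e1 ^ 2 * e2 ^ 2) = q * (e5 ^ 2 * e10 ^ 2) + 2 * q * e10 * (C0 ^ 2 * D2 - C2 ^ 2 * D0)
      - 2 * e5 * (C0 * D0 ^ 2 - q ^ 2 * (C2 * D2 ^ 2))"
proof -
  note M = section_fps_mult_explicit[folded S_def]
  have s1: "S 0 e1 = C0" "S 1 e1 = - e5" "S 2 e1 = - C2" "S 3 e1 = 0" "S 4 e1 = 0"
    using sections_E1 by (simp_all add: defs S_def)
  have s2: "S 0 e2 = D0" "S 1 e2 = 0" "S 2 e2 = - e10" "S 3 e2 = 0" "S 4 e2 = - D2"
    using sections_E2 by (simp_all add: defs S_def)
  note rel = level10_relations(3,4)[OF defs]
  show "S 2 e2 = - e10" by (fact s2)
  have s11: "S 0 (e1 ^ 2) = C0 ^ 2" "S 1 (e1 ^ 2) = - 2 * (C0 * e5)" "S 2 (e1 ^ 2) = - (e5 ^ 2)"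
    "S 3 (e1 ^ 2) = 2 * (e5 * C2)" "S 4 (e1 ^ 2) = C2 ^ 2"
    unfolding power2_eq_square[of e1] M s1 using rel(1) by (simp_all add: power2_eq_square algebra_simps)
  have s22: "S 0 (e2 ^ 2) = D0 ^ 2" "S 1 (e2 ^ 2) = 2 * q * (e10 * D2)"
    "S 2 (e2 ^ 2) = - 2 * (D0 * e10)" "S 3 (e2 ^ 2) = q * D2 ^ 2" "S 4 (e2 ^ 2) = - (e10 ^ 2)"
    unfolding power2_eq_square[of e2] M s2 using rel(2) by (simp_all add: power2_eq_square algebra_simps)
  show "S 2 (e1 ^ 2) = - (e5 ^ 2)" "S 4 (e2 ^ 2) = - (e10 ^ 2)" using s11 s22 by simp_all
  show "S 3 (e1 * e2) = e5 * e10" unfolding M s1 s2 by simp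
  have cube: "F ^ 3 = F ^ 2 * F" for F :: "rat fps" by (simp add: power3_eq_cube power2_eq_square)
  have "S 0 (e1 ^ 3) = C0 ^ 3 - 3 * q * (e5 * C2 ^ 2)" "S 1 (e1 ^ 3) = - 3 * (C0 ^ 2 * e5) - q * C2 ^ 3"
    unfolding cube M s11 s1 by algebra+
  moreover have "S 2 (e1 ^ 3) = 0" unfolding cube M s11 s1 using rel(1) by algebra
  moreover have "S 3 (e1 ^ 3) = 5 * e5 ^ 3" unfolding cube M s11 s1 using rel(1) by algebra
  moreover have "S 4 (e1 ^ 3) = 0" unfolding cube M s11 s1 using rel(1) by algebra
  ultimately have s111: "S 0 (e1 ^ 3) = C0 ^ 3 - 3 * q * (e5 * C2 ^ 2)"
    "S 1 (e1 ^ 3) = - 3 * (C0 ^ 2 * e5) - q * C2 ^ 3"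
    "S 2 (e1 ^ 3) = 0" "S 3 (e1 ^ 3) = 5 * e5 ^ 3" "S 4 (e1 ^ 3) = 0" by simp_all
  show "S 3 (e1 ^ 3) = 5 * e5 ^ 3" by (fact s111)
  show "S 4 (e1 ^ 2 * e2) = e5 ^ 2 * e10 - (C0 ^ 2 * D2 - C2 ^ 2 * D0)"
    unfolding M s11 s2 by algebra
  show "S 0 (e1 * e2 ^ 2) = q * (e5 * e10 ^ 2) + (C0 * D0 ^ 2 - q ^ 2 * (C2 * D2 ^ 2))"
    unfolding M s1 s22 by algebra
  show "S 1 (e2 ^ 3) = 5 * q * e10 ^ 3"
    unfolding cube M s2 s22 using rel(2) by algebra
  show "S 0 (e1 ^ 3 * e2) = (C0 ^ 3 * D0 + q ^ 2 * (C2 ^ 3 * D2)) +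
      3 * q * e5 * (C0 ^ 2 * D2 - C2 ^ 2 * D0) - 5 * q * (e5 ^ 3 * e10)"
    unfolding M s111 s2 by algebra
  show "S 1 (e1 ^ 2 * e2 ^ 2) = q * (e5 ^ 2 * e10 ^ 2) + 2 * q * e10 * (C0 ^ 2 * D2 - C2 ^ 2 * D0)
      - 2 * e5 * (C0 * D0 ^ 2 - q ^ 2 * (C2 * D2 ^ 2))"
    unfolding M s11 s22 by algebra
qed

section \<open>The operator on multiples of powers of \<open>xi_q\<close>\<close>

text \<open>
  The series \<open>xi_q(q^5) * G / xi_q^4\<close>, written without a division by \<open>q\<close>.
\<close>
definition seed :: "rat fps \<Rightarrow> rat fps" where
  "seed G = q * G * (eta_q oo q ^ 5) * inverse eta_q ^ 4"

definition seed_section :: "rat fps \<Rightarrow> nat \<Rightarrow> rat fps" where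
  "seed_section G j = section_fps 5 2 (seed G * xi_q ^ j)"

lemma eta_q_nth_0: "fps_nth eta_q 0 \<noteq> 0"
proof
  assume "fps_nth eta_q 0 = 0"
  then have "fps_nth (eta_q * (E q ^ 3 * E (q ^ 5))) 0 = 0" by simp
  then show False unfolding eta_q by (simp add: fps_power_zeroth E_nth_0)
qed

lemma xi_compose: "xi_q oo q ^ 5 = q ^ 5 * (eta_q oo q ^ 5)"
  by (simp add: xi_eta compose_power_mult)

lemma seed_xi_4: "seed G * xi_q ^ 4 = (xi_q oo q ^ 5) * G"
proof -
  have "(eta_q * inverse eta_q) ^ 4 = 1"
    using inverse_mult_eq_1'[OF eta_q_nth_0] by simp
  moreover have "seed G * xi_q ^ 4 = q ^ 5 * (eta_q oo q ^ 5) * G * (eta_q * inverse eta_q) ^ 4"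
    unfolding seed_def xi_eta power_mult_distrib
    by (simp add: power_numeral_reduce mult_ac)
  ultimately show ?thesis by (simp add: xi_compose)
qed

text \<open>
  The factor \<open>xi_q(q^5)\<close> becomes \<open>xi_q\<close> outside the section.  Starting the sequence four steps below
  \<open>G\<close> is what makes the initial values accessible.
\<close>
lemma seed_section_add_4: "seed_section G (j + 4) = xi_q * section_fps 5 2 (G * xi_q ^ j)"
proof -
  have "seed G * xi_q ^ (j + 4) = (seed G * xi_q ^ 4) * xi_q ^ j"
    by (simp add: power_add mult_ac)
  also have "\<dots> = (xi_q oo q ^ 5) * (G * xi_q ^ j)"
    by (simp add: seed_xi_4 mult_ac)
  finally show ?thesis
    by (simp add: seed_section_def section_fps_compose_mult)
qed

lemma modular_coeff_compose: "modular_coeff k (F oo q ^ 5) = modular_coeff k F oo q ^ 5"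
  by (simp add: modular_coeff_def fps_compose_add_distrib compose_power_mult compose_power_power)

lemma section_modular_coeff:
  "section_fps 5 2 (modular_coeff k (xi_q oo q ^ 5) * F) = modular_coeff k xi_q * section_fps 5 2 F"
  unfolding modular_coeff_compose by (simp add: section_fps_compose_mult)

text \<open>
  Multiply the modular equation by \<open>seed G * xi_q^j\<close> and move its coefficients, which are series in
  \<open>q^5\<close>, out of the section.
\<close>
lemma seed_section_recurrence:
  "seed_section G (j + 5) = modular_coeff 1 xi_q * seed_section G (j + 4)
    + modular_coeff 2 xi_q * seed_section G (j + 3) + modular_coeff 3 xi_q * seed_section G (j + 2)
    + modular_coeff 4 xi_q * seed_section G (j + 1) + modular_coeff 5 xi_q * seed_section G j"
proof -
  let ?c = "\<lambda>k. modular_coeff k (xi_q oo q ^ 5)"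
  have "seed G * xi_q ^ (j + 5) = seed G * xi_q ^ j * xi_q ^ 5"
    by (simp add: power_add mult_ac)
  also have "\<dots> = ?c 1 * (seed G * xi_q ^ (j + 4)) + ?c 2 * (seed G * xi_q ^ (j + 3))
      + ?c 3 * (seed G * xi_q ^ (j + 2)) + ?c 4 * (seed G * xi_q ^ (j + 1)) + ?c 5 * (seed G * xi_q ^ j)"
    unfolding modular_equation by (simp add: power_add distrib_left power2_eq_square mult_ac)
  finally show ?thesis
    by (simp only: seed_section_def section_fps_add section_modular_coeff)
qed

lemma seed_section_linear:
  fixes G :: "rat fps"
  defines "u \<equiv> seed_section G"
  shows "section_fps 5 2 (seed G * (xi_q ^ 3 * (1 + 4 * xi_q))) = u 3 + 4 * u 4"
    "section_fps 5 2 (seed G * (xi_q ^ 2 * (1 + 4 * xi_q))) = u 2 + 4 * u 3"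
    "section_fps 5 2 (seed G * (xi_q ^ 2 * (1 + 4 * xi_q) ^ 2)) = u 2 + 8 * u 3 + 16 * u 4"
    "section_fps 5 2 (seed G * (xi_q * (1 + 4 * xi_q) ^ 2)) = u 1 + 8 * u 2 + 16 * u 3"
    "section_fps 5 2 (seed G * (1 + 4 * xi_q) ^ 3) = u 0 + 12 * u 1 + 48 * u 2 + 64 * u 3"
proof -
  let ?s = "section_fps 5 2"
  let ?m = "\<lambda>j. seed G * xi_q ^ j"
  have u: "u j = ?s (?m j)" for j by (simp add: u_def seed_section_def)
  have "seed G * (xi_q ^ 3 * (1 + 4 * xi_q)) = ?m 3 + 4 * ?m 4" by algebra
  then show "?s (seed G * (xi_q ^ 3 * (1 + 4 * xi_q))) = u 3 + 4 * u 4"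
    by (simp only: u section_fps_add section_fps_numeral_mult)
  have "seed G * (xi_q ^ 2 * (1 + 4 * xi_q)) = ?m 2 + 4 * ?m 3" by algebra
  then show "?s (seed G * (xi_q ^ 2 * (1 + 4 * xi_q))) = u 2 + 4 * u 3"
    by (simp only: u section_fps_add section_fps_numeral_mult)
  have "seed G * (xi_q ^ 2 * (1 + 4 * xi_q) ^ 2) = ?m 2 + 8 * ?m 3 + 16 * ?m 4" by algebra
  then show "?s (seed G * (xi_q ^ 2 * (1 + 4 * xi_q) ^ 2)) = u 2 + 8 * u 3 + 16 * u 4"
    by (simp only: u section_fps_add section_fps_numeral_mult)
  have "seed G * (xi_q * (1 + 4 * xi_q) ^ 2) = ?m 1 + 8 * ?m 2 + 16 * ?m 3"
    unfolding power_one_right by algebra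
  then show "?s (seed G * (xi_q * (1 + 4 * xi_q) ^ 2)) = u 1 + 8 * u 2 + 16 * u 3"
    by (simp only: u section_fps_add section_fps_numeral_mult)
  have "seed G * (1 + 4 * xi_q) ^ 3 = ?m 0 + 12 * ?m 1 + 48 * ?m 2 + 64 * ?m 3"
    unfolding power_one_right power_0 by algebra
  then show "?s (seed G * (1 + 4 * xi_q) ^ 3) = u 0 + 12 * u 1 + 48 * u 2 + 64 * u 3"
    by (simp only: u section_fps_add section_fps_numeral_mult)
qed

lemma section_2_shift:
  "section_fps 5 2 (q * F) = section_fps 5 1 F"
  "section_fps 5 2 (q ^ 2 * F) = section_fps 5 0 F"
  "section_fps 5 2 (q ^ 3 * F) = q * section_fps 5 4 F"
  "section_fps 5 2 (q ^ 4 * F) = q * section_fps 5 3 F"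
  "section_fps 5 2 (q ^ 5 * F) = q * section_fps 5 2 F"
  using section_fps_X_power_mult[of 1 2 F] section_fps_X_power_mult[of 2 2 F]
    section_fps_X_power_mult[of 3 2 F] section_fps_X_power_mult[of 4 2 F]
    section_fps_compose_mult[of 5 2 q F] by simp_all

text \<open>
  Series in \<open>q^5\<close> may be cleared before taking the section.
\<close>
lemma section_product_with_scale:
  assumes "M * (G oo q ^ 5) = (H oo q ^ 5) * F"
  shows   "section_fps 5 2 M * G = H * section_fps 5 2 F"
  using arg_cong[OF assms, of "section_fps 5 2"]
    section_fps_compose_mult[of 5 2 G M] section_fps_compose_mult[of 5 2 H F]
  by (simp add: mult.commute)

context
  fixes e1 e2 e5 e10 \<xi> \<eta> \<eta>' :: "rat fps"
  assumes defs: "e1 = E q" "e2 = E (q ^ 2)" "e5 = E (q ^ 5)" "e10 = E (q ^ 10)" "\<xi> = xi_q"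
    "\<eta> = eta_q" "\<eta>' = eta_q oo q ^ 5"
begin

text \<open>
  The identity with \<open>e10^5\<close> and \<open>e5^5\<close> shows that multiplication by \<open>(1 + 4 * xi_q) / xi_q\<close>
  amounts, up to series in \<open>q^5\<close>, to multiplication by \<open>E(q^2) / (q * E(q))\<close>.
\<close>
lemma xi_basic:
  shows "\<xi> * (e1 ^ 3 * e5) = q * (e2 * e10 ^ 3)" "\<xi> = q * \<eta>" "\<eta> * (e1 ^ 3 * e5) = e2 * e10 ^ 3"
    "q * (1 + 4 * \<xi>) * (e1 * e10 ^ 5) = \<xi> * (e2 * e5 ^ 5)"
    "(1 + 4 * \<xi>) * (e1 ^ 4 * e10 ^ 2) = e2 ^ 2 * e5 ^ 4"
    "(1 + 5 * \<xi>) * (e1 ^ 5 * e10) = e2 ^ 5 * e5"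
    "seed G * \<xi> ^ 4 = q ^ 5 * \<eta>' * G"
    "e1 \<noteq> 0" "e2 \<noteq> 0" "e5 \<noteq> 0" "e10 \<noteq> 0" "\<xi> \<noteq> 0" "\<eta> \<noteq> 0" "1 + 4 * \<xi> \<noteq> 0" "1 + 5 * \<xi> \<noteq> 0"
    "e1 oo q ^ 5 = e5" "e2 oo q ^ 5 = e10" "\<eta> oo q ^ 5 = \<eta>'"
proof -
  note rel = level10_relations[OF defs(1-5) refl refl refl refl]
  show nz: "e1 \<noteq> 0" "e2 \<noteq> 0" "e5 \<noteq> 0" "e10 \<noteq> 0" by (simp_all add: defs)
  show xi: "\<xi> * (e1 ^ 3 * e5) = q * (e2 * e10 ^ 3)" using xi_eq by (simp add: defs)
  show "\<xi> = q * \<eta>" by (simp add: defs xi_eta)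
  show "\<eta> * (e1 ^ 3 * e5) = e2 * e10 ^ 3" using eta_q by (simp add: defs)
  show 4: "(1 + 4 * \<xi>) * (e1 ^ 4 * e10 ^ 2) = e2 ^ 2 * e5 ^ 4" by (fact rel)
  show 5: "(1 + 5 * \<xi>) * (e1 ^ 5 * e10) = e2 ^ 5 * e5" by (fact rel)
  show "seed G * \<xi> ^ 4 = q ^ 5 * \<eta>' * G"
    using seed_xi_4[of G] by (simp add: defs xi_compose mult_ac)
  show "\<xi> \<noteq> 0" "\<eta> \<noteq> 0" using xi nz \<open>\<xi> = q * \<eta>\<close> by auto
  show "1 + 4 * \<xi> \<noteq> 0" using 4 nz by auto
  show "1 + 5 * \<xi> \<noteq> 0" using 5 nz by auto
  have "(e1 ^ 3 * e10 ^ 2 * e5) * (q * (1 + 4 * \<xi>) * (e1 * e10 ^ 5)) = (e1 ^ 3 * e10 ^ 2 * e5) * (\<xi> * (e2 * e5 ^ 5))"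
    using xi 4 by algebra
  then show "q * (1 + 4 * \<xi>) * (e1 * e10 ^ 5) = \<xi> * (e2 * e5 ^ 5)"
    using nz by simp
  show "e1 oo q ^ 5 = e5" "e2 oo q ^ 5 = e10" "\<eta> oo q ^ 5 = \<eta>'"
    using E_compose_power[of 1 5] E_compose_power[of 2 5] by (simp_all add: defs)
qed

text \<open>
  Up to series in \<open>q^5\<close>, the series \<open>seed delta_q\<close> times \<open>xi^4\<close>, \<open>xi^3\<close>, \<open>xi^2 * (1 + 4 * xi)\<close>,
  \<open>xi * (1 + 4 * xi)^2\<close> and \<open>(1 + 4 * xi)^3\<close> is \<open>q^5 * e2\<close>, \<open>q^4 * e1^3\<close>,
  \<open>q^3 * e1^2 * e2\<close>, \<open>q^2 * e1 * e2^2\<close> and \<open>q * e2^3\<close>.  The sections of these monomials are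
  known, and \<open>level10_relations\<close> turns them into multiples of \<open>gamma_q\<close>.
\<close>
lemma delta_values:
  defines "u \<equiv> seed_section delta_q"
  shows "u 4 = - (\<xi> * gamma_q)"
    and "(1 + 5 * \<xi>) * u 3 = 5 * \<xi> * (1 + 4 * \<xi>) * gamma_q"
    and "(1 + 5 * \<xi>) ^ 2 * (u 2 + 4 * u 3) = \<xi> * gamma_q"
    and "(1 + 5 * \<xi>) ^ 2 * (u 1 + 8 * u 2 + 16 * u 3) = (1 + 4 * \<xi>) * gamma_q"
    and "(1 + 5 * \<xi>) ^ 4 * (u 0 + 12 * u 1 + 48 * u 2 + 64 * u 3) = 5 * \<xi> * (1 + 4 * \<xi>) * gamma_q"
proof -
  obtain C0 C2 D0 D2 where CD: "C0 = dissect0" "C2 = dissect2" "D0 = dissect0_sq" "D2 = dissect2_sq" by simp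
  note rel = level10_relations[OF defs(1-5) CD]
  note val = sections_E_products[OF defs(1-5) CD]
  note xb = xi_basic
  note nz = xb(8-15)
  obtain sd where sd: "sd = seed delta_q" by simp
  have \<delta>: "delta_q = e2 * e5 ^ 2" and \<gamma>: "gamma_q = e1 ^ 2 * e10"
    by (simp_all add: delta_q_def gamma_q_def defs)
  have seed: "sd * \<xi> ^ 4 = q ^ 5 * \<eta>' * (e2 * e5 ^ 2)"
    unfolding sd xb(7) \<delta> ..
  have hom: "(F * G) oo q ^ 5 = (F oo q ^ 5) * (G oo q ^ 5)" "(F ^ n) oo q ^ 5 = (F oo q ^ 5) ^ n" for F G :: "rat fps" and n
    by (simp_all add: compose_power_mult compose_power_power)
  have "(q * e2 * e10 ^ 3) * ((sd * \<xi> ^ 3) * e10 ^ 3) = (q * e2 * e10 ^ 3) * (\<eta>' * e5 ^ 3 * (q ^ 4 * e1 ^ 3))"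
    using seed xb(1) by algebra
  then have 0: "(sd * \<xi> ^ 3) * e10 ^ 3 = \<eta>' * e5 ^ 3 * (q ^ 4 * e1 ^ 3)"
    using nz by simp
  have "(q * e1 * e10 ^ 5) * ((sd * (\<xi> ^ 2 * (1 + 4 * \<xi>))) * e10 ^ 3) = (e2 * e5 ^ 5) * ((sd * \<xi> ^ 3) * e10 ^ 3)"
    using xb(4) by algebra
  then have "(q * e1) * ((sd * (\<xi> ^ 2 * (1 + 4 * \<xi>))) * e10 ^ 8) = (q * e1) * (\<eta>' * e5 ^ 8 * (q ^ 3 * (e1 ^ 2 * e2)))"
    unfolding 0 by algebra
  then have 1: "(sd * (\<xi> ^ 2 * (1 + 4 * \<xi>))) * e10 ^ 8 = \<eta>' * e5 ^ 8 * (q ^ 3 * (e1 ^ 2 * e2))"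
    using nz by simp
  have "(q * e1 * e10 ^ 5) * ((sd * (\<xi> * (1 + 4 * \<xi>) ^ 2)) * e10 ^ 8) = (e2 * e5 ^ 5) * ((sd * (\<xi> ^ 2 * (1 + 4 * \<xi>))) * e10 ^ 8)"
    using xb(4) by algebra
  then have "(q * e1) * ((sd * (\<xi> * (1 + 4 * \<xi>) ^ 2)) * e10 ^ 13) = (q * e1) * (\<eta>' * e5 ^ 13 * (q ^ 2 * (e1 * e2 ^ 2)))"
    unfolding 1 by algebra
  then have 2: "(sd * (\<xi> * (1 + 4 * \<xi>) ^ 2)) * e10 ^ 13 = \<eta>' * e5 ^ 13 * (q ^ 2 * (e1 * e2 ^ 2))"
    using nz by simp
  have "(q * e1 * e10 ^ 5) * ((sd * (1 + 4 * \<xi>) ^ 3) * e10 ^ 13) = (e2 * e5 ^ 5) * ((sd * (\<xi> * (1 + 4 * \<xi>) ^ 2)) * e10 ^ 13)"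
    using xb(4) by algebra
  then have "(q * e1) * ((sd * (1 + 4 * \<xi>) ^ 3) * e10 ^ 18) = (q * e1) * (\<eta>' * e5 ^ 18 * (q * e2 ^ 3))"
    unfolding 2 by algebra
  then have 3: "(sd * (1 + 4 * \<xi>) ^ 3) * e10 ^ 18 = \<eta>' * e5 ^ 18 * (q * e2 ^ 3)"
    using nz by simp
  have 4: "(sd * \<xi> ^ 4) = \<eta>' * e5 ^ 2 * (q ^ 5 * e2)"
    unfolding seed by (simp add: mult_ac)
  note lin = seed_section_linear[of delta_q, folded u_def defs(5) sd]
  have u: "section_fps 5 2 (sd * \<xi> ^ j) = u j" for j
    by (simp add: u_def seed_section_def sd defs)
  have T4: "u 4 = \<eta> * e1 ^ 2 * (q * section_fps 5 2 e2)"
  proof -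
    have "section_fps 5 2 (sd * \<xi> ^ 4) * 1 = (\<eta> * e1 ^ 2) * section_fps 5 2 (q ^ 5 * e2)"
      by (rule section_product_with_scale) (simp add: hom xb(16-18) 4)
    then show ?thesis by (simp add: u section_2_shift)
  qed
  have T3: "u 3 * e2 ^ 3 = \<eta> * e1 ^ 3 * (q * section_fps 5 3 (e1 ^ 3))"
  proof -
    have "section_fps 5 2 (sd * \<xi> ^ 3) * (e2 ^ 3) = (\<eta> * e1 ^ 3) * section_fps 5 2 (q ^ 4 * e1 ^ 3)"
      by (rule section_product_with_scale) (simp add: hom xb(16-18) 0)
    then show ?thesis by (simp add: u section_2_shift)
  qed
  have T2: "(u 2 + 4 * u 3) * e2 ^ 8 = \<eta> * e1 ^ 8 * (q * section_fps 5 4 (e1 ^ 2 * e2))"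
  proof -
    have "section_fps 5 2 (sd * (\<xi> ^ 2 * (1 + 4 * \<xi>))) * (e2 ^ 8) = (\<eta> * e1 ^ 8) * section_fps 5 2 (q ^ 3 * (e1 ^ 2 * e2))"
      by (rule section_product_with_scale) (simp add: hom xb(16-18) 1)
    then show ?thesis by (simp add: lin section_2_shift)
  qed
  have T1: "(u 1 + 8 * u 2 + 16 * u 3) * e2 ^ 13 = \<eta> * e1 ^ 13 * section_fps 5 0 (e1 * e2 ^ 2)"
  proof -
    have "section_fps 5 2 (sd * (\<xi> * (1 + 4 * \<xi>) ^ 2)) * (e2 ^ 13) = (\<eta> * e1 ^ 13) * section_fps 5 2 (q ^ 2 * (e1 * e2 ^ 2))"
      by (rule section_product_with_scale) (simp add: hom xb(16-18) 2)
    then show ?thesis by (simp add: lin section_2_shift)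
  qed
  have T0: "(u 0 + 12 * u 1 + 48 * u 2 + 64 * u 3) * e2 ^ 18 = \<eta> * e1 ^ 18 * section_fps 5 1 (e2 ^ 3)"
  proof -
    have "section_fps 5 2 (sd * (1 + 4 * \<xi>) ^ 3) * (e2 ^ 18) = (\<eta> * e1 ^ 18) * section_fps 5 2 (q * e2 ^ 3)"
      by (rule section_product_with_scale) (simp add: hom xb(16-18) 3)
    then show ?thesis by (simp add: lin section_2_shift)
  qed
  show "u 4 = - (\<xi> * gamma_q)"
    unfolding T4 val \<gamma> xb(2) by simp
  note units = xb(5,6)
  \<comment> \<open>all remaining claims compare eta quotients, after multiplication by a common denominator\<close>
  show "(1 + 5 * \<xi>) * u 3 = 5 * \<xi> * (1 + 4 * \<xi>) * gamma_q"
  proof -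
    have "(e1 ^ 9 * e10 ^ 3 * e2 ^ 3) * ((1 + 5 * \<xi>) * u 3) = (e1 ^ 4 * e10 ^ 2) * ((1 + 5 * \<xi>) * (e1 ^ 5 * e10)) * (u 3 * e2 ^ 3)"
      by (simp add: power_numeral_reduce mult_ac)
    also have "\<dots> = (e1 ^ 4 * e10 ^ 2) * (e2 ^ 5 * e5) * (\<eta> * e1 ^ 3 * (q * (5 * e5 ^ 3)))"
      unfolding units T3 val ..
    also have "\<dots> = (5 * \<xi> * gamma_q * (e1 ^ 5 * e10 * e2 ^ 3)) * (e2 ^ 2 * e5 ^ 4)"
      unfolding xb(2) \<gamma> by algebra
    also have "\<dots> = (e1 ^ 9 * e10 ^ 3 * e2 ^ 3) * (5 * \<xi> * (1 + 4 * \<xi>) * gamma_q)"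
      unfolding units[symmetric] by algebra
    finally show ?thesis using nz by simp
  qed
  show "(1 + 5 * \<xi>) ^ 2 * (u 2 + 4 * u 3) = \<xi> * gamma_q"
  proof -
    obtain V where V: "V = section_fps 5 4 (e1 ^ 2 * e2)" by simp
    have VV: "(1 + 4 * \<xi>) * V = e5 ^ 2 * e10"
      unfolding V val using rel(5) by algebra
    obtain w where w: "w = u 2 + 4 * u 3" by simp
    have "((1 + 4 * \<xi>) * (e1 ^ 5 * e10) ^ 2 * e2 ^ 8) * ((1 + 5 * \<xi>) ^ 2 * w) =
        (1 + 4 * \<xi>) * ((1 + 5 * \<xi>) * (e1 ^ 5 * e10)) ^ 2 * (w * e2 ^ 8)"
      by algebra
    also have "\<dots> = (e2 ^ 5 * e5) ^ 2 * (q * \<eta>) * e1 ^ 8 * ((1 + 4 * \<xi>) * V)"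
      unfolding units w T2 V by algebra
    also have "\<dots> = \<xi> * e1 ^ 8 * e2 ^ 8 * e10 * (e2 ^ 2 * e5 ^ 4)"
      unfolding xb(2)[symmetric] VV by algebra
    also have "\<dots> = ((1 + 4 * \<xi>) * (e1 ^ 5 * e10) ^ 2 * e2 ^ 8) * (\<xi> * gamma_q)"
      unfolding units[symmetric] \<gamma> by algebra
    finally show ?thesis using nz by (simp add: w)
  qed
  show "(1 + 5 * \<xi>) ^ 2 * (u 1 + 8 * u 2 + 16 * u 3) = (1 + 4 * \<xi>) * gamma_q"
  proof -
    obtain V where V: "V = section_fps 5 0 (e1 * e2 ^ 2)" by simp
    have VV: "\<xi> * V = q * (1 + 5 * \<xi>) * e5 * e10 ^ 2"
      unfolding V val using rel(6) by algebra
    obtain w where w: "w = u 1 + 8 * u 2 + 16 * u 3" by simp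
    have "(q * (e1 ^ 5 * e10) ^ 3 * e2 ^ 13) * ((1 + 5 * \<xi>) ^ 2 * w) =
        q * (e1 ^ 5 * e10) * ((1 + 5 * \<xi>) * (e1 ^ 5 * e10)) ^ 2 * (w * e2 ^ 13)"
      by algebra
    also have "\<dots> = (e1 ^ 5 * e10) * (e2 ^ 5 * e5) ^ 2 * e1 ^ 13 * ((q * \<eta>) * V)"
      unfolding units w T1 V by algebra
    also have "\<dots> = (e2 ^ 5 * e5) ^ 2 * e1 ^ 13 * q * e5 * e10 ^ 2 * ((1 + 5 * \<xi>) * (e1 ^ 5 * e10))"
      unfolding xb(2)[symmetric] VV by algebra
    also have "\<dots> = e2 ^ 13 * e1 ^ 13 * q * e10 ^ 2 * (e2 ^ 2 * e5 ^ 4)"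
      unfolding units by algebra
    also have "\<dots> = (q * (e1 ^ 5 * e10) ^ 3 * e2 ^ 13) * ((1 + 4 * \<xi>) * gamma_q)"
      unfolding units[symmetric] \<gamma> by algebra
    finally show ?thesis using nz by (simp add: w)
  qed
  show "(1 + 5 * \<xi>) ^ 4 * (u 0 + 12 * u 1 + 48 * u 2 + 64 * u 3) = 5 * \<xi> * (1 + 4 * \<xi>) * gamma_q"
  proof -
    obtain w where w: "w = u 0 + 12 * u 1 + 48 * u 2 + 64 * u 3" by simp
    have "((e1 ^ 5 * e10) ^ 4 * e2 ^ 18) * ((1 + 5 * \<xi>) ^ 4 * w) =
        ((1 + 5 * \<xi>) * (e1 ^ 5 * e10)) ^ 4 * (w * e2 ^ 18)"
      by algebra
    also have "\<dots> = 5 * (q * \<eta>) * e1 ^ 18 * (e2 ^ 5 * e5) ^ 4 * e10 ^ 3"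
      unfolding units w T0 val by algebra
    also have "\<dots> = 5 * \<xi> * e1 ^ 18 * e2 ^ 18 * e10 ^ 3 * (e2 ^ 2 * e5 ^ 4)"
      unfolding xb(2) by algebra
    also have "\<dots> = ((e1 ^ 5 * e10) ^ 4 * e2 ^ 18) * (5 * \<xi> * (1 + 4 * \<xi>) * gamma_q)"
      unfolding units[symmetric] \<gamma> by algebra
    finally show ?thesis using nz by (simp add: w)
  qed
qed

text \<open>
  The analogue for \<open>gamma_q\<close>; here the monomials are \<open>q^5 * e1^2\<close>, \<open>q^4 * e1 * e2\<close>,
  \<open>q^3 * e2^2\<close>, \<open>q^2 * e1^3 * e2\<close> and \<open>q * e1^2 * e2^2\<close>.
\<close>
lemma gamma_values:
  defines "u \<equiv> seed_section gamma_q"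
  shows "u 4 = - (\<xi> * delta_q)"
    and "(1 + 5 * \<xi>) * (u 3 + 4 * u 4) = \<xi> * delta_q"
    and "(1 + 5 * \<xi>) ^ 2 * (u 2 + 8 * u 3 + 16 * u 4) = - (\<xi> * delta_q)"
    and "(1 + 5 * \<xi>) ^ 3 * (u 1 + 8 * u 2 + 16 * u 3) =
      ((1 + 4 * \<xi>) ^ 2 - 3 * \<xi> * (1 + 4 * \<xi>) + 16 * \<xi> ^ 2) * delta_q"
    and "(1 + 5 * \<xi>) ^ 4 * (u 0 + 12 * u 1 + 48 * u 2 + 64 * u 3) =
      (8 * \<xi> ^ 2 + \<xi> * (1 + 4 * \<xi>) - 2 * (1 + 4 * \<xi>) ^ 2) * delta_q"
proof -
  obtain C0 C2 D0 D2 where CD: "C0 = dissect0" "C2 = dissect2" "D0 = dissect0_sq" "D2 = dissect2_sq" by simp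
  note rel = level10_relations[OF defs(1-5) CD]
  note val = sections_E_products[OF defs(1-5) CD]
  note xb = xi_basic
  note nz = xb(8-15)
  obtain sd where sd: "sd = seed gamma_q" by simp
  have \<delta>: "delta_q = e2 * e5 ^ 2" and \<gamma>: "gamma_q = e1 ^ 2 * e10"
    by (simp_all add: delta_q_def gamma_q_def defs)
  have seed: "sd * \<xi> ^ 4 = q ^ 5 * \<eta>' * (e1 ^ 2 * e10)"
    unfolding sd xb(7) \<gamma> ..
  have hom: "(F * G) oo q ^ 5 = (F oo q ^ 5) * (G oo q ^ 5)" "(F ^ n) oo q ^ 5 = (F oo q ^ 5) ^ n" for F G :: "rat fps" and n
    by (simp_all add: compose_power_mult compose_power_power)
  have 0: "(sd * \<xi> ^ 4) = \<eta>' * e10 * (q ^ 5 * e1 ^ 2)"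
    unfolding seed by (simp add: mult_ac)
  have "(q * e1 * e10 ^ 5) * (sd * (\<xi> ^ 3 * (1 + 4 * \<xi>))) = (e2 * e5 ^ 5) * (sd * \<xi> ^ 4)"
    using xb(4) by algebra
  then have "(q * e1 * e10) * ((sd * (\<xi> ^ 3 * (1 + 4 * \<xi>))) * e10 ^ 4) = (q * e1 * e10) * (\<eta>' * e5 ^ 5 * (q ^ 4 * (e1 * e2)))"
    unfolding 0 by algebra
  then have 1: "(sd * (\<xi> ^ 3 * (1 + 4 * \<xi>))) * e10 ^ 4 = \<eta>' * e5 ^ 5 * (q ^ 4 * (e1 * e2))"
    using nz by simp
  have "(q * e1 * e10 ^ 5) * ((sd * (\<xi> ^ 2 * (1 + 4 * \<xi>) ^ 2)) * e10 ^ 4) = (e2 * e5 ^ 5) * ((sd * (\<xi> ^ 3 * (1 + 4 * \<xi>))) * e10 ^ 4)"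
    using xb(4) by algebra
  then have "(q * e1) * ((sd * (\<xi> ^ 2 * (1 + 4 * \<xi>) ^ 2)) * e10 ^ 9) = (q * e1) * (\<eta>' * e5 ^ 10 * (q ^ 3 * e2 ^ 2))"
    unfolding 1 by algebra
  then have 2: "(sd * (\<xi> ^ 2 * (1 + 4 * \<xi>) ^ 2)) * e10 ^ 9 = \<eta>' * e5 ^ 10 * (q ^ 3 * e2 ^ 2)"
    using nz by simp
  have "(q * e2 * e10 ^ 3) * ((sd * (\<xi> * (1 + 4 * \<xi>) ^ 2)) * e10 ^ 9) = (e1 ^ 3 * e5) * ((sd * (\<xi> ^ 2 * (1 + 4 * \<xi>) ^ 2)) * e10 ^ 9)"
    using xb(1) by algebra
  then have "(q * e2) * ((sd * (\<xi> * (1 + 4 * \<xi>) ^ 2)) * e10 ^ 12) = (q * e2) * (\<eta>' * e5 ^ 11 * (q ^ 2 * (e1 ^ 3 * e2)))"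
    unfolding 2 by algebra
  then have 3: "(sd * (\<xi> * (1 + 4 * \<xi>) ^ 2)) * e10 ^ 12 = \<eta>' * e5 ^ 11 * (q ^ 2 * (e1 ^ 3 * e2))"
    using nz by simp
  have "(q * e1 * e10 ^ 5) * ((sd * (1 + 4 * \<xi>) ^ 3) * e10 ^ 12) = (e2 * e5 ^ 5) * ((sd * (\<xi> * (1 + 4 * \<xi>) ^ 2)) * e10 ^ 12)"
    using xb(4) by algebra
  then have "(q * e1) * ((sd * (1 + 4 * \<xi>) ^ 3) * e10 ^ 17) = (q * e1) * (\<eta>' * e5 ^ 16 * (q * (e1 ^ 2 * e2 ^ 2)))"
    unfolding 3 by algebra
  then have 4: "(sd * (1 + 4 * \<xi>) ^ 3) * e10 ^ 17 = \<eta>' * e5 ^ 16 * (q * (e1 ^ 2 * e2 ^ 2))"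
    using nz by simp
  note lin = seed_section_linear[of gamma_q, folded u_def defs(5) sd]
  have u: "section_fps 5 2 (sd * \<xi> ^ j) = u j" for j
    by (simp add: u_def seed_section_def sd defs)
  have T0: "u 4 = \<eta> * e2 * (q * section_fps 5 2 (e1 ^ 2))"
  proof -
    have "section_fps 5 2 (sd * \<xi> ^ 4) * 1 = (\<eta> * e2) * section_fps 5 2 (q ^ 5 * e1 ^ 2)"
      by (rule section_product_with_scale) (simp add: hom xb(16-18) 0)
    then show ?thesis by (simp add: u section_2_shift)
  qed
  have T1: "(u 3 + 4 * u 4) * e2 ^ 4 = \<eta> * e1 ^ 5 * (q * section_fps 5 3 (e1 * e2))"
  proof -
    have "section_fps 5 2 (sd * (\<xi> ^ 3 * (1 + 4 * \<xi>))) * (e2 ^ 4) = (\<eta> * e1 ^ 5) * section_fps 5 2 (q ^ 4 * (e1 * e2))"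
      by (rule section_product_with_scale) (simp add: hom xb(16-18) 1)
    then show ?thesis by (simp add: lin section_2_shift)
  qed
  have T2: "(u 2 + 8 * u 3 + 16 * u 4) * e2 ^ 9 = \<eta> * e1 ^ 10 * (q * section_fps 5 4 (e2 ^ 2))"
  proof -
    have "section_fps 5 2 (sd * (\<xi> ^ 2 * (1 + 4 * \<xi>) ^ 2)) * (e2 ^ 9) = (\<eta> * e1 ^ 10) * section_fps 5 2 (q ^ 3 * e2 ^ 2)"
      by (rule section_product_with_scale) (simp add: hom xb(16-18) 2)
    then show ?thesis by (simp add: lin section_2_shift)
  qed
  have T3: "(u 1 + 8 * u 2 + 16 * u 3) * e2 ^ 12 = \<eta> * e1 ^ 11 * section_fps 5 0 (e1 ^ 3 * e2)"
  proof -
    have "section_fps 5 2 (sd * (\<xi> * (1 + 4 * \<xi>) ^ 2)) * (e2 ^ 12) = (\<eta> * e1 ^ 11) * section_fps 5 2 (q ^ 2 * (e1 ^ 3 * e2))"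
      by (rule section_product_with_scale) (simp add: hom xb(16-18) 3)
    then show ?thesis by (simp add: lin section_2_shift)
  qed
  have T4: "(u 0 + 12 * u 1 + 48 * u 2 + 64 * u 3) * e2 ^ 17 = \<eta> * e1 ^ 16 * section_fps 5 1 (e1 ^ 2 * e2 ^ 2)"
  proof -
    have "section_fps 5 2 (sd * (1 + 4 * \<xi>) ^ 3) * (e2 ^ 17) = (\<eta> * e1 ^ 16) * section_fps 5 2 (q * (e1 ^ 2 * e2 ^ 2))"
      by (rule section_product_with_scale) (simp add: hom xb(16-18) 4)
    then show ?thesis by (simp add: lin section_2_shift)
  qed
  show "u 4 = - (\<xi> * delta_q)"
    unfolding T0 val \<delta> xb(2) by simp
  note units = xb(5,6)
  show "(1 + 5 * \<xi>) * (u 3 + 4 * u 4) = \<xi> * delta_q"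
  proof -
    obtain w where w: "w = u 3 + 4 * u 4" by simp
    have "((e1 ^ 5 * e10) * e2 ^ 4) * ((1 + 5 * \<xi>) * w) = ((1 + 5 * \<xi>) * (e1 ^ 5 * e10)) * (w * e2 ^ 4)"
      by algebra
    also have "\<dots> = (e2 ^ 5 * e5) * (q * \<eta>) * e1 ^ 5 * (e5 * e10)"
      unfolding units w T1 val by algebra
    also have "\<dots> = ((e1 ^ 5 * e10) * e2 ^ 4) * (\<xi> * delta_q)"
      unfolding xb(2) \<delta> by algebra
    finally show ?thesis using nz by (simp add: w)
  qed
  show "(1 + 5 * \<xi>) ^ 2 * (u 2 + 8 * u 3 + 16 * u 4) = - (\<xi> * delta_q)"
  proof -
    obtain w where w: "w = u 2 + 8 * u 3 + 16 * u 4" by simp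
    have "((e1 ^ 5 * e10) ^ 2 * e2 ^ 9) * ((1 + 5 * \<xi>) ^ 2 * w) = ((1 + 5 * \<xi>) * (e1 ^ 5 * e10)) ^ 2 * (w * e2 ^ 9)"
      by algebra
    also have "\<dots> = - ((e2 ^ 5 * e5) ^ 2 * (q * \<eta>) * e1 ^ 10 * e10 ^ 2)"
      unfolding units w T2 val by algebra
    also have "\<dots> = ((e1 ^ 5 * e10) ^ 2 * e2 ^ 9) * (- (\<xi> * delta_q))"
      unfolding xb(2) \<delta> by algebra
    finally have eq: "((e1 ^ 5 * e10) ^ 2 * e2 ^ 9) * ((1 + 5 * \<xi>) ^ 2 * w) =
        ((e1 ^ 5 * e10) ^ 2 * e2 ^ 9) * (- (\<xi> * delta_q))" .
    have "(e1 ^ 5 * e10) ^ 2 * e2 ^ 9 \<noteq> 0" using nz by simp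
    from iffD1[OF mult_left_cancel[OF this] eq]
    show ?thesis by (simp only: w)
  qed
  show "(1 + 5 * \<xi>) ^ 3 * (u 1 + 8 * u 2 + 16 * u 3) =
      ((1 + 4 * \<xi>) ^ 2 - 3 * \<xi> * (1 + 4 * \<xi>) + 16 * \<xi> ^ 2) * delta_q"
  proof -
    obtain V p where V: "V = section_fps 5 0 (e1 ^ 3 * e2)"
      and p: "p = (1 + 4 * \<xi>) ^ 2 - 3 * \<xi> * (1 + 4 * \<xi>) + 16 * \<xi> ^ 2" by simp
    have VV: "\<xi> * ((1 + 4 * \<xi>) * V) = q * e5 ^ 3 * e10 * p"
      unfolding V val p using rel(5,7) by algebra
    obtain w where w: "w = u 1 + 8 * u 2 + 16 * u 3" by simp
    have "(q * (1 + 4 * \<xi>) * (e1 ^ 5 * e10) ^ 3 * e2 ^ 12) * ((1 + 5 * \<xi>) ^ 3 * w) =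
        q * (1 + 4 * \<xi>) * ((1 + 5 * \<xi>) * (e1 ^ 5 * e10)) ^ 3 * (w * e2 ^ 12)"
      by algebra
    also have "\<dots> = (e2 ^ 5 * e5) ^ 3 * e1 ^ 11 * ((q * \<eta>) * ((1 + 4 * \<xi>) * V))"
      unfolding units w T3 V by algebra
    also have "\<dots> = e2 ^ 13 * e5 ^ 2 * e1 ^ 11 * q * e10 * p * (e2 ^ 2 * e5 ^ 4)"
      unfolding xb(2)[symmetric] VV by algebra
    also have "\<dots> = (q * (1 + 4 * \<xi>) * (e1 ^ 5 * e10) ^ 3 * e2 ^ 12) * (p * delta_q)"
      unfolding units[symmetric] \<delta> by algebra
    finally show ?thesis using nz by (simp add: w p)
  qed
  show "(1 + 5 * \<xi>) ^ 4 * (u 0 + 12 * u 1 + 48 * u 2 + 64 * u 3) =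
      (8 * \<xi> ^ 2 + \<xi> * (1 + 4 * \<xi>) - 2 * (1 + 4 * \<xi>) ^ 2) * delta_q"
  proof -
    obtain V p where V: "V = section_fps 5 1 (e1 ^ 2 * e2 ^ 2)"
      and p: "p = 8 * \<xi> ^ 2 + \<xi> * (1 + 4 * \<xi>) - 2 * (1 + 4 * \<xi>) ^ 2" by simp
    have VV: "\<xi> * ((1 + 4 * \<xi>) * V) = q * e5 ^ 2 * e10 ^ 2 * p"
      unfolding V val p using rel(5,6) by algebra
    obtain w where w: "w = u 0 + 12 * u 1 + 48 * u 2 + 64 * u 3" by simp
    have "(q * (1 + 4 * \<xi>) * (e1 ^ 5 * e10) ^ 4 * e2 ^ 17) * ((1 + 5 * \<xi>) ^ 4 * w) =
        q * (1 + 4 * \<xi>) * ((1 + 5 * \<xi>) * (e1 ^ 5 * e10)) ^ 4 * (w * e2 ^ 17)"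
      by algebra
    also have "\<dots> = (e2 ^ 5 * e5) ^ 4 * e1 ^ 16 * ((q * \<eta>) * ((1 + 4 * \<xi>) * V))"
      unfolding units w T4 V by algebra
    also have "\<dots> = e2 ^ 18 * e5 ^ 2 * e1 ^ 16 * q * e10 ^ 2 * p * (e2 ^ 2 * e5 ^ 4)"
      unfolding xb(2)[symmetric] VV by algebra
    also have "\<dots> = (q * (1 + 4 * \<xi>) * (e1 ^ 5 * e10) ^ 4 * e2 ^ 17) * (p * delta_q)"
      unfolding units[symmetric] \<delta> by algebra
    finally show ?thesis using nz by (simp add: w p)
  qed
qed

end

section \<open>The generating function of the matrices\<close>

lemma D_poly_eq:
  "D_poly = 1 - (\<Sum>k=1..5. fps_const (modular_coeff k q) * x_var ^ k)"
proof -
  have "(\<Sum>k=1..5. f k) = f 1 + f 2 + f 3 + f 4 + f 5" for f :: "nat \<Rightarrow> rat fps fps"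
    by (simp add: eval_nat_numeral)
  then show ?thesis
    by (simp add: D_poly_def modular_coeff_def Let_def numeral_fps_const[where ?'a = "rat fps"])
qed

lemma modular_coeff_eq_0 [simp]: "modular_coeff 0 y = 0" "k > 5 \<Longrightarrow> modular_coeff k y = 0"
  by (simp_all add: modular_coeff_def)

lemma nth_monomial: "fps_nth (fps_const c * x_var ^ k) i = (if k = i then c else 0)"
  by (auto simp: fps_X_power_mult_right_nth)

lemma D_poly_nth: "fps_nth D_poly i = (if i = 0 then 1 else - modular_coeff i q)"
proof -
  have "fps_nth D_poly i = of_bool (i = 0) - (\<Sum>k=1..5. if k = i then modular_coeff k q else 0)"
    unfolding D_poly_eq fps_sub_nth fps_sum_nth nth_monomial by simp
  then show ?thesis by auto
qed

definition alpha_numer :: "nat \<Rightarrow> 'a :: comm_ring_1 \<Rightarrow> 'a" where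
  "alpha_numer i y =
    (if i = 1 then - y
     else if i = 2 then y + 210 * y^2 + 4300 * y^3 + 34000 * y^4 + 120000 * y^5 + 160000 * y^6
     else if i = 3 then y + 180 * y^2 + 3575 * y^3 + 27500 * y^4 + 94000 * y^5 + 120000 * y^6
     else if i = 4 then 50 * y^2 + 1000 * y^3 + 7450 * y^4 + 24500 * y^5 + 30000 * y^6
     else if i = 5 then 5 * y^2 + 95 * y^3 + 675 * y^4 + 2125 * y^5 + 2500 * y^6
     else 0)"

definition beta_numer :: "nat \<Rightarrow> 'a :: comm_ring_1 \<Rightarrow> 'a" where
  "beta_numer i y =
    (if i = 1 then - y
     else if i = 2 then 3 * y + 320 * y^2 + 5520 * y^3 + 39200 * y^4 + 128000 * y^5 + 160000 * y^6
     else if i = 3 then y + 226 * y^2 + 4185 * y^3 + 30200 * y^4 + 98000 * y^5 + 120000 * y^6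
     else if i = 4 then 56 * y^2 + 1080 * y^3 + 7800 * y^4 + 25000 * y^5 + 30000 * y^6
     else if i = 5 then 5 * y^2 + 95 * y^3 + 675 * y^4 + 2125 * y^5 + 2500 * y^6
     else 0)"

lemma nth_sum_monomials:
  assumes "\<And>i. i \<notin> {1..5} \<Longrightarrow> f i = 0"
  shows "fps_nth (\<Sum>k=1..5. fps_const (f k) * x_var ^ k) i = f i"
proof -
  have "fps_nth (\<Sum>k=1..5. fps_const (f k) * x_var ^ k) i = (\<Sum>k=1..5. if k = i then f k else 0)"
    by (simp only: fps_sum_nth nth_monomial)
  then show ?thesis using assms[of i] by auto
qed

lemma N_alpha_nth: "fps_nth N_alpha i = alpha_numer i q"
proof -
  have "(\<Sum>k=1..5. f k) = f 1 + f 2 + f 3 + f 4 + f 5" for f :: "nat \<Rightarrow> rat fps fps"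
    by (simp add: eval_nat_numeral)
  then have eq: "N_alpha = (\<Sum>k=1..5. fps_const (alpha_numer k q) * x_var ^ k)"
    by (simp add: N_alpha_def alpha_numer_def Let_def numeral_fps_const[where ?'a = "rat fps"] flip: fps_const_neg)
  show ?thesis unfolding eq by (rule nth_sum_monomials) (auto simp: alpha_numer_def)
qed

lemma N_beta_nth: "fps_nth N_beta i = beta_numer i q"
proof -
  have "(\<Sum>k=1..5. f k) = f 1 + f 2 + f 3 + f 4 + f 5" for f :: "nat \<Rightarrow> rat fps fps"
    by (simp add: eval_nat_numeral)
  then have eq: "N_beta = (\<Sum>k=1..5. fps_const (beta_numer k q) * x_var ^ k)"
    by (simp add: N_beta_def beta_numer_def Let_def numeral_fps_const[where ?'a = "rat fps"] flip: fps_const_neg)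
  show ?thesis unfolding eq by (rule nth_sum_monomials) (auto simp: beta_numer_def)
qed

lemma xi_nth_0 [simp]: "fps_nth xi_q 0 = 0"
  by (simp add: xi_eta)

lemma compose_xi_simps:
  "(F + G) oo xi_q = (F oo xi_q) + (G oo xi_q)" "(F - G) oo xi_q = (F oo xi_q) - (G oo xi_q)"
  "(- F) oo xi_q = - (F oo xi_q)"
  "(F * G) oo xi_q = (F oo xi_q) * (G oo xi_q)" "(F ^ n) oo xi_q = (F oo xi_q) ^ n"
  "q oo xi_q = xi_q" "numeral k oo xi_q = numeral k"
  by (simp_all add: fps_compose_add_distrib fps_compose_sub_distrib fps_compose_uminus
      fps_compose_mult_distrib fps_compose_power numeral_fps_const)

lemma compose_xi_polys:
  "modular_coeff i q oo xi_q = modular_coeff i xi_q"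
  "alpha_numer i q oo xi_q = alpha_numer i xi_q" "beta_numer i q oo xi_q = beta_numer i xi_q"
  by (simp_all add: modular_coeff_def alpha_numer_def beta_numer_def compose_xi_simps)

text \<open>
  The identity \<open>D * (N / D) = N\<close>, read off at \<open>x^i\<close>.
\<close>
lemma quotient_row_recurrence:
  fixes N :: "rat fps fps"
  defines "a \<equiv> \<lambda>i. fps_nth (N / D_poly) i oo xi_q"
  shows "a i = (fps_nth N i oo xi_q) + (\<Sum>k=1..i. modular_coeff k xi_q * a (i - k))"
proof -
  define A where "A = fps_nth (N / D_poly)"
  have "fps_nth N i = fps_nth (D_poly * (N / D_poly)) i"
    using quotient_times_D[of N] by (simp add: mult.commute)
  also have "\<dots> = (\<Sum>k=0..i. fps_nth D_poly k * A (i - k))"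
    by (simp add: fps_mult_nth A_def)
  also have "\<dots> = A i - (\<Sum>k=1..i. modular_coeff k q * A (i - k))"
    by (subst sum.atLeast_Suc_atMost) (auto simp: D_poly_nth sum_negf)
  finally have "A i = fps_nth N i + (\<Sum>k=1..i. modular_coeff k q * A (i - k))" by simp
  then have "A i oo xi_q = (fps_nth N i oo xi_q) + (\<Sum>k=1..i. modular_coeff k q * A (i - k) oo xi_q)"
    by (metis compose_xi_simps(1) fps_compose_sum_distrib)
  then show ?thesis by (simp add: a_def A_def compose_xi_simps compose_xi_polys)
qed

text \<open>
  Both sides satisfy the recurrence of order five given by the modular equation; the five
  numerators encode the initial values.
\<close>
lemma seed_section_eq_row:
  fixes N :: "rat fps fps" and G H :: "rat fps"
  defines "a \<equiv> \<lambda>i. fps_nth (N / D_poly) i oo xi_q" and "u \<equiv> seed_section G"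
    and "c \<equiv> \<lambda>k. modular_coeff k xi_q" and "n \<equiv> \<lambda>i. fps_nth N i oo xi_q"
  assumes n: "n 0 = 0" "\<And>i. i > 5 \<Longrightarrow> n i = 0"
  assumes init: "u 4 = n 1 * H" "c 2 * u 3 + c 3 * u 2 + c 4 * u 1 + c 5 * u 0 = n 2 * H"
    "c 3 * u 3 + c 4 * u 2 + c 5 * u 1 = n 3 * H" "c 4 * u 3 + c 5 * u 2 = n 4 * H"
    "c 5 * u 3 = n 5 * H"
  assumes pos: "i \<ge> 1"
  shows "u (i + 3) = a i * H"
  using pos
proof (induction i rule: less_induct)
  case (less i)
  have a: "a i = n i + (\<Sum>k=1..i. c k * a (i - k))" for i
    using quotient_row_recurrence[of N i] by (simp add: a_def n_def c_def)
  have u: "u (j + 5) = c 1 * u (j + 4) + c 2 * u (j + 3) + c 3 * u (j + 2) + c 4 * u (j + 1) + c 5 * u j" for j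
    unfolding u_def c_def by (rule seed_section_recurrence)
  have a0: "a 0 = 0" using a[of 0] n by simp
  consider "i = 1" | "i = 2" | "i = 3" | "i = 4" | "i = 5" | "i > 5" using less.prems by linarith
  then show ?case
  proof cases
    case 1
    then show ?thesis using a[of 1] a0 init(1) by simp
  next
    case 2
    have "a 2 = n 2 + c 1 * a 1" using a[of 2] a0 by (simp add: eval_nat_numeral)
    moreover have "u 4 = a 1 * H" using less.IH[of 1] 2 by simp
    ultimately show ?thesis using u[of 0] init(2) 2 by (simp add: algebra_simps flip: numeral_2_eq_2)
  next
    case 3
    have "a 3 = n 3 + c 1 * a 2 + c 2 * a 1" using a[of 3] a0 by (simp add: eval_nat_numeral)
    moreover have "u 4 = a 1 * H" "u 5 = a 2 * H" using less.IH[of 1] less.IH[of 2] 3 by simp_all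
    ultimately show ?thesis using u[of 1] init(3) 3 by (simp add: algebra_simps flip: numeral_2_eq_2)
  next
    case 4
    have "a 4 = n 4 + c 1 * a 3 + c 2 * a 2 + c 3 * a 1" using a[of 4] a0 by (simp add: eval_nat_numeral)
    moreover have "u 4 = a 1 * H" "u 5 = a 2 * H" "u 6 = a 3 * H"
      using less.IH[of 1] less.IH[of 2] less.IH[of 3] 4 by simp_all
    ultimately show ?thesis using u[of 2] init(4) 4 by (simp add: algebra_simps flip: numeral_2_eq_2)
  next
    case 5
    have "a 5 = n 5 + c 1 * a 4 + c 2 * a 3 + c 3 * a 2 + c 4 * a 1"
      using a[of 5] a0 by (simp add: eval_nat_numeral)
    moreover have "u 4 = a 1 * H" "u 5 = a 2 * H" "u 6 = a 3 * H" "u 7 = a 4 * H"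
      using less.IH[of 1] less.IH[of 2] less.IH[of 3] less.IH[of 4] 5 by simp_all
    ultimately show ?thesis using u[of 3] init(5) 5 by (simp add: algebra_simps flip: numeral_2_eq_2)
  next
    case 6
    then obtain j where j: "i = j + 6" using that[of "i - 6"] by simp
    have "(\<Sum>k=1..i. c k * a (i - k)) = (\<Sum>k=1..5. c k * a (i - k))"
      by (rule sum.mono_neutral_right) (auto simp: j c_def)
    also have "\<dots> = c 1 * a (j + 5) + c 2 * a (j + 4) + c 3 * a (j + 3) + c 4 * a (j + 2) + c 5 * a (j + 1)"
      by (simp add: j eval_nat_numeral)
    finally have "a i = c 1 * a (j + 5) + c 2 * a (j + 4) + c 3 * a (j + 3) + c 4 * a (j + 2) + c 5 * a (j + 1)"
      using a[of i] n(2) 6 by simp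
    moreover have "u (j + 8) = a (j + 5) * H" "u (j + 7) = a (j + 4) * H" "u (j + 6) = a (j + 3) * H"
      "u (j + 5) = a (j + 2) * H" "u (j + 4) = a (j + 1) * H"
      using less.IH[of "j + 5"] less.IH[of "j + 4"] less.IH[of "j + 3"] less.IH[of "j + 2"] less.IH[of "j + 1"] j
      by (simp_all add: eval_nat_numeral)
    ultimately show ?thesis using u[of "j + 4"] by (simp add: j algebra_simps)
  qed
qed

lemma xi_facts: "1 + 5 * xi_q \<noteq> 0" "1 + 4 * xi_q \<noteq> 0" "xi_q \<noteq> 0"
  using xi_basic(12,14,15)[OF refl refl refl refl refl refl refl] by auto

text \<open>
  The triangular system of \<open>delta_values\<close>, solved for the values themselves with the common denominator
  \<open>(1 + 5 * xi)^4\<close>.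
\<close>
lemma delta_scaled:
  assumes "u = seed_section delta_q" "\<xi> = xi_q" "t = 1 + 5 * \<xi>" "H = gamma_q"
  shows "t ^ 4 * u 3 = 5 * \<xi> * (1 + 4 * \<xi>) * t ^ 3 * H"
    "t ^ 4 * u 2 = (\<xi> * t ^ 2 - 20 * \<xi> * (1 + 4 * \<xi>) * t ^ 3) * H"
    "t ^ 4 * u 1 = ((1 + 4 * \<xi>) * t ^ 2 - 8 * \<xi> * t ^ 2 + 80 * \<xi> * (1 + 4 * \<xi>) * t ^ 3) * H"
    "t ^ 4 * u 0 = (5 * \<xi> * (1 + 4 * \<xi>) - 12 * (1 + 4 * \<xi>) * t ^ 2 + 48 * \<xi> * t ^ 2 - 320 * \<xi> * (1 + 4 * \<xi>) * t ^ 3) * H"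
proof -
  note v = delta_values[OF refl refl refl refl refl refl refl, folded assms(1), folded assms(2),
      folded assms(3,4)]
  have U3: "t ^ 4 * u 3 = 5 * \<xi> * (1 + 4 * \<xi>) * t ^ 3 * H"
  proof -
    have "t ^ 4 * u 3 = t ^ 3 * (t * u 3)" by algebra
    then show ?thesis unfolding v by algebra
  qed
  have U2: "t ^ 4 * u 2 = (\<xi> * t ^ 2 - 20 * \<xi> * (1 + 4 * \<xi>) * t ^ 3) * H"
  proof -
    have "t ^ 4 * u 2 = t ^ 2 * (t ^ 2 * (u 2 + 4 * u 3)) - 4 * (t ^ 4 * u 3)" by algebra
    then show ?thesis unfolding v U3 by algebra
  qed
  have U1: "t ^ 4 * u 1 = ((1 + 4 * \<xi>) * t ^ 2 - 8 * \<xi> * t ^ 2 + 80 * \<xi> * (1 + 4 * \<xi>) * t ^ 3) * H"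
  proof -
    have "t ^ 4 * u 1 = t ^ 2 * (t ^ 2 * (u 1 + 8 * u 2 + 16 * u 3)) - 8 * (t ^ 4 * u 2) - 16 * (t ^ 4 * u 3)" by algebra
    then show ?thesis unfolding v U3 U2 by algebra
  qed
  have U0: "t ^ 4 * u 0 = (5 * \<xi> * (1 + 4 * \<xi>) - 12 * (1 + 4 * \<xi>) * t ^ 2 + 48 * \<xi> * t ^ 2 - 320 * \<xi> * (1 + 4 * \<xi>) * t ^ 3) * H"
  proof -
    have "t ^ 4 * u 0 = t ^ 4 * (u 0 + 12 * u 1 + 48 * u 2 + 64 * u 3) - 12 * (t ^ 4 * u 1) - 48 * (t ^ 4 * u 2) - 64 * (t ^ 4 * u 3)" by algebra
    then show ?thesis unfolding v U3 U2 U1 by algebra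
  qed
  show "t ^ 4 * u 3 = 5 * \<xi> * (1 + 4 * \<xi>) * t ^ 3 * H" "t ^ 4 * u 2 = (\<xi> * t ^ 2 - 20 * \<xi> * (1 + 4 * \<xi>) * t ^ 3) * H"
    "t ^ 4 * u 1 = ((1 + 4 * \<xi>) * t ^ 2 - 8 * \<xi> * t ^ 2 + 80 * \<xi> * (1 + 4 * \<xi>) * t ^ 3) * H"
    "t ^ 4 * u 0 = (5 * \<xi> * (1 + 4 * \<xi>) - 12 * (1 + 4 * \<xi>) * t ^ 2 + 48 * \<xi> * t ^ 2 - 320 * \<xi> * (1 + 4 * \<xi>) * t ^ 3) * H" by (fact U3 U2 U1 U0)+
qed

text \<open>
  Only the initial conditions of \<open>seed_section_eq_row\<close> are left to check: polynomial identities in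
  \<open>xi_q\<close> after multiplication by \<open>(1 + 5 * xi)^4\<close>.
\<close>
lemma section_delta_row:
  assumes "i \<ge> 1"
  shows "seed_section delta_q (i + 3) = (fps_nth (N_beta / D_poly) i oo xi_q) * gamma_q"
proof (rule seed_section_eq_row[OF _ _ _ _ _ _ _ assms])
  note val = delta_values[OF refl refl refl refl refl refl refl]
  obtain u where u: "u = seed_section delta_q" by simp
  obtain \<xi> t H where xi: "\<xi> = xi_q" and t: "t = 1 + 5 * \<xi>" and H: "H = gamma_q" by simp
  have tnz: "t \<noteq> 0" using xi_facts by (simp add: t xi)
  note v = val[folded u, folded xi, folded t H]
  note U = delta_scaled[OF u xi t H]
  note U3 = U(1) and U2 = U(2) and U1 = U(3) and U0 = U(4)
  have nth: "fps_nth N_beta i oo xi_q = beta_numer i \<xi>" for i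
    by (simp add: N_beta_nth compose_xi_polys xi)
  show "fps_nth N_beta 0 oo xi_q = 0" "i > 5 \<Longrightarrow> fps_nth N_beta i oo xi_q = 0" for i
    by (simp_all add: nth beta_numer_def)
  show "seed_section delta_q 4 = (fps_nth N_beta 1 oo xi_q) * gamma_q"
    by (simp add: nth v(1) u[symmetric] H[symmetric] beta_numer_def)
  let ?c = "\<lambda>k. modular_coeff k \<xi>"
  have cancel: "x = y" if "t ^ 4 * x = t ^ 4 * y" for x y using that tnz by simp
  have "?c 2 * u 3 + ?c 3 * u 2 + ?c 4 * u 1 + ?c 5 * u 0 = beta_numer 2 \<xi> * H"
  proof (rule cancel)
    have "t ^ 4 * (?c 2 * u 3 + ?c 3 * u 2 + ?c 4 * u 1 + ?c 5 * u 0) =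
        ?c 2 * (t ^ 4 * u 3) + ?c 3 * (t ^ 4 * u 2) + ?c 4 * (t ^ 4 * u 1) + ?c 5 * (t ^ 4 * u 0)"
      by (simp add: algebra_simps)
    also have "\<dots> = t ^ 4 * (beta_numer 2 \<xi> * H)"
      unfolding U3 U2 U1 U0 unfolding modular_coeff_def beta_numer_def t by simp algebra
    finally show "t ^ 4 * (?c 2 * u 3 + ?c 3 * u 2 + ?c 4 * u 1 + ?c 5 * u 0) = t ^ 4 * (beta_numer 2 \<xi> * H)" .
  qed
  then show "modular_coeff 2 xi_q * seed_section delta_q 3 + modular_coeff 3 xi_q * seed_section delta_q 2
      + modular_coeff 4 xi_q * seed_section delta_q 1 + modular_coeff 5 xi_q * seed_section delta_q 0
      = (fps_nth N_beta 2 oo xi_q) * gamma_q"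
    by (simp only: nth u xi H)
  have "?c 3 * u 3 + ?c 4 * u 2 + ?c 5 * u 1 = beta_numer 3 \<xi> * H"
  proof (rule cancel)
    have "t ^ 4 * (?c 3 * u 3 + ?c 4 * u 2 + ?c 5 * u 1) =
        ?c 3 * (t ^ 4 * u 3) + ?c 4 * (t ^ 4 * u 2) + ?c 5 * (t ^ 4 * u 1)"
      by (simp add: algebra_simps)
    also have "\<dots> = t ^ 4 * (beta_numer 3 \<xi> * H)"
      unfolding U3 U2 U1 unfolding modular_coeff_def beta_numer_def t by simp algebra
    finally show "t ^ 4 * (?c 3 * u 3 + ?c 4 * u 2 + ?c 5 * u 1) = t ^ 4 * (beta_numer 3 \<xi> * H)" .
  qed
  then show "modular_coeff 3 xi_q * seed_section delta_q 3 + modular_coeff 4 xi_q * seed_section delta_q 2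
      + modular_coeff 5 xi_q * seed_section delta_q 1 = (fps_nth N_beta 3 oo xi_q) * gamma_q"
    by (simp only: nth u xi H)
  have "?c 4 * u 3 + ?c 5 * u 2 = beta_numer 4 \<xi> * H"
  proof (rule cancel)
    have "t ^ 4 * (?c 4 * u 3 + ?c 5 * u 2) = ?c 4 * (t ^ 4 * u 3) + ?c 5 * (t ^ 4 * u 2)"
      by (simp add: algebra_simps)
    also have "\<dots> = t ^ 4 * (beta_numer 4 \<xi> * H)"
      unfolding U3 U2 unfolding modular_coeff_def beta_numer_def t by simp algebra
    finally show "t ^ 4 * (?c 4 * u 3 + ?c 5 * u 2) = t ^ 4 * (beta_numer 4 \<xi> * H)" .
  qed
  then show "modular_coeff 4 xi_q * seed_section delta_q 3 + modular_coeff 5 xi_q * seed_section delta_q 2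
      = (fps_nth N_beta 4 oo xi_q) * gamma_q"
    by (simp only: nth u xi H)
  have "?c 5 * u 3 = beta_numer 5 \<xi> * H"
  proof (rule cancel)
    have "t ^ 4 * (?c 5 * u 3) = ?c 5 * (t ^ 4 * u 3)"
      by (simp add: algebra_simps)
    also have "\<dots> = t ^ 4 * (beta_numer 5 \<xi> * H)"
      unfolding U3 unfolding modular_coeff_def beta_numer_def t by simp algebra
    finally show "t ^ 4 * (?c 5 * u 3) = t ^ 4 * (beta_numer 5 \<xi> * H)" .
  qed
  then show "modular_coeff 5 xi_q * seed_section delta_q 3 = (fps_nth N_beta 5 oo xi_q) * gamma_q"
    by (simp only: nth u xi H)
qed

lemma gamma_scaled:
  assumes "u = seed_section gamma_q" "\<xi> = xi_q" "t = 1 + 5 * \<xi>" "H = delta_q"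
  shows "t ^ 4 * u 3 = (\<xi> * t ^ 3 + 4 * \<xi> * t ^ 4) * H"
    "t ^ 4 * u 2 = (- \<xi> * t ^ 2 - 8 * (\<xi> * t ^ 3 + 4 * \<xi> * t ^ 4) + 16 * \<xi> * t ^ 4) * H"
    "t ^ 4 * u 1 = (((1 + 4 * \<xi>) ^ 2 - 3 * \<xi> * (1 + 4 * \<xi>) + 16 * \<xi> ^ 2) * t - 8 * (- \<xi> * t ^ 2 - 8 * (\<xi> * t ^ 3 + 4 * \<xi> * t ^ 4) + 16 * \<xi> * t ^ 4) - 16 * (\<xi> * t ^ 3 + 4 * \<xi> * t ^ 4)) * H"
    "t ^ 4 * u 0 = ((8 * \<xi> ^ 2 + \<xi> * (1 + 4 * \<xi>) - 2 * (1 + 4 * \<xi>) ^ 2) - 12 * (((1 + 4 * \<xi>) ^ 2 - 3 * \<xi> * (1 + 4 * \<xi>) + 16 * \<xi> ^ 2) * t - 8 * (- \<xi> * t ^ 2 - 8 * (\<xi> * t ^ 3 + 4 * \<xi> * t ^ 4) + 16 * \<xi> * t ^ 4) - 16 * (\<xi> * t ^ 3 + 4 * \<xi> * t ^ 4)) - 48 * (- \<xi> * t ^ 2 - 8 * (\<xi> * t ^ 3 + 4 * \<xi> * t ^ 4) + 16 * \<xi> * t ^ 4) - 64 * (\<xi> * t ^ 3 + 4 * \<xi> * t ^ 4)) * H"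
proof -
  note v = gamma_values[OF refl refl refl refl refl refl refl, folded assms(1), folded assms(2),
      folded assms(3,4)]
  have U3: "t ^ 4 * u 3 = (\<xi> * t ^ 3 + 4 * \<xi> * t ^ 4) * H"
  proof -
    have "t ^ 4 * u 3 = t ^ 3 * (t * (u 3 + 4 * u 4)) - 4 * t ^ 4 * u 4" by algebra
    then show ?thesis unfolding v(2-5) unfolding v(1) by algebra
  qed
  have U2: "t ^ 4 * u 2 = (- \<xi> * t ^ 2 - 8 * (\<xi> * t ^ 3 + 4 * \<xi> * t ^ 4) + 16 * \<xi> * t ^ 4) * H"
  proof -
    have "t ^ 4 * u 2 = t ^ 2 * (t ^ 2 * (u 2 + 8 * u 3 + 16 * u 4)) - 8 * (t ^ 4 * u 3) - 16 * t ^ 4 * u 4" by algebra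
    then show ?thesis unfolding v(2-5) unfolding v(1) U3 by algebra
  qed
  have U1: "t ^ 4 * u 1 = (((1 + 4 * \<xi>) ^ 2 - 3 * \<xi> * (1 + 4 * \<xi>) + 16 * \<xi> ^ 2) * t - 8 * (- \<xi> * t ^ 2 - 8 * (\<xi> * t ^ 3 + 4 * \<xi> * t ^ 4) + 16 * \<xi> * t ^ 4) - 16 * (\<xi> * t ^ 3 + 4 * \<xi> * t ^ 4)) * H"
  proof -
    have "t ^ 4 * u 1 = t * (t ^ 3 * (u 1 + 8 * u 2 + 16 * u 3)) - 8 * (t ^ 4 * u 2) - 16 * (t ^ 4 * u 3)" by algebra
    then show ?thesis unfolding v(2-5) unfolding v(1) U3 U2 by algebra
  qed
  have U0: "t ^ 4 * u 0 = ((8 * \<xi> ^ 2 + \<xi> * (1 + 4 * \<xi>) - 2 * (1 + 4 * \<xi>) ^ 2) - 12 * (((1 + 4 * \<xi>) ^ 2 - 3 * \<xi> * (1 + 4 * \<xi>) + 16 * \<xi> ^ 2) * t - 8 * (- \<xi> * t ^ 2 - 8 * (\<xi> * t ^ 3 + 4 * \<xi> * t ^ 4) + 16 * \<xi> * t ^ 4) - 16 * (\<xi> * t ^ 3 + 4 * \<xi> * t ^ 4)) - 48 * (- \<xi> * t ^ 2 - 8 * (\<xi> * t ^ 3 + 4 * \<xi> * t ^ 4) + 16 * \<xi> * t ^ 4) - 64 * (\<xi> * t ^ 3 + 4 * \<xi> * t ^ 4)) * H"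
  proof -
    have "t ^ 4 * u 0 = t ^ 4 * (u 0 + 12 * u 1 + 48 * u 2 + 64 * u 3) - 12 * (t ^ 4 * u 1) - 48 * (t ^ 4 * u 2) - 64 * (t ^ 4 * u 3)" by algebra
    then show ?thesis unfolding v(2-5) unfolding v(1) U3 U2 U1 by algebra
  qed
  show "t ^ 4 * u 3 = (\<xi> * t ^ 3 + 4 * \<xi> * t ^ 4) * H" "t ^ 4 * u 2 = (- \<xi> * t ^ 2 - 8 * (\<xi> * t ^ 3 + 4 * \<xi> * t ^ 4) + 16 * \<xi> * t ^ 4) * H"
    "t ^ 4 * u 1 = (((1 + 4 * \<xi>) ^ 2 - 3 * \<xi> * (1 + 4 * \<xi>) + 16 * \<xi> ^ 2) * t - 8 * (- \<xi> * t ^ 2 - 8 * (\<xi> * t ^ 3 + 4 * \<xi> * t ^ 4) + 16 * \<xi> * t ^ 4) - 16 * (\<xi> * t ^ 3 + 4 * \<xi> * t ^ 4)) * H"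
    "t ^ 4 * u 0 = ((8 * \<xi> ^ 2 + \<xi> * (1 + 4 * \<xi>) - 2 * (1 + 4 * \<xi>) ^ 2) - 12 * (((1 + 4 * \<xi>) ^ 2 - 3 * \<xi> * (1 + 4 * \<xi>) + 16 * \<xi> ^ 2) * t - 8 * (- \<xi> * t ^ 2 - 8 * (\<xi> * t ^ 3 + 4 * \<xi> * t ^ 4) + 16 * \<xi> * t ^ 4) - 16 * (\<xi> * t ^ 3 + 4 * \<xi> * t ^ 4)) - 48 * (- \<xi> * t ^ 2 - 8 * (\<xi> * t ^ 3 + 4 * \<xi> * t ^ 4) + 16 * \<xi> * t ^ 4) - 64 * (\<xi> * t ^ 3 + 4 * \<xi> * t ^ 4)) * H" by (fact U3 U2 U1 U0)+
qed

lemma section_gamma_row: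
  assumes "i \<ge> 1"
  shows "seed_section gamma_q (i + 3) = (fps_nth (N_alpha / D_poly) i oo xi_q) * delta_q"
proof (rule seed_section_eq_row[OF _ _ _ _ _ _ _ assms])
  note val = gamma_values[OF refl refl refl refl refl refl refl]
  obtain u where u: "u = seed_section gamma_q" by simp
  obtain \<xi> t H where xi: "\<xi> = xi_q" and t: "t = 1 + 5 * \<xi>" and H: "H = delta_q" by simp
  have tnz: "t \<noteq> 0" using xi_facts by (simp add: t xi)
  note v = val[folded u, folded xi, folded t H]
  note U = gamma_scaled[OF u xi t H]
  note U3 = U(1) and U2 = U(2) and U1 = U(3) and U0 = U(4)
  have nth: "fps_nth N_alpha i oo xi_q = alpha_numer i \<xi>" for i
    by (simp add: N_alpha_nth compose_xi_polys xi)
  show "fps_nth N_alpha 0 oo xi_q = 0" "i > 5 \<Longrightarrow> fps_nth N_alpha i oo xi_q = 0" for i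
    by (simp_all add: nth alpha_numer_def)
  show "seed_section gamma_q 4 = (fps_nth N_alpha 1 oo xi_q) * delta_q"
    by (simp add: nth v(1) u[symmetric] H[symmetric] alpha_numer_def)
  let ?c = "\<lambda>k. modular_coeff k \<xi>"
  have cancel: "x = y" if "t ^ 4 * x = t ^ 4 * y" for x y using that tnz by simp
  have "?c 2 * u 3 + ?c 3 * u 2 + ?c 4 * u 1 + ?c 5 * u 0 = alpha_numer 2 \<xi> * H"
  proof (rule cancel)
    have "t ^ 4 * (?c 2 * u 3 + ?c 3 * u 2 + ?c 4 * u 1 + ?c 5 * u 0) =
        ?c 2 * (t ^ 4 * u 3) + ?c 3 * (t ^ 4 * u 2) + ?c 4 * (t ^ 4 * u 1) + ?c 5 * (t ^ 4 * u 0)"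
      by (simp add: algebra_simps)
    also have "\<dots> = t ^ 4 * (alpha_numer 2 \<xi> * H)"
      unfolding U3 U2 U1 U0 unfolding modular_coeff_def alpha_numer_def t by simp algebra
    finally show "t ^ 4 * (?c 2 * u 3 + ?c 3 * u 2 + ?c 4 * u 1 + ?c 5 * u 0) = t ^ 4 * (alpha_numer 2 \<xi> * H)" .
  qed
  then show "modular_coeff 2 xi_q * seed_section gamma_q 3 + modular_coeff 3 xi_q * seed_section gamma_q 2
      + modular_coeff 4 xi_q * seed_section gamma_q 1 + modular_coeff 5 xi_q * seed_section gamma_q 0
      = (fps_nth N_alpha 2 oo xi_q) * delta_q"
    by (simp only: nth u xi H)
  have "?c 3 * u 3 + ?c 4 * u 2 + ?c 5 * u 1 = alpha_numer 3 \<xi> * H"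
  proof (rule cancel)
    have "t ^ 4 * (?c 3 * u 3 + ?c 4 * u 2 + ?c 5 * u 1) =
        ?c 3 * (t ^ 4 * u 3) + ?c 4 * (t ^ 4 * u 2) + ?c 5 * (t ^ 4 * u 1)"
      by (simp add: algebra_simps)
    also have "\<dots> = t ^ 4 * (alpha_numer 3 \<xi> * H)"
      unfolding U3 U2 U1 unfolding modular_coeff_def alpha_numer_def t by simp algebra
    finally show "t ^ 4 * (?c 3 * u 3 + ?c 4 * u 2 + ?c 5 * u 1) = t ^ 4 * (alpha_numer 3 \<xi> * H)" .
  qed
  then show "modular_coeff 3 xi_q * seed_section gamma_q 3 + modular_coeff 4 xi_q * seed_section gamma_q 2
      + modular_coeff 5 xi_q * seed_section gamma_q 1 = (fps_nth N_alpha 3 oo xi_q) * delta_q"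
    by (simp only: nth u xi H)
  have "?c 4 * u 3 + ?c 5 * u 2 = alpha_numer 4 \<xi> * H"
  proof (rule cancel)
    have "t ^ 4 * (?c 4 * u 3 + ?c 5 * u 2) = ?c 4 * (t ^ 4 * u 3) + ?c 5 * (t ^ 4 * u 2)"
      by (simp add: algebra_simps)
    also have "\<dots> = t ^ 4 * (alpha_numer 4 \<xi> * H)"
      unfolding U3 U2 unfolding modular_coeff_def alpha_numer_def t by simp algebra
    finally show "t ^ 4 * (?c 4 * u 3 + ?c 5 * u 2) = t ^ 4 * (alpha_numer 4 \<xi> * H)" .
  qed
  then show "modular_coeff 4 xi_q * seed_section gamma_q 3 + modular_coeff 5 xi_q * seed_section gamma_q 2
      = (fps_nth N_alpha 4 oo xi_q) * delta_q"
    by (simp only: nth u xi H)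
  have "?c 5 * u 3 = alpha_numer 5 \<xi> * H"
  proof (rule cancel)
    have "t ^ 4 * (?c 5 * u 3) = ?c 5 * (t ^ 4 * u 3)"
      by (simp add: algebra_simps)
    also have "\<dots> = t ^ 4 * (alpha_numer 5 \<xi> * H)"
      unfolding U3 unfolding modular_coeff_def alpha_numer_def t by simp algebra
    finally show "t ^ 4 * (?c 5 * u 3) = t ^ 4 * (alpha_numer 5 \<xi> * H)" .
  qed
  then show "modular_coeff 5 xi_q * seed_section gamma_q 3 = (fps_nth N_alpha 5 oo xi_q) * delta_q"
    by (simp only: nth u xi H)
qed

section \<open>Power series in \<open>xi_q\<close>\<close>

lemma suminf_xi:
  "(\<Sum>i. fps_const (c i) * xi_q ^ i) = Abs_fps c oo xi_q"
proof -
  have "(\<lambda>n. \<Sum>i<n. fps_const (c i) * xi_q ^ i) \<longlonglongrightarrow> (Abs_fps c oo xi_q)"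
  proof (rule tendsto_fpsI)
    fix k
    have "fps_nth (\<Sum>i<n. fps_const (c i) * xi_q ^ i) k = fps_nth (Abs_fps c oo xi_q) k" if "k < n" for n
    proof -
      have "(\<Sum>i<n. c i * fps_nth (xi_q ^ i) k) = (\<Sum>i=0..k. c i * fps_nth (xi_q ^ i) k)"
        by (rule sum.mono_neutral_right)
          (use that startsby_zero_power_prefix[OF xi_nth_0] in auto)
      then show ?thesis by (simp add: fps_sum_nth fps_compose_nth)
    qed
    then show "\<forall>\<^sub>F n in sequentially. fps_nth (\<Sum>i<n. fps_const (c i) * xi_q ^ i) k = fps_nth (Abs_fps c oo xi_q) k"
      by (auto simp: eventually_at_top_dense)
  qed
  then have "(\<lambda>i. fps_const (c i) * xi_q ^ i) sums (Abs_fps c oo xi_q)"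
    by (simp add: sums_def)
  then show ?thesis by (rule sums_unique[symmetric])
qed

lemma eq_upto_compose_xi: "eq_upto n F G \<Longrightarrow> eq_upto n (F oo xi_q) (G oo xi_q)"
  by (auto simp: eq_upto_def fps_compose_nth intro!: sum.cong)

lemma eq_upto_all: "(\<And>n. eq_upto n F G) \<Longrightarrow> F = G"
  by (auto simp: eq_upto_def fps_eq_iff)

text \<open>
  Linear extension of the row formulas to arbitrary power series in \<open>xi_q\<close>; the steepness of
  the quotient makes every coefficient a finite sum.
\<close>
lemma section_vec_mat:
  fixes N :: "rat fps fps" and G H :: "rat fps" and v :: "nat \<Rightarrow> rat"
  defines "M \<equiv> \<lambda>i j. fps_nth (fps_nth (N / D_poly) i) j"
  assumes steep: "steep N"
    and rows: "\<And>i. i \<ge> 1 \<Longrightarrow> seed_section G (i + 3) = (fps_nth (N / D_poly) i oo xi_q) * H"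
  shows "section_fps 5 2 (G * (\<Sum>i. fps_const (v (Suc i)) * xi_q ^ i)) =
    H * (\<Sum>j. fps_const (vec_mat v M (Suc j)) * xi_q ^ j)"
proof -
  define w where "w = Abs_fps (vec_mat v M)"
  define F where "F = Abs_fps (\<lambda>i. v (Suc i)) oo xi_q"
  have zero: "M i j = 0" if "i > 5 * j" for i j
    using steep_quotient[OF steep] that by (auto simp: steep_def M_def)
  have vec: "vec_mat v M j = (\<Sum>i=1..K. v i * M i j)" if "K \<ge> 5 * j" for j K
    unfolding vec_mat_def
    by (rule sum.mono_neutral_left) (use zero[of j] that in \<open>fastforce simp: not_less[symmetric]\<close>)+
  have "eq_upto n (xi_q * section_fps 5 2 (G * F)) ((w oo xi_q) * H)" for n
  proof -
    \<comment> \<open>enough terms to determine all coefficients up to \<open>q^(5n+2)\<close>, and the steepness bound \<open>5 * n\<close>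
      for the columns \<open>j \<le> n\<close>\<close>
    define K where "K = 5 * n + 3"
    define FK where "FK = (\<Sum>i<K. fps_const (v (Suc i)) * xi_q ^ i)"
    have "eq_upto (5 * n + 2) F FK"
      unfolding eq_upto_def
    proof (intro allI impI)
      fix k assume "k \<le> 5 * n + 2"
      then have "(\<Sum>i<K. v (Suc i) * fps_nth (xi_q ^ i) k) = (\<Sum>i=0..k. v (Suc i) * fps_nth (xi_q ^ i) k)"
        by (intro sum.mono_neutral_right)
          (use startsby_zero_power_prefix[OF xi_nth_0] in \<open>auto simp: K_def\<close>)
      then show "fps_nth F k = fps_nth FK k"
        by (simp add: F_def FK_def fps_sum_nth fps_compose_nth)
    qed
    then have "eq_upto (5 * n + 2) (G * F) (G * FK)"
      by (intro eq_upto_mult eq_upto_refl)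
    then have "eq_upto n (section_fps 5 2 (G * F)) (section_fps 5 2 (G * FK))"
      by (simp add: eq_upto_def section_fps_def)
    then have "eq_upto n (xi_q * section_fps 5 2 (G * F)) (xi_q * section_fps 5 2 (G * FK))"
      by (intro eq_upto_mult eq_upto_refl)
    also have "xi_q * section_fps 5 2 (G * FK) =
        (\<Sum>i<K. fps_const (v (Suc i)) * (xi_q * section_fps 5 2 (G * xi_q ^ i)))"
      by (simp add: FK_def sum_distrib_left section_fps_sum section_fps_const_mult
          mult.left_commute[of G] mult.left_commute[of xi_q])
    also have "\<dots> = (\<Sum>i<K. fps_const (v (Suc i)) * ((fps_nth (N / D_poly) (Suc i) oo xi_q) * H))"
      using rows seed_section_add_4[of G] by (intro sum.cong refl) (simp add: eval_nat_numeral)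
    also have "\<dots> = ((\<Sum>i<K. fps_const (v (Suc i)) * fps_nth (N / D_poly) (Suc i)) oo xi_q) * H"
      by (simp add: fps_compose_sum_distrib sum_distrib_right compose_xi_simps mult.assoc)
    also have "eq_upto n \<dots> ((w oo xi_q) * H)"
    proof (intro eq_upto_mult eq_upto_refl eq_upto_compose_xi)
      show "eq_upto n (\<Sum>i<K. fps_const (v (Suc i)) * fps_nth (N / D_poly) (Suc i)) w"
        unfolding eq_upto_def
      proof (intro allI impI)
        fix j assume "j \<le> n"
        then have "vec_mat v M j = (\<Sum>i=1..K. v i * M i j)" by (intro vec) (simp add: K_def)
        also have "\<dots> = (\<Sum>i<K. v (Suc i) * M (Suc i) j)"
          by (rule sum.reindex_bij_witness[of _ Suc "\<lambda>i. i - 1"]) auto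
        finally show "fps_nth (\<Sum>i<K. fps_const (v (Suc i)) * fps_nth (N / D_poly) (Suc i)) j = fps_nth w j"
          by (simp add: w_def fps_sum_nth M_def)
      qed
    qed
    finally show ?thesis .
  qed
  then have eq: "xi_q * section_fps 5 2 (G * F) = (w oo xi_q) * H"
    by (rule eq_upto_all)
  have "vec_mat v M 0 = 0" using vec[of 0 0] by simp
  then have "w = q * Abs_fps (\<lambda>j. vec_mat v M (Suc j))"
    by (auto simp: w_def fps_eq_iff gr0_conv_Suc)
  then have "w oo xi_q = xi_q * (Abs_fps (\<lambda>j. vec_mat v M (Suc j)) oo xi_q)"
    by (simp add: compose_xi_simps)
  with eq have "xi_q * section_fps 5 2 (G * F) = xi_q * (H * (Abs_fps (\<lambda>j. vec_mat v M (Suc j)) oo xi_q))"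
    by (simp add: mult_ac)
  then show ?thesis
    unfolding suminf_xi F_def using xi_facts(3) by simp
qed

section \<open>The first vector\<close>

text \<open>
  Up to series in \<open>q^5\<close>, the series \<open>xi_q * F\<close> is \<open>(1 + 4 * xi)^4 * (1 + 5 * xi) * seed delta_q\<close>.
  Expanding the polynomial as \<open>1 + xi * W\<close> and dividing by \<open>xi\<close> would leave the term
  \<open>seed delta_q / xi\<close>; the modular equation replaces it by nonnegative powers of \<open>xi\<close>, at the price of
  a factor \<open>modular_coeff 5 Y\<close>.  The section is then a combination of the known values.
\<close>
lemma section_start:
  assumes A: "F * E q ^ 6 = E (q ^ 2) ^ 9"
  shows "section_fps 5 2 F =
    gamma_q * (18 + 720 * xi_q + 7625 * xi_q ^ 2 + 32500 * xi_q ^ 3 + 50000 * xi_q ^ 4)"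
proof -
  obtain e1 e2 e5 e10 \<xi> \<eta> \<eta>' where defs: "e1 = E q" "e2 = E (q ^ 2)" "e5 = E (q ^ 5)" "e10 = E (q ^ 10)"
    "\<xi> = xi_q" "\<eta> = eta_q" "\<eta>' = eta_q oo q ^ 5" by simp
  note xb = xi_basic[OF defs]
  note nz = xb(8-15)
  note val = delta_values[OF defs]
  obtain sd u t H where sd: "sd = seed delta_q" and u: "u = seed_section delta_q"
    and t: "t = 1 + 5 * \<xi>" and H: "H = gamma_q" by simp
  note v = val[folded u, folded t H]
  have \<delta>: "delta_q = e2 * e5 ^ 2" and \<gamma>: "H = e1 ^ 2 * e10"
    by (simp_all add: delta_q_def gamma_q_def defs H)
  have seed: "sd * \<xi> ^ 4 = q ^ 5 * \<eta>' * (e2 * e5 ^ 2)"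
    unfolding sd xb(7) \<delta> ..
  define c where "c = (\<lambda>k. modular_coeff k (\<xi> oo q ^ 5))"
  define W where "W = 21 + 176 * \<xi> + 736 * \<xi> ^ 2 + 1536 * \<xi> ^ 3 + 1280 * \<xi> ^ 4"
  have W: "(1 + 4 * \<xi>) ^ 4 * (1 + 5 * \<xi>) = 1 + \<xi> * W"
    unfolding W_def by algebra
  have F: "F * e1 ^ 6 = e2 ^ 9" using A by (simp add: defs)
  have "(q ^ 4 * e1 ^ 9 * e10 ^ 21) * ((1 + 4 * \<xi>) ^ 4 * (1 + 5 * \<xi>) * sd * e10 ^ 24) =
      (q * (1 + 4 * \<xi>) * (e1 * e10 ^ 5)) ^ 4 * ((1 + 5 * \<xi>) * (e1 ^ 5 * e10)) * sd * e10 ^ 24"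
    by algebra
  also have "\<dots> = (sd * \<xi> ^ 4) * (e2 * e5 ^ 5) ^ 4 * (e2 ^ 5 * e5) * e10 ^ 24"
    unfolding xb(4,6) by algebra
  also have "\<dots> = q ^ 4 * \<eta>' * e5 ^ 23 * e10 ^ 21 * (e2 ^ 9) * (q * (e2 * e10 ^ 3))"
    unfolding seed by algebra
  also have "\<dots> = (q ^ 4 * e1 ^ 9 * e10 ^ 21) * (\<xi> * (\<eta>' * F * e5 ^ 24))"
    unfolding F[symmetric] xb(1)[symmetric] by algebra
  finally have "(q ^ 4 * e1 ^ 9 * e10 ^ 21) * (\<xi> * (\<eta>' * F * e5 ^ 24)) =
      (q ^ 4 * e1 ^ 9 * e10 ^ 21) * ((1 + 4 * \<xi>) ^ 4 * (1 + 5 * \<xi>) * sd * e10 ^ 24)" ..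
  then have start: "\<xi> * (\<eta>' * F * e5 ^ 24) = (1 + \<xi> * W) * sd * e10 ^ 24"
    unfolding W using nz by simp
  have modular: "\<xi> ^ 5 = c 1 * \<xi> ^ 4 + c 2 * \<xi> ^ 3 + c 3 * \<xi> ^ 2 + c 4 * \<xi> + c 5"
    using modular_equation by (simp add: c_def defs)
  obtain M where M: "M = sd * \<xi> ^ 4 - c 1 * (sd * \<xi> ^ 3) - c 2 * (sd * \<xi> ^ 2)
      - c 3 * (sd * \<xi> ^ 1) - c 4 * (sd * \<xi> ^ 0)
      + c 5 * (21 * (sd * \<xi> ^ 0) + 176 * (sd * \<xi> ^ 1) + 736 * (sd * \<xi> ^ 2)
        + 1536 * (sd * \<xi> ^ 3) + 1280 * (sd * \<xi> ^ 4))" by simp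
  have "\<xi> * (M * e10 ^ 24) = (c 5 * (\<xi> * W) + (\<xi> ^ 5 - c 1 * \<xi> ^ 4 - c 2 * \<xi> ^ 3 - c 3 * \<xi> ^ 2 - c 4 * \<xi>)) * sd * e10 ^ 24"
    unfolding M W_def power_one_right power_0 by algebra
  also have "\<xi> ^ 5 - c 1 * \<xi> ^ 4 - c 2 * \<xi> ^ 3 - c 3 * \<xi> ^ 2 - c 4 * \<xi> = c 5"
    unfolding modular by simp
  also have "(c 5 * (\<xi> * W) + c 5) * sd * e10 ^ 24 = c 5 * ((1 + \<xi> * W) * sd * e10 ^ 24)"
    by algebra
  also have "\<dots> = \<xi> * (c 5 * \<eta>' * e5 ^ 24 * F)"
    unfolding start[symmetric] by algebra
  finally have "M * e10 ^ 24 = c 5 * \<eta>' * e5 ^ 24 * F"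
    using nz by simp
  moreover have "e10 ^ 24 = (e2 ^ 24) oo q ^ 5"
    "c 5 * \<eta>' * e5 ^ 24 = (modular_coeff 5 \<xi> * \<eta> * e1 ^ 24) oo q ^ 5"
    using xb(16-18) by (simp_all add: c_def modular_coeff_compose compose_power_mult compose_power_power)
  ultimately have "section_fps 5 2 M * e2 ^ 24 = (modular_coeff 5 \<xi> * \<eta> * e1 ^ 24) * section_fps 5 2 F"
    by (intro section_product_with_scale) simp
  moreover have "section_fps 5 2 M = u 4 - modular_coeff 1 \<xi> * u 3 - modular_coeff 2 \<xi> * u 2
      - modular_coeff 3 \<xi> * u 1 - modular_coeff 4 \<xi> * u 0
      + modular_coeff 5 \<xi> * (21 * u 0 + 176 * u 1 + 736 * u 2 + 1536 * u 3 + 1280 * u 4)"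
    unfolding M c_def defs(5) section_fps_add section_fps_diff section_modular_coeff
      section_fps_numeral_mult sd u seed_section_def ..
  ultimately have sec: "(u 4 - modular_coeff 1 \<xi> * u 3 - modular_coeff 2 \<xi> * u 2
      - modular_coeff 3 \<xi> * u 1 - modular_coeff 4 \<xi> * u 0
      + modular_coeff 5 \<xi> * (21 * u 0 + 176 * u 1 + 736 * u 2 + 1536 * u 3 + 1280 * u 4)) * e2 ^ 24 =
      modular_coeff 5 \<xi> * \<eta> * e1 ^ 24 * section_fps 5 2 F" by simp
  obtain x1 where x1: "x1 = 18 + 720 * \<xi> + 7625 * \<xi> ^ 2 + 32500 * \<xi> ^ 3 + 50000 * \<xi> ^ 4" by simp
  note U = delta_scaled[OF u defs(5) t H]
  have "t ^ 4 * (u 4 - modular_coeff 1 \<xi> * u 3 - modular_coeff 2 \<xi> * u 2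
      - modular_coeff 3 \<xi> * u 1 - modular_coeff 4 \<xi> * u 0
      + modular_coeff 5 \<xi> * (21 * u 0 + 176 * u 1 + 736 * u 2 + 1536 * u 3 + 1280 * u 4)) =
    t ^ 4 * u 4 - modular_coeff 1 \<xi> * (t ^ 4 * u 3) - modular_coeff 2 \<xi> * (t ^ 4 * u 2)
      - modular_coeff 3 \<xi> * (t ^ 4 * u 1) - modular_coeff 4 \<xi> * (t ^ 4 * u 0)
      + modular_coeff 5 \<xi> * (21 * (t ^ 4 * u 0) + 176 * (t ^ 4 * u 1) + 736 * (t ^ 4 * u 2)
        + 1536 * (t ^ 4 * u 3) + 1280 * (t ^ 4 * u 4))"
    by (simp add: algebra_simps)
  also have "\<dots> = x1 * \<xi> * (1 + 4 * \<xi>) * t ^ 3 * H"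
    unfolding U v(1) unfolding modular_coeff_def x1 t by simp algebra
  finally have Mt: "t ^ 4 * (u 4 - modular_coeff 1 \<xi> * u 3 - modular_coeff 2 \<xi> * u 2
      - modular_coeff 3 \<xi> * u 1 - modular_coeff 4 \<xi> * u 0
      + modular_coeff 5 \<xi> * (21 * u 0 + 176 * u 1 + 736 * u 2 + 1536 * u 3 + 1280 * u 4)) =
      x1 * \<xi> * (1 + 4 * \<xi>) * t ^ 3 * H" .
  have c5: "modular_coeff 5 \<xi> = \<xi> * t ^ 4"
    unfolding t modular_coeff_def by simp algebra
  obtain T where T: "T = section_fps 5 2 F" by simp
  have "(\<xi> * t ^ 3) * (t ^ 5 * \<eta> * e1 ^ 24 * T) = t ^ 4 * (modular_coeff 5 \<xi> * \<eta> * e1 ^ 24 * T)"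
    unfolding c5 by algebra
  also have "\<dots> = (\<xi> * t ^ 3) * (x1 * (1 + 4 * \<xi>) * H * e2 ^ 24)"
    unfolding T sec[symmetric] mult.assoc[symmetric] Mt by algebra
  finally have "t ^ 5 * \<eta> * e1 ^ 24 * T = x1 * (1 + 4 * \<xi>) * H * e2 ^ 24"
    using nz by (simp add: t)
  then have "(e1 * e10 ^ 5 * (e1 ^ 4 * e10 ^ 2) * (e1 ^ 3 * e5)) * (t ^ 5 * \<eta> * e1 ^ 24 * T) =
      (e1 * e10 ^ 5 * (e1 ^ 4 * e10 ^ 2) * (e1 ^ 3 * e5)) * (x1 * (1 + 4 * \<xi>) * H * e2 ^ 24)"
    by simp
  also have "\<dots> = e1 * e10 ^ 5 * (e1 ^ 3 * e5) * x1 * H * e2 ^ 24 * (e2 ^ 2 * e5 ^ 4)"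
    unfolding xb(5)[symmetric] by algebra
  also have "(e1 * e10 ^ 5 * (e1 ^ 4 * e10 ^ 2) * (e1 ^ 3 * e5)) * (t ^ 5 * \<eta> * e1 ^ 24 * T) =
      ((1 + 5 * \<xi>) * (e1 ^ 5 * e10)) ^ 5 * (\<eta> * (e1 ^ 3 * e5)) * (e1 ^ 4 * e10 ^ 2) * T"
    unfolding t by algebra
  also have "\<dots> = (e2 ^ 5 * e5) ^ 5 * (e2 * e10 ^ 3) * (e1 ^ 4 * e10 ^ 2) * T"
    unfolding xb(3,6) ..
  finally have "(e2 ^ 26 * e5 ^ 5 * e1 ^ 4 * e10 ^ 5) * T = (e2 ^ 26 * e5 ^ 5 * e1 ^ 4 * e10 ^ 5) * (x1 * H)"
    by algebra
  then have "T = x1 * H" using nz by simp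
  then show ?thesis by (simp add: T x1 H defs mult.commute)
qed

section \<open>Jacobi's identity for the cube of \<open>E q\<close>\<close>

lemma qbinom_const_poly: "qbinom [:p:] n j = [:qbinom p n j:]"
  by (induction p n j rule: qbinom.induct) (simp_all add: poly_const_pow one_pCons)

lemma pderiv_sum: "pderiv (\<Sum>i\<in>I. f i) = (\<Sum>i\<in>I. pderiv (f i))"
  by (induction I rule: infinite_finite_induct) (simp_all add: pderiv_add)

text \<open>
  The \<open>q\<close>-binomial theorem gives the coefficients of a polynomial that vanishes at \<open>1\<close> because of the
  factor with index \<open>N\<close>; its derivative there is the product of the other factors.
\<close>
lemma sum_split_factor:
  fixes N :: nat
  defines "c \<equiv> \<lambda>j. (- 1) ^ j * q ^ ((j choose 2) + N * (2 * N + 1 - j)) * qbinom q (2 * N + 1) j"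
  shows "(\<Sum>j\<le>2 * N + 1. c j) = 0"
    and "(\<Sum>j\<le>2 * N + 1. of_nat j * c j) = - (q ^ N * (\<Prod>k\<in>{..<2 * N + 1} - {N}. q ^ N - q ^ k))"
proof -
  define n where "n = 2 * N + 1"
  define P where "P = (\<Prod>k<n. [:q ^ N:] + (- monom 1 1) * [:q:] ^ k)"
  have coeffs: "P = (\<Sum>j\<le>n. monom (c j) j)"
  proof -
    have "P = (\<Sum>j\<le>n. [:q:] ^ (j choose 2) * qbinom [:q:] n j * (- monom 1 1) ^ j * [:q ^ N:] ^ (n - j))"
      unfolding P_def by (rule qbinomial_theorem)
    also have "\<dots> = (\<Sum>j\<le>n. monom (c j) j)"
    proof (intro sum.cong refl)
      fix j
      have "(- monom 1 1 :: rat fps poly) ^ j = smult ((- 1) ^ j) (monom 1 j)"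
        by (induction j) (simp_all add: monom_Suc mult_monom)
      then show "[:q:] ^ (j choose 2) * qbinom [:q:] n j * (- monom 1 1) ^ j * [:q ^ N:] ^ (n - j) = monom (c j) j"
        by (simp add: qbinom_const_poly poly_const_pow c_def n_def smult_monom power_add power_mult mult_ac)
    qed
    finally show ?thesis .
  qed
  have factor: "[:q ^ N:] + (- monom 1 1) * [:q:] ^ k = [:q ^ N, - (q ^ k):]" for k
    by (simp add: poly_const_pow monom_altdef)
  have P: "P = [:q ^ N, - (q ^ N):] * (\<Prod>k\<in>{..<n} - {N}. [:q ^ N, - (q ^ k):])"
    unfolding P_def factor by (rule prod.remove) (auto simp: n_def)
  have "poly P 1 = 0" by (simp add: P)
  then show "(\<Sum>j\<le>2 * N + 1. c j) = 0"
    by (simp add: coeffs poly_sum poly_monom n_def)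
  have derivative: "poly (pderiv P) 1 = (\<Sum>j\<le>n. of_nat j * c j)"
    by (simp add: coeffs pderiv_sum poly_sum poly_monom pderiv_monom)
  have "poly (pderiv P) 1 = - (q ^ N * (\<Prod>k\<in>{..<n} - {N}. q ^ N - q ^ k))"
    unfolding P pderiv_mult by (simp add: pderiv_pCons poly_prod)
  then show "(\<Sum>j\<le>2 * N + 1. of_nat j * c j) = - (q ^ N * (\<Prod>k\<in>{..<2 * N + 1} - {N}. q ^ N - q ^ k))"
    unfolding derivative by (simp add: n_def)
qed

text \<open>
  The two sums of \<open>sum_split_factor\<close>, combined so that the weight \<open>j - N\<close> is centred.
\<close>
lemma finite_jacobi_cube:
  "(\<Sum>j\<le>2 * N + 1. fps_const (int_sign (int j - int N) * of_int (int j - int N)) *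
      q ^ nat (half_quad 1 (- 1) (int j - int N)) * qbinom q (2 * N + 1) j) = - (qpoch q N ^ 2)"
proof -
  define c where "c = (\<lambda>j. (- 1) ^ j * q ^ ((j choose 2) + N * (2 * N + 1 - j)) * qbinom q (2 * N + 1) j)"
  define C where "C = (N choose 2) + N * N + N"
  have sums: "(\<Sum>j\<le>2 * N + 1. c j) = 0"
    "(\<Sum>j\<le>2 * N + 1. of_nat j * c j) = - (q ^ N * (\<Prod>k\<in>{..<2 * N + 1} - {N}. q ^ N - q ^ k))"
    unfolding c_def by (rule sum_split_factor)+
  have prod: "q ^ N * (\<Prod>k\<in>{..<2 * N + 1} - {N}. q ^ N - q ^ k) = (- 1) ^ N * q ^ C * qpoch q N ^ 2"
  proof -
    have split: "{..<2 * N + 1} - {N} = {..<N} \<union> {N + 1..2 * N}" by auto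
    have "(\<Prod>k<N. q ^ N - q ^ k) = (\<Prod>k<N. (- 1) * q ^ k * (1 - q ^ (N - k)))"
      by (intro prod.cong refl) (simp add: algebra_simps flip: power_add)
    also have "\<dots> = (- 1) ^ N * (\<Prod>k<N. q ^ k) * (\<Prod>k<N. 1 - q ^ (N - k))"
      by (simp only: prod.distrib prod_constant card_lessThan)
    also have "(\<Prod>k<N. q ^ k) = q ^ (N choose 2)"
      by (induction N) (simp_all add: Suc_choose_2 power_add numeral_2_eq_2)
    also have "(\<Prod>k<N. 1 - q ^ (N - k)) = qpoch q N"
      unfolding qpoch_def
      by (rule prod.reindex_bij_witness[of _ "\<lambda>i. N - i" "\<lambda>i. N - i"]) auto
    finally have 1: "(\<Prod>k<N. q ^ N - q ^ k) = (- 1) ^ N * q ^ (N choose 2) * qpoch q N" .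
    have "(\<Prod>k=N + 1..2 * N. q ^ N - q ^ k) = (\<Prod>i=1..N. q ^ N * (1 - q ^ i))"
      by (rule prod.reindex_bij_witness[of _ "\<lambda>i. N + i" "\<lambda>k. k - N"])
        (auto simp: algebra_simps simp flip: power_add)
    then have 2: "(\<Prod>k=N + 1..2 * N. q ^ N - q ^ k) = q ^ (N * N) * qpoch q N"
      by (simp add: prod.distrib qpoch_def power_mult)
    have "(\<Prod>k\<in>{..<2 * N + 1} - {N}. q ^ N - q ^ k) =
        (\<Prod>k<N. q ^ N - q ^ k) * (\<Prod>k=N + 1..2 * N. q ^ N - q ^ k)"
      unfolding split by (rule prod.union_disjoint) auto
    then show ?thesis
      unfolding 1 2 by (simp add: C_def power_add power2_eq_square mult_ac)
  qed
  have summand: "(of_nat j - of_nat N) * c j = (- 1) ^ N * q ^ C *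
      (fps_const (int_sign (int j - int N) * of_int (int j - int N)) *
        q ^ nat (half_quad 1 (- 1) (int j - int N)) * qbinom q (2 * N + 1) j)" if "j \<le> 2 * N + 1" for j
  proof -
    define i where "i = int j - int N"
    have hq: "half_quad 1 (- 1) i \<ge> 0" "2 * half_quad 1 (- 1) i = i\<^sup>2 - i"
      using half_quad_bounds(1)[of 1 "- 1" i] double_half_quad[of 1 "- 1" i] by auto
    have diff: "int (2 * N + 1 - j) = 2 * int N + 1 - int j" using that by auto
    have "2 * int ((j choose 2) + N * (2 * N + 1 - j)) = 2 * int (C + nat (half_quad 1 (- 1) i))"
      unfolding of_nat_add of_nat_mult distrib_left double_choose_2 diff C_def
      using hq by (simp add: double_choose_2 i_def power2_eq_square algebra_simps)
    then have exp: "(j choose 2) + N * (2 * N + 1 - j) = C + nat (half_quad 1 (- 1) i)"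
      by (simp only: mult_cancel_left of_nat_eq_iff) simp
    have sign: "(- 1 :: rat fps) ^ k = fps_const (int_sign (int k))" for k
      by (induction k) (auto simp: int_sign_def)
    have "(- 1 :: rat fps) ^ j = (- 1) ^ N * fps_const (int_sign i)"
      unfolding sign by (simp add: i_def int_sign_def)
    moreover have "(of_nat j - of_nat N :: rat fps) = fps_const (of_int i)"
      by (simp add: i_def flip: fps_of_nat fps_const_sub)
    ultimately show ?thesis
      unfolding c_def exp i_def[symmetric] by (simp add: power_add mult_ac flip: fps_const_mult)
  qed
  have "(- 1) ^ N * q ^ C * (\<Sum>j\<le>2 * N + 1. fps_const (int_sign (int j - int N) * of_int (int j - int N)) *
      q ^ nat (half_quad 1 (- 1) (int j - int N)) * qbinom q (2 * N + 1) j) =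
      (\<Sum>j\<le>2 * N + 1. (of_nat j - of_nat N) * c j)"
    unfolding sum_distrib_left by (intro sum.cong refl) (simp only: summand atMost_iff)
  also have "\<dots> = (\<Sum>j\<le>2 * N + 1. of_nat j * c j) - of_nat N * (\<Sum>j\<le>2 * N + 1. c j)"
    by (simp only: left_diff_distrib sum_subtractf sum_distrib_left)
  also have "\<dots> = (- 1) ^ N * q ^ C * (- (qpoch q N ^ 2))"
    unfolding sums prod by simp
  finally have eq: "(- 1) ^ N * q ^ C * (\<Sum>j\<le>2 * N + 1. fps_const (int_sign (int j - int N) * of_int (int j - int N)) *
      q ^ nat (half_quad 1 (- 1) (int j - int N)) * qbinom q (2 * N + 1) j) =
      (- 1) ^ N * q ^ C * (- (qpoch q N ^ 2))" .
  have "(- 1) ^ N * q ^ C \<noteq> (0 :: rat fps)" by simp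
  from iffD1[OF mult_left_cancel[OF this] eq] show ?thesis .
qed

lemma E_eq_upto_qpoch: "m \<le> N \<Longrightarrow> eq_upto m (E q) (qpoch q N)"
  using E_eq_eprod[of 1] eprod_nth[of _ N "\<lambda>_. 1"] by (simp add: eq_upto_def qpoch_def)

text \<open>
  The limit of \<open>finite_jacobi_cube\<close>, multiplied by one more factor \<open>E q\<close>; the truncation argument is
  that of \<open>jacobi_triple_product\<close>.
\<close>
lemma jacobi_cube_index:
  "gsum UNIV (\<lambda>i. int_sign i * of_int i) (half_quad 1 (- 1)) = - (E q ^ 3)"
proof (rule fps_ext)
  fix n :: nat
  define N where "N = 2 * n + 2"
  let ?e = "half_quad 1 (- 1)"
  have e: "?e i \<ge> 0" "\<bar>i\<bar> - 1 \<le> ?e i" for i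
    using half_quad_bounds[of 1 "- 1" i] by auto
  have "eq_upto n (- (E q ^ 3)) (- (qpoch q N ^ 2) * qpoch q N)"
  proof -
    have "eq_upto n (E q ^ 3) (qpoch q N ^ 3)"
      by (intro eq_upto_power E_eq_upto_qpoch) (simp add: N_def)
    then show ?thesis by (simp add: eq_upto_def power3_eq_cube power2_eq_square)
  qed
  then have trunc: "fps_nth (- (E q ^ 3)) n = fps_nth (- (qpoch q N ^ 2) * qpoch q N) n"
    by (simp add: eq_upto_def)
  have assoc: "fps_const a * X * Y * Z = fps_const a * (X * (Y * Z))" for a and X Y Z :: "rat fps"
    by (simp only: mult.assoc)
  have "fps_nth (- (qpoch q N ^ 2) * qpoch q N) n =
      (\<Sum>j\<le>2 * N + 1. int_sign (int j - int N) * of_int (int j - int N) *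
      fps_nth (q ^ nat (?e (int j - int N)) * (qbinom q (2 * N + 1) j * qpoch q N)) n)"
    unfolding finite_jacobi_cube[symmetric]
    by (simp only: sum_distrib_right fps_sum_nth assoc fps_mult_left_const_nth)
  also have "\<dots> = (\<Sum>j\<le>2 * N + 1. if ?e (int j - int N) = int n
      then int_sign (int j - int N) * of_int (int j - int N) else 0)"
  proof (intro sum.cong refl)
    fix j assume j: "j \<in> {..2 * N + 1}"
    define i where "i = int j - int N"
    have "fps_nth (q ^ nat (?e i) * (qbinom q (2 * N + 1) j * qpoch q N)) n = of_bool (?e i = int n)"
    proof (cases "\<bar>i\<bar> \<le> int n + 1")
      case True
      have "eq_upto n (qbinom (q ^ 1) (2 * N + 1) j * qpoch (q ^ 1) N) 1"
        by (rule qbinom_limit) (use True in \<open>auto simp: i_def N_def\<close>)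
      then have "eq_upto n (q ^ nat (?e i) * (qbinom q (2 * N + 1) j * qpoch q N)) (q ^ nat (?e i) * 1)"
        by (intro eq_upto_mult eq_upto_refl) (simp only: power_one_right)
      then have "fps_nth (q ^ nat (?e i) * (qbinom q (2 * N + 1) j * qpoch q N)) n =
          fps_nth (q ^ nat (?e i) * 1) n"
        by (simp add: eq_upto_def)
      then show ?thesis using e(1)[of i] by (auto simp: fps_X_power_nth)
    next
      case False
      then have "int n < ?e i" using e(2)[of i] by linarith
      then show ?thesis by (auto simp: fps_X_power_mult_nth)
    qed
    then show "int_sign (int j - int N) * of_int (int j - int N) *
        fps_nth (q ^ nat (?e (int j - int N)) * (qbinom q (2 * N + 1) j * qpoch q N)) n =
      (if ?e (int j - int N) = int n then int_sign (int j - int N) * of_int (int j - int N) else 0)"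
      by (simp add: i_def)
  qed
  also have "\<dots> = (\<Sum>j\<in>{j \<in> {..2 * N + 1}. ?e (int j - int N) = int n}.
      int_sign (int j - int N) * of_int (int j - int N))"
    by (subst sum.inter_filter) auto
  also have "\<dots> = (\<Sum>i | i \<in> UNIV \<and> ?e i = int n. int_sign i * of_int i)"
  proof (rule sum.reindex_bij_witness[of _ "\<lambda>i. nat (i + int N)" "\<lambda>j. int j - int N"])
    fix i assume i: "i \<in> {i. i \<in> UNIV \<and> ?e i = int n}"
    then have "\<bar>i\<bar> \<le> int N" using e(2)[of i] by (auto simp: N_def)
    then show "int (nat (i + int N)) - int N = i"
      "nat (i + int N) \<in> {j \<in> {..2 * N + 1}. ?e (int j - int N) = int n}"
      using i by auto
  qed auto
  finally show "fps_nth (gsum UNIV (\<lambda>i. int_sign i * of_int i) ?e) n = fps_nth (- (E q ^ 3)) n"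
    using trunc by (simp add: gsum_def)
qed

text \<open>
  Symmetrise \<open>jacobi_cube_index\<close> under \<open>i \<mapsto> 1 - i\<close>.
\<close>
theorem jacobi_cube:
  "gsum UNIV (\<lambda>u. int_sign u * of_int (2 * u + 1)) (half_quad 1 1) = 2 * E q ^ 3"
proof -
  have 1: "bij_betw (\<lambda>u. u + 1) (UNIV :: int set) UNIV"
    by (rule bij_betw_byWitness[of _ "\<lambda>u. u - 1"]) auto
  have 2: "bij_betw (\<lambda>u. - u) (UNIV :: int set) UNIV" by (rule bij_uminus_int)
  have hq: "half_quad 1 (- 1) (u + 1) = half_quad 1 1 u" "half_quad 1 (- 1) (- u) = half_quad 1 1 u" for u
    by (simp_all add: half_quad_def power2_eq_square algebra_simps)
  have "gsum UNIV (\<lambda>u. int_sign u * of_int (2 * u + 1)) (half_quad 1 1) =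
      gsum UNIV (\<lambda>u. - (int_sign (u + 1) * of_int (u + 1)) + - (int_sign (- u) * of_int (- u))) (half_quad 1 1)"
    by (intro gsum_cong) (auto simp: int_sign_def)
  also have "\<dots> = - gsum UNIV (\<lambda>u. int_sign (u + 1) * of_int (u + 1)) (half_quad 1 1) +
      - gsum UNIV (\<lambda>u. int_sign (- u) * of_int (- u)) (half_quad 1 1)"
    by (simp only: gsum_add gsum_uminus)
  also have "gsum UNIV (\<lambda>u. int_sign (u + 1) * of_int (u + 1)) (half_quad 1 1) = - (E q ^ 3)"
    using gsum_reindex[OF 1, of "\<lambda>i. int_sign i * of_int i" "half_quad 1 (- 1)"] jacobi_cube_index
    by (simp add: hq)
  also have "gsum UNIV (\<lambda>u. int_sign (- u) * of_int (- u)) (half_quad 1 1) = - (E q ^ 3)"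
    using gsum_reindex[OF 2, of "\<lambda>i. int_sign i * of_int i" "half_quad 1 (- 1)"] jacobi_cube_index
    by (simp add: hq)
  finally show ?thesis by simp
qed

section \<open>The sum of divisors at odd arguments\<close>

definition sigma_fps :: "rat fps" where
  "sigma_fps = Abs_fps (\<lambda>n. of_nat (\<Sum>d | d \<in> {1..n} \<and> d dvd n. d))"

definition nat_fps :: "rat fps" where "nat_fps = Abs_fps of_nat"
definition pos_fps :: "rat fps" where "pos_fps = Abs_fps (\<lambda>n. of_bool (n > 0))"

lemma nat_fps_eq: "nat_fps * (1 - q) ^ 2 = q"
proof (rule fps_ext)
  fix n
  have "nat_fps * (1 - q) ^ 2 = nat_fps - fps_const 2 * (q ^ 1 * nat_fps) + q ^ 2 * nat_fps"
    by (simp add: power2_eq_square algebra_simps flip: numeral_fps_const)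
  then have "fps_nth (nat_fps * (1 - q) ^ 2) n = of_nat n - 2 * (if n < 1 then 0 else of_nat (n - 1))
      + (if n < 2 then 0 else of_nat (n - 2))"
    by (simp only: fps_add_nth fps_sub_nth fps_mult_left_const_nth fps_X_power_mult_nth nat_fps_def fps_nth_Abs_fps)
  then show "fps_nth (nat_fps * (1 - q) ^ 2) n = fps_nth q n"
    by (auto simp: fps_X_def of_nat_diff)
qed

lemma pos_fps_eq: "pos_fps * (1 - q) = q"
proof (rule fps_ext)
  fix n
  have "pos_fps * (1 - q) = pos_fps - q ^ 1 * pos_fps" by (simp add: algebra_simps)
  then have "fps_nth (pos_fps * (1 - q)) n = of_bool (n > 0) - (if n < 1 then 0 else of_bool (n - 1 > 0))"
    by (simp only: fps_sub_nth fps_X_power_mult_nth pos_fps_def fps_nth_Abs_fps)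
  then show "fps_nth (pos_fps * (1 - q)) n = fps_nth q n"
    by (auto simp: fps_X_def)
qed

lemma nat_fps_compose:
  assumes "m > 0"
  shows "nat_fps oo q ^ m = q ^ m * inverse (1 - q ^ m) ^ 2"
proof -
  have "(nat_fps oo q ^ m) * (1 - q ^ m) ^ 2 = q ^ m"
    using arg_cong[OF nat_fps_eq, of "\<lambda>F. F oo q ^ m"] assms
    by (simp add: compose_power_mult compose_power_power fps_compose_sub_distrib)
  moreover have "(1 - q ^ m) * inverse (1 - q ^ m) = 1"
    by (rule inverse_mult_eq_1') (use assms in simp)
  ultimately show ?thesis
    by (metis (no_types, lifting) mult.assoc mult_1_right power_mult_distrib power_one)
qed

lemma pos_fps_compose:
  assumes "m > 0"
  shows "(pos_fps oo q ^ m) * (1 - q ^ m) = q ^ m"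
  using arg_cong[OF pos_fps_eq, of "\<lambda>F. F oo q ^ m"] assms
  by (simp add: compose_power_mult fps_compose_sub_distrib)

text \<open>
  The two forms of the Lambert series, summing over a divisor or over its codivisor.  The first is the one
  that comes from the logarithmic derivative of \<open>E q\<close>, the second from counting smallest parts.
\<close>
lemma sigma_fps_lambert:
  "eq_upto N sigma_fps (\<Sum>k=1..N. of_nat k * (pos_fps oo q ^ k))"
  "eq_upto N sigma_fps (\<Sum>m=1..N. nat_fps oo q ^ m)"
proof -
  have 1: "fps_nth (\<Sum>k=1..N. of_nat k * (pos_fps oo q ^ k)) n = fps_nth sigma_fps n" if "n \<le> N" for n
  proof -
    have "fps_nth (\<Sum>k=1..N. of_nat k * (pos_fps oo q ^ k)) n =
        (\<Sum>k=1..N. if k dvd n \<and> n > 0 then of_nat k else 0)"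
      unfolding fps_sum_nth
      by (intro sum.cong refl)
        (auto simp: fps_of_nat[symmetric] nth_compose_power pos_fps_def dvd_div_eq_0_iff)
    also have "\<dots> = (\<Sum>k | k \<in> {1..n} \<and> k dvd n. of_nat k)"
      using that by (subst sum.inter_filter[symmetric]) (auto intro!: sum.cong dest: dvd_imp_le)
    finally show ?thesis by (simp add: sigma_fps_def)
  qed
  then show "eq_upto N sigma_fps (\<Sum>k=1..N. of_nat k * (pos_fps oo q ^ k))"
    by (simp add: eq_upto_def)
  have "fps_nth (\<Sum>m=1..N. nat_fps oo q ^ m) n = fps_nth sigma_fps n" if "n \<le> N" for n
  proof -
    have "fps_nth (\<Sum>m=1..N. nat_fps oo q ^ m) n = (\<Sum>m=1..N. if m dvd n then of_nat (n div m) else 0)"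
      unfolding fps_sum_nth by (intro sum.cong refl) (auto simp: nth_compose_power nat_fps_def)
    also have "\<dots> = (\<Sum>m | m \<in> {1..N} \<and> m dvd n. of_nat (n div m))"
      by (subst sum.inter_filter[symmetric]) auto
    also have "\<dots> = (\<Sum>d | d \<in> {1..n} \<and> d dvd n. of_nat d)"
    proof (cases "n = 0")
      case False
      show ?thesis
      proof (rule sum.reindex_bij_witness[of _ "\<lambda>d. n div d" "\<lambda>d. n div d"])
        fix m assume m: "m \<in> {m. m \<in> {1..N} \<and> m dvd n}"
        then obtain k where k: "n = m * k" by auto
        with m False show "n div (n div m) = m" "n div m \<in> {d. d \<in> {1..n} \<and> d dvd n}"
          "of_nat (n div m) = of_nat (n div m)" by (auto simp: Suc_le_eq)
      next
        fix d assume d: "d \<in> {d. d \<in> {1..n} \<and> d dvd n}"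
        then obtain k where k: "n = d * k" by auto
        with d False have "k \<le> n" by simp
        with that have "k \<le> N" by simp
        with d k False that show "n div (n div d) = d" "n div d \<in> {m. m \<in> {1..N} \<and> m dvd n}"
          by (auto simp: Suc_le_eq)
      qed
    qed auto
    finally show ?thesis by (simp add: sigma_fps_def)
  qed
  then show "eq_upto N sigma_fps (\<Sum>m=1..N. nat_fps oo q ^ m)"
    by (simp add: eq_upto_def)
qed

text \<open>
  The Euler derivation \<open>q * d/dq\<close>.
\<close>
definition qderiv :: "rat fps \<Rightarrow> rat fps" where
  "qderiv F = q * fps_deriv F"

lemma qderiv_nth: "fps_nth (qderiv F) n = of_nat n * fps_nth F n"
  by (cases n) (simp_all add: qderiv_def)

lemma qderiv_mult: "qderiv (F * G) = qderiv F * G + F * qderiv G"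
  by (simp add: qderiv_def algebra_simps)

lemma qderiv_one_minus_power: "qderiv (1 - q ^ k) = - (of_nat k * q ^ k)"
  by (rule fps_ext) (auto simp: qderiv_nth fps_X_power_nth simp flip: fps_of_nat)

lemma qderiv_qpoch:
  "qderiv (qpoch q N) = - ((\<Sum>k=1..N. of_nat k * (pos_fps oo q ^ k)) * qpoch q N)"
proof (induction N)
  case 0
  then show ?case by (simp add: qderiv_def)
next
  case (Suc N)
  obtain P Q I S c where PQ: "P = qpoch q N" "Q = q ^ Suc N" "I = pos_fps oo q ^ Suc N"
    "S = (\<Sum>k=1..N. of_nat k * (pos_fps oo q ^ k))" "c = (of_nat (Suc N) :: rat fps)" by simp
  have I: "Q = I * (1 - Q)" unfolding PQ using pos_fps_compose[of "Suc N"] by simp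
  have "qderiv (qpoch q (Suc N)) = qderiv P * (1 - Q) - P * (c * Q)"
    unfolding qpoch_Suc qderiv_mult qderiv_one_minus_power PQ by simp
  also have "\<dots> = - (S * P) * (1 - Q) - P * (c * (I * (1 - Q)))"
    using Suc I by (simp add: PQ)
  also have "\<dots> = - ((S + c * I) * (P * (1 - Q)))" by algebra
  finally show ?case
    by (simp add: PQ qpoch_Suc)
qed

lemma qderiv_E: "qderiv (E q) = - (sigma_fps * E q)"
proof (rule eq_upto_all)
  fix N
  have "eq_upto N (qderiv (E q)) (qderiv (qpoch q N))"
    using E_eq_upto_qpoch[of N N] by (simp add: eq_upto_def qderiv_nth)
  also have "eq_upto N (qderiv (qpoch q N)) (- (sigma_fps * E q))"
    unfolding qderiv_qpoch
    using eq_upto_mult[OF eq_upto_sym[OF sigma_fps_lambert(1)] eq_upto_sym[OF E_eq_upto_qpoch[of N N]]]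
    by (simp add: eq_upto_def)
  finally show "eq_upto N (qderiv (E q)) (- (sigma_fps * E q))" .
qed

definition negate_q :: "rat fps \<Rightarrow> rat fps" where
  "negate_q F = Abs_fps (\<lambda>n. (- 1) ^ n * fps_nth F n)"

lemma negate_q_mult: "negate_q (F * G) = negate_q F * negate_q G"
proof (rule fps_ext)
  fix n
  have "(- 1) ^ n * (fps_nth F i * fps_nth G (n - i)) =
      ((- 1) ^ i * fps_nth F i) * ((- 1) ^ (n - i) * fps_nth G (n - i))" if "i \<le> n" for i
    using that by (metis (no_types, lifting) le_add_diff_inverse mult.assoc mult.left_commute power_add)
  then show "fps_nth (negate_q (F * G)) n = fps_nth (negate_q F * negate_q G) n"
    unfolding negate_q_def fps_mult_nth fps_nth_Abs_fps sum_distrib_left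
    by (intro sum.cong refl) simp
qed

lemma negate_q_qderiv: "qderiv (negate_q F) = negate_q (qderiv F)"
  by (rule fps_ext) (simp add: qderiv_nth negate_q_def)

lemma negate_q_even: "negate_q (F oo q ^ 2) = F oo q ^ 2"
  by (rule fps_ext) (auto simp: negate_q_def nth_compose_power)

lemma qderiv_gsum:
  assumes "\<And>i. i \<in> I \<Longrightarrow> e i \<ge> 0"
  shows "qderiv (gsum I c e) = gsum I (\<lambda>i. c i * of_int (e i)) e"
  by (rule fps_ext) (auto simp: qderiv_nth gsum_def sum_distrib_left mult.commute intro!: sum.cong)

lemma half_quad_2_0: "half_quad 2 0 n = n\<^sup>2"
  using double_half_quad[of 2 0 n] by simp

lemma negate_q_phi: "negate_q (theta_minus 2 0) = theta_plus 2 0"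
proof (rule fps_ext)
  fix n
  have "(- 1) ^ n * int_sign i = 1" if "half_quad 2 0 i = int n" for i
  proof -
    have "even n \<longleftrightarrow> even i" using that half_quad_2_0[of i] by (metis even_of_nat even_power zero_neq_numeral pos2)
    then show ?thesis by (auto simp: int_sign_def)
  qed
  then show "fps_nth (negate_q (theta_minus 2 0)) n = fps_nth (theta_plus 2 0) n"
    by (auto simp: negate_q_def theta_minus_def theta_plus_def gsum_def sum_distrib_left)
qed

text \<open>
  In the double sum of the Wronskian, the weights cancel when \<open>m + n\<close> is even and double when it is odd.
  On the odd pairs \<open>(u + v + 1, u - v)\<close> and their mirror images, the weight
  \<open>(u + v + 1)^2 - (u - v)^2 = (2u + 1)(2v + 1)\<close> factors, which gives the square of Jacobi's series.
\<close>
lemma phi_wronskian: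
  "theta_minus 2 0 * qderiv (theta_plus 2 0) - theta_plus 2 0 * qderiv (theta_minus 2 0) =
     4 * q * E (q ^ 4) ^ 6"
proof -
  define e where "e = (\<lambda>(m, n). half_quad 2 0 m + half_quad 2 0 n)"
  let ?odd = "{x \<in> UNIV \<times> UNIV :: (int \<times> int) set. (fst x + snd x) mod 2 = 1}"
  have sq: "gsummable UNIV (half_quad 2 0)" by (rule gsummable_half_quad) auto
  have summable: "gsummable X e" for X
    unfolding e_def using gsummable_times[OF sq sq] by (auto simp: gsummable_def elim!: finite_subset[rotated])
  have e: "e (m, n) = m\<^sup>2 + n\<^sup>2" for m n by (simp add: e_def half_quad_2_0)
  define c1 where "c1 = (\<lambda>(m, n). int_sign m * of_int (n\<^sup>2))"
  define c2 where "c2 = (\<lambda>(m :: int, n). int_sign n * of_int (n\<^sup>2))"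
  have A: "theta_minus 2 0 * qderiv (theta_plus 2 0) = gsum (UNIV \<times> UNIV) c1 e"
    unfolding theta_minus_def theta_plus_def
    by (subst qderiv_gsum) (auto simp: half_quad_2_0 gsum_mult[OF sq sq] c1_def e_def intro!: gsum_cong)
  have B: "theta_plus 2 0 * qderiv (theta_minus 2 0) = gsum (UNIV \<times> UNIV) c2 e"
    unfolding theta_minus_def theta_plus_def
    by (subst qderiv_gsum) (auto simp: half_quad_2_0 gsum_mult[OF sq sq] c2_def e_def intro!: gsum_cong)
  have "gsum (UNIV \<times> UNIV) c1 e - gsum (UNIV \<times> UNIV) c2 e =
      gsum (UNIV \<times> UNIV) (\<lambda>x. c1 x + - c2 x) e"
    unfolding gsum_add gsum_uminus by simp
  also have "\<dots> = (\<Sum>k\<in>{0, 1}. gsum {x \<in> UNIV \<times> UNIV. (fst x + snd x) mod 2 = k} (\<lambda>x. c1 x + - c2 x) e)"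
    by (rule gsum_partition[OF summable]) auto
  also have "\<dots> = gsum {x \<in> UNIV \<times> UNIV. (fst x + snd x) mod 2 = 0} (\<lambda>x. c1 x + - c2 x) e +
      gsum ?odd (\<lambda>x. c1 x + - c2 x) e"
    by simp
  also have "gsum {x \<in> UNIV \<times> UNIV. (fst x + snd x) mod 2 = 0} (\<lambda>x. c1 x + - c2 x) e =
      gsum {x \<in> UNIV \<times> UNIV. (fst x + snd x) mod 2 = 0} (\<lambda>x. 0) e"
    by (intro gsum_cong) (auto simp: c1_def c2_def int_sign_def)
  also have "\<dots> = 0" by (simp add: gsum_def fps_eq_iff)
  also have "gsum ?odd (\<lambda>x. c1 x + - c2 x) e = gsum ?odd (\<lambda>x. c1 x + c1 x) e"
    by (intro gsum_cong) (auto simp: c1_def c2_def int_sign_def)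
  also have "\<dots> = gsum ?odd c1 e + gsum ?odd c1 e"
    by (rule gsum_add)
  also have "\<dots> = gsum (UNIV \<times> UNIV) (\<lambda>x. c1 (case x of (u, v) \<Rightarrow> (u + v + 1, u - v)))
      (\<lambda>x. e (case x of (u, v) \<Rightarrow> (u + v + 1, u - v))) +
    gsum (UNIV \<times> UNIV) (\<lambda>x. c1 (case x of (u, v) \<Rightarrow> (u - v, u + v + 1)))
      (\<lambda>x. e (case x of (u, v) \<Rightarrow> (u - v, u + v + 1)))"
    using gsum_reindex[OF bij_sum_diff_odd, of c1 e]
      gsum_reindex[OF bij_betw_trans[OF bij_sum_diff_odd bij_swap_odd], of c1 e]
    by (simp add: case_prod_unfold comp_def)
  also have "\<dots> = gsum (UNIV \<times> UNIV) (\<lambda>(u, v). 1 * ((int_sign u * of_int (2 * u + 1)) * (int_sign v * of_int (2 * v + 1))))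
      (\<lambda>(u, v). half_quad 4 4 u + half_quad 4 4 v + int 1)"
  proof -
    have hq: "2 * half_quad 4 4 u = 4 * u\<^sup>2 + 4 * u" for u
      using double_half_quad[of 4 4 u] by simp
    have exp: "e (u + v + 1, u - v) = half_quad 4 4 u + half_quad 4 4 v + int 1"
      "e (u - v, u + v + 1) = half_quad 4 4 u + half_quad 4 4 v + int 1" for u v
      using hq[of u] hq[of v] by (simp_all add: e power2_eq_square algebra_simps)
    have sign: "int_sign 1 = -1" by (simp add: int_sign_def)
    have "gsum (UNIV \<times> UNIV) (\<lambda>x. c1 (case x of (u, v) \<Rightarrow> (u + v + 1, u - v)))
        (\<lambda>x. e (case x of (u, v) \<Rightarrow> (u + v + 1, u - v))) =
      gsum (UNIV \<times> UNIV) (\<lambda>(u, v). - (int_sign u * int_sign v * of_int ((u - v)\<^sup>2)))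
        (\<lambda>(u, v). half_quad 4 4 u + half_quad 4 4 v + int 1)"
      by (intro gsum_cong; clarsimp simp only: exp prod.case) (simp add: c1_def int_sign_add sign)
    moreover have "gsum (UNIV \<times> UNIV) (\<lambda>x. c1 (case x of (u, v) \<Rightarrow> (u - v, u + v + 1)))
        (\<lambda>x. e (case x of (u, v) \<Rightarrow> (u - v, u + v + 1))) =
      gsum (UNIV \<times> UNIV) (\<lambda>(u, v). int_sign u * int_sign v * of_int ((u + v + 1)\<^sup>2))
        (\<lambda>(u, v). half_quad 4 4 u + half_quad 4 4 v + int 1)"
      by (intro gsum_cong; clarsimp simp only: exp prod.case) (simp add: c1_def int_sign_diff)
    ultimately show ?thesis
      by (simp only: gsum_add[symmetric]) (intro gsum_cong, auto simp: power2_eq_square algebra_simps)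
  qed
  also have "\<dots> = fps_const 1 * q ^ 1 * (gsum UNIV (\<lambda>u. int_sign u * of_int (2 * u + 1)) (half_quad 4 4) *
      gsum UNIV (\<lambda>u. int_sign u * of_int (2 * u + 1)) (half_quad 4 4))"
    by (rule gsum_reindex_product[OF bij_betw_id]) (auto intro!: gsummable_half_quad)
  also have "gsum UNIV (\<lambda>u. int_sign u * of_int (2 * u + 1)) (half_quad 4 4) = 2 * E q ^ 3 oo q ^ 4"
  proof -
    have "int 4 * half_quad 1 1 u = half_quad 4 4 u" for u
      using double_half_quad[of 1 1 u] double_half_quad[of 4 4 u] by simp
    then show ?thesis
      unfolding jacobi_cube[symmetric] gsum_compose_power[OF zero_less_numeral] by presburger
  qed
  also have "2 * E q ^ 3 oo q ^ 4 = 2 * E (q ^ 4) ^ 3"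
    using E_compose_power[of 1 4] by (simp add: compose_power_mult compose_power_power)
  also have "fps_const 1 * q ^ 1 * (2 * E (q ^ 4) ^ 3 * (2 * E (q ^ 4) ^ 3)) = 4 * q * E (q ^ 4) ^ 6"
    by (simp add: power_numeral_reduce mult_ac)
  finally show ?thesis by (simp add: A B)
qed

text \<open>
  The logarithmic derivative of \<open>phi(-q) = E(q)^2 / E(q^2)\<close> involves \<open>sigma_fps\<close>; subtracting the same
  identity with \<open>-q\<close> for \<open>q\<close> removes \<open>E(q^2)\<close> and the even exponents, and leaves the Wronskian.
\<close>
theorem sigma_odd:
  "section_fps 2 1 sigma_fps * E q ^ 4 = E (q ^ 2) ^ 8"
proof -
  obtain f g E1 N1 E2 E4 s t where v: "f = theta_minus 2 0" "g = theta_plus 2 0" "E1 = E q"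
    "N1 = negate_q (E q)" "E2 = E (q ^ 2)" "E4 = E (q ^ 4)" "s = sigma_fps" "t = negate_q sigma_fps" by simp
  have neg_uminus: "negate_q (- F) = - negate_q F" for F
    by (simp add: negate_q_def fps_eq_iff)
  have E2: "E (q ^ 2) = E q oo q ^ 2" using E_compose_power[of 1 2] by simp
  have nE2: "negate_q (E (q ^ 2)) = E (q ^ 2)" unfolding E2 by (rule negate_q_even)
  have f: "f * E2 = E1 ^ 2" using theta_minus_2_0 by (simp add: v)
  have g: "g * E2 = N1 ^ 2"
    using arg_cong[OF theta_minus_2_0, of negate_q] nE2
    by (simp add: v negate_q_mult negate_q_phi power2_eq_square)
  have D: "qderiv E1 = - (s * E1)" "qderiv N1 = - (t * N1)"
    using qderiv_E by (simp_all add: v negate_q_qderiv neg_uminus negate_q_mult)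
  have Nnz: "E2 \<noteq> 0" "E4 \<noteq> 0" by (simp_all add: v)
  have "qderiv (f * E2) = qderiv (E1 * E1)" "qderiv (g * E2) = qderiv (N1 * N1)"
    using f g by (simp_all only: power2_eq_square)
  then have "qderiv f * E2 + f * qderiv E2 = - 2 * s * E1 ^ 2"
    "qderiv g * E2 + g * qderiv E2 = - 2 * t * N1 ^ 2"
    unfolding qderiv_mult D by algebra+
  then have "qderiv f * E2 + f * qderiv E2 = - 2 * s * (f * E2)"
    "qderiv g * E2 + g * qderiv E2 = - 2 * t * (g * E2)"
    unfolding f g by simp_all
  then have "E2 * (f * qderiv g - g * qderiv f) = E2 * (2 * (s - t) * (f * g))"
    by algebra
  then have "f * qderiv g - g * qderiv f = 2 * (s - t) * (f * g)" using Nnz by simp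
  then have W: "4 * q * E4 ^ 6 = 2 * (s - t) * (f * g)"
    using phi_wronskian by (simp add: v)
  have "(theta_minus 2 0 oo q ^ 2) * (E (q ^ 2) oo q ^ 2) = (E q oo q ^ 2) ^ 2"
    using arg_cong[OF theta_minus_2_0, of "\<lambda>F. F oo q ^ 2"]
    by (simp add: compose_power_mult compose_power_power)
  then have "theta_minus 4 0 * E4 = E2 ^ 2"
    using theta_minus_compose_power[of 2 2 0] E_compose_power[of 2 2] by (simp add: v E2[symmetric])
  moreover have "f * g = theta_minus 4 0 ^ 2"
    using theta_plus_mult_minus[of 2 0] by (simp add: v power2_eq_square mult.commute)
  ultimately have fg: "f * g * E4 ^ 2 = E2 ^ 4"
    by algebra
  have odd: "s - t = 2 * q * (section_fps 2 1 sigma_fps oo q ^ 2)"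
  proof (rule fps_ext)
    fix n
    have "2 * q * (section_fps 2 1 sigma_fps oo q ^ 2) = fps_const 2 * (q ^ 1 * (section_fps 2 1 sigma_fps oo q ^ 2))"
      by (simp flip: numeral_fps_const)
    then have "fps_nth (2 * q * (section_fps 2 1 sigma_fps oo q ^ 2)) n =
        2 * (if n < 1 then 0 else fps_nth (section_fps 2 1 sigma_fps oo q ^ 2) (n - 1))"
      by (simp only: fps_mult_left_const_nth fps_X_power_mult_nth)
    then show "fps_nth (s - t) n = fps_nth (2 * q * (section_fps 2 1 sigma_fps oo q ^ 2)) n"
      by (cases "even n") (auto simp: v negate_q_def nth_compose_power section_fps_def elim!: oddE)
  qed
  have "4 * q * E4 ^ 8 = 4 * q * ((section_fps 2 1 sigma_fps oo q ^ 2) * E2 ^ 4)"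
    using W fg unfolding odd by algebra
  then have "E4 ^ 8 = (section_fps 2 1 sigma_fps oo q ^ 2) * E2 ^ 4" by simp
  then have eq: "E (q ^ 2) ^ 8 oo q ^ 2 = section_fps 2 1 sigma_fps * E q ^ 4 oo q ^ 2"
    using E_compose_power[of 2 2] E2 by (simp add: v compose_power_mult compose_power_power)
  have "fps_nth (E (q ^ 2) ^ 8) n = fps_nth (section_fps 2 1 sigma_fps * E q ^ 4) n" for n
    using arg_cong[OF eq, of "\<lambda>F. fps_nth F (2 * n)"] by (simp add: nth_compose_power)
  then show ?thesis by (simp add: fps_eq_iff)
qed

section \<open>Counting overpartitions\<close>

text \<open>
  The relation between an entry and any later one that characterises overpartitions; it makes them sorted
  lists, which behave well under appending.
\<close>
definition over_rel :: "nat \<times> bool \<Rightarrow> nat \<times> bool \<Rightarrow> bool" where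
  "over_rel p p' \<longleftrightarrow> fst p' \<le> fst p \<and> (snd p' \<longrightarrow> fst p \<noteq> fst p')"

lemma overpartitions_iff:
  "ps \<in> overpartitions n \<longleftrightarrow>
     sorted_wrt over_rel ps \<and> (\<forall>p\<in>set ps. fst p > 0) \<and> sum_list (map fst ps) = n"
  unfolding overpartitions_def over_rel_def sorted_wrt_map
  by (auto simp: sorted_wrt_iff_nth_less)

definition over_with_parts :: "nat set \<Rightarrow> nat \<Rightarrow> (nat \<times> bool) list set" where
  "over_with_parts A n = {ps \<in> overpartitions n. fst ` set ps \<subseteq> A}"

lemma finite_over_with_parts: "finite (over_with_parts A n)"
  using finite_overpartitions[of n] by (simp add: over_with_parts_def)

text \<open>
  The \<open>j\<close> copies of a part \<open>b\<close>, for \<open>j \<ge> 1\<close>, with the first one overlined iff \<open>f\<close>.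
\<close>
definition block :: "nat \<Rightarrow> bool \<Rightarrow> nat \<Rightarrow> (nat \<times> bool) list" where
  "block b f j = (b, f) # replicate (j - 1) (b, False)"

lemma block_simps:
  "sum_list (map fst (block b f j)) = (if j = 0 then b else j * b)" "fst ` set (block b f j) = {b}"
  "length (block b f j) = (if j = 0 then 1 else j)" "hd (block b f j) = (b, f)" "block b f j \<noteq> []"
  "sorted_wrt over_rel (block b f j)"
  by (cases j; auto simp: block_def sum_list_replicate over_rel_def sorted_wrt_iff_nth_less nth_Cons split: nat.splits)+

lemma append_block_overpartition:
  assumes "ps \<in> over_with_parts A n" "\<forall>k\<in>A. b < k" "0 < b" "0 < j"
  shows "ps @ block b f j \<in> overpartitions (n + j * b)"
proof -
  have ps: "sorted_wrt over_rel ps" "\<forall>p\<in>set ps. fst p > 0" "sum_list (map fst ps) = n"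
    "\<forall>p\<in>set ps. b < fst p"
    using assms by (auto simp: over_with_parts_def overpartitions_iff)
  have "fst p = b" if "p \<in> set (block b f j)" for p
    using block_simps(2)[of b f j] that by auto
  with ps show ?thesis
    using assms(3,4) block_simps(1,6)[of b f j]
    by (auto simp: overpartitions_iff sorted_wrt_append over_rel_def)
qed

text \<open>
  The entries of the smallest size form a block at the end of the list.
\<close>
lemma overpartition_split:
  assumes "L \<in> overpartitions n" "\<forall>p\<in>set L. b \<le> fst p" "b \<in> fst ` set L"
  obtains ps f j where "L = ps @ block b f j" "0 < j" "j * b \<le> n" "ps \<in> overpartitions (n - j * b)"
    "\<forall>p\<in>set ps. b < fst p"
proof -
  define ps tl where "ps = filter (\<lambda>p. fst p \<noteq> b) L" and "tl = filter (\<lambda>p. fst p = b) L"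
  have L: "sorted_wrt over_rel L" "\<forall>p\<in>set L. fst p > 0" "sum_list (map fst L) = n"
    using assms by (auto simp: overpartitions_iff)
  have split: "L = ps @ tl"
    unfolding ps_def tl_def using L(1) assms(2)
  proof (induction L)
    case (Cons x L)
    show ?case
    proof (cases "fst x = b")
      case True
      have "\<forall>p\<in>set L. fst p = b"
      proof
        fix p assume "p \<in> set L"
        then have "fst p \<le> fst x" "b \<le> fst p" using Cons.prems by (auto simp: over_rel_def)
        then show "fst p = b" using True by simp
      qed
      then show ?thesis using True by (simp add: filter_id_conv filter_False)
    next
      case False
      then show ?thesis using Cons by auto
    qed
  qed simp
  have "tl \<noteq> []" using assms(3) by (auto simp: tl_def filter_empty_conv)
  then obtain x rest where tl: "tl = x # rest" by (cases tl) auto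
  have tl_b: "\<forall>p\<in>set tl. fst p = b" by (simp add: tl_def)
  have sorted: "sorted_wrt over_rel tl" "sorted_wrt over_rel ps"
    using L(1) unfolding split by (auto simp: sorted_wrt_append)
  have "\<forall>p\<in>set rest. p = (b, False)"
    using sorted(1) tl_b unfolding tl by (auto simp: over_rel_def)
  then have "rest = replicate (length rest) (b, False)"
    by (simp add: replicate_length_same)
  moreover have "x = (b, snd x)" using tl_b tl by (cases x) auto
  ultimately have block: "tl = block b (snd x) (Suc (length rest))"
    unfolding tl block_def by simp
  have sum: "sum_list (map fst ps) + Suc (length rest) * b = n"
    using L(3) block_simps(1)[of b "snd x" "Suc (length rest)"] unfolding split block by simp
  show ?thesis
  proof (rule that)
    show "L = ps @ block b (snd x) (Suc (length rest))" using split block by simp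
    show "Suc (length rest) * b \<le> n" using sum by linarith
    show "ps \<in> overpartitions (n - Suc (length rest) * b)"
      using sum sorted(2) L(2) unfolding split by (auto simp: overpartitions_iff)
    show "\<forall>p\<in>set ps. b < fst p" using assms(2) by (auto simp: ps_def order_less_le)
  qed simp
qed

lemma append_block_inject:
  assumes "\<forall>p\<in>set ps. b < fst p" "\<forall>p\<in>set ps'. b < fst p" "0 < j" "0 < j'"
  shows "ps @ block b f j = ps' @ block b f' j' \<longleftrightarrow> ps = ps' \<and> f = f' \<and> j = j'"
proof
  assume eq: "ps @ block b f j = ps' @ block b f' j'"
  have filter: "filter (\<lambda>p. fst p \<noteq> b) (block b f j) = []" for f j
    using block_simps(2)[of b f j] by (auto simp: filter_empty_conv)
  have "filter (\<lambda>p. fst p \<noteq> b) ps = ps" "filter (\<lambda>p. fst p \<noteq> b) ps' = ps'"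
    using assms by (auto simp: filter_id_conv)
  then have "ps = ps'" using arg_cong[OF eq, of "filter (\<lambda>p. fst p \<noteq> b)"] by (simp add: filter)
  with eq have "block b f j = block b f' j'" by simp
  then have "length (block b f j) = length (block b f' j')" "hd (block b f j) = hd (block b f' j')"
    by simp_all
  with \<open>ps = ps'\<close> show "ps = ps' \<and> f = f' \<and> j = j'"
    using assms by (simp add: block_simps)
qed simp

text \<open>
  An overpartition that uses the new smallest part \<open>b\<close> consists of one with larger parts and a block; the
  factor two counts the choices for the overline.
\<close>
lemma card_over_with_parts_insert:
  assumes "\<forall>k\<in>A. b < k" "0 < b"
  shows "card (over_with_parts (insert b A) n) =
    card (over_with_parts A n) + 2 * (\<Sum>j | j \<in> {1..n} \<and> j * b \<le> n. card (over_with_parts A (n - j * b)))"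
proof -
  define J where "J = {j. j \<in> {1..n} \<and> j * b \<le> n}"
  define I where "I = (SIGMA j:J. (UNIV :: bool set) \<times> over_with_parts A (n - j * b))"
  define h where "h = (\<lambda>(j, f, ps). ps @ block b f j)"
  have bigger: "\<forall>p\<in>set ps. b < fst p" if "ps \<in> over_with_parts A k" for ps k
    using that assms(1) by (auto simp: over_with_parts_def)
  have inj: "inj_on h I"
  proof (rule inj_onI)
    fix x y assume x: "x \<in> I" and y: "y \<in> I" and eq: "h x = h y"
    obtain j f ps j' f' ps' where xy: "x = (j, f, ps)" "y = (j', f', ps')" by (metis prod.exhaust)
    have "0 < j" "0 < j'" "\<forall>p\<in>set ps. b < fst p" "\<forall>p\<in>set ps'. b < fst p"
      using x y bigger by (auto simp: I_def J_def xy)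
    then show "x = y"
      using eq append_block_inject[of ps b ps' j j' f f'] unfolding xy by (simp add: h_def)
  qed
  have union: "over_with_parts (insert b A) n = over_with_parts A n \<union> h ` I"
  proof (intro equalityI subsetI)
    fix L assume L: "L \<in> over_with_parts (insert b A) n"
    show "L \<in> over_with_parts A n \<union> h ` I"
    proof (cases "b \<in> fst ` set L")
      case False
      then show ?thesis using L by (auto simp: over_with_parts_def)
    next
      case True
      have "L \<in> overpartitions n" "\<forall>p\<in>set L. b \<le> fst p"
        using L assms(1) by (auto simp: over_with_parts_def image_subset_iff less_imp_le)
      then obtain ps f j where *: "L = ps @ block b f j" "0 < j" "j * b \<le> n"
        "ps \<in> overpartitions (n - j * b)" "\<forall>p\<in>set ps. b < fst p"
        using True by (rule overpartition_split)
      have "fst ` set ps \<subseteq> A"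
        using L *(1,5) by (auto simp: over_with_parts_def image_subset_iff)
      moreover have "j \<le> n" using *(3) assms(2) le_trans[of j "j * b" n] by simp
      ultimately have "(j, f, ps) \<in> I" using * by (auto simp: I_def J_def over_with_parts_def)
      then show ?thesis using *(1) by (force simp: h_def)
    qed
  next
    fix L assume "L \<in> over_with_parts A n \<union> h ` I"
    then show "L \<in> over_with_parts (insert b A) n"
    proof
      assume "L \<in> h ` I"
      then obtain j f ps where *: "L = ps @ block b f j" "1 \<le> j" "j * b \<le> n" "ps \<in> over_with_parts A (n - j * b)"
        by (auto simp: h_def I_def J_def)
      have "L \<in> overpartitions n"
        using append_block_overpartition[OF *(4) assms, of j f] * by simp
      moreover have "fst ` set L \<subseteq> insert b A"
        using *(1,4) block_simps(2)[of b f j] by (auto simp: over_with_parts_def)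
      ultimately show ?thesis by (simp add: over_with_parts_def)
    qed (auto simp: over_with_parts_def)
  qed
  have disjoint: "over_with_parts A n \<inter> h ` I = {}"
  proof -
    have "b \<in> fst ` set (h x)" for x
      by (cases x) (auto simp: h_def block_def)
    then show ?thesis using assms(1) by (fastforce simp: over_with_parts_def)
  qed
  have finI: "finite I" unfolding I_def J_def by (intro finite_SigmaI finite_cartesian_product finite_over_with_parts) auto
  have "card (over_with_parts (insert b A) n) = card (over_with_parts A n) + card I"
    unfolding union using disjoint finI inj
    by (simp add: card_Un_disjoint finite_over_with_parts card_image)
  also have "card I = (\<Sum>j\<in>J. 2 * card (over_with_parts A (n - j * b)))"
    unfolding I_def by (subst card_SigmaI) (auto simp: J_def card_cartesian_product finite_over_with_parts)
  finally show ?thesis by (simp add: J_def sum_distrib_left)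
qed

definition over_factor :: "nat \<Rightarrow> rat fps" where
  "over_factor k = (1 + q ^ k) * inverse (1 - q ^ k)"

lemma inverse_one_minus_power: "k > 0 \<Longrightarrow> (1 - q ^ k) * inverse (1 - q ^ k) = 1"
  by (rule inverse_mult_eq_1') simp

lemma over_factor_eq:
  assumes "k > 0"
  shows "over_factor k = 1 + 2 * (pos_fps oo q ^ k)"
proof -
  note inv = inverse_one_minus_power[OF assms]
  have pos: "pos_fps oo q ^ k = q ^ k * inverse (1 - q ^ k)"
  proof -
    have "(pos_fps oo q ^ k) * ((1 - q ^ k) * inverse (1 - q ^ k)) = q ^ k * inverse (1 - q ^ k)"
      unfolding mult.assoc[symmetric] pos_fps_compose[OF assms] ..
    then show ?thesis unfolding inv by simp
  qed
  have "1 + q ^ k = (1 - q ^ k) + 2 * q ^ k" by simp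
  then have "over_factor k = (1 - q ^ k) * inverse (1 - q ^ k) + 2 * q ^ k * inverse (1 - q ^ k)"
    unfolding over_factor_def by (simp only: distrib_right)
  then show ?thesis unfolding inv pos by (simp only: mult.assoc)
qed

lemma sum_multiples:
  fixes f :: "nat \<Rightarrow> nat \<Rightarrow> rat"
  assumes "b > 0" "\<And>i. f 0 i = 0"
  shows "(\<Sum>i=0..n. if b dvd i then f (i div b) (n - i) else 0) =
    (\<Sum>j | j \<in> {1..n} \<and> j * b \<le> n. f j (n - j * b))"
proof -
  have "(\<Sum>i=0..n. if b dvd i then f (i div b) (n - i) else 0) =
      (\<Sum>i | i \<in> {0..n} \<and> b dvd i. f (i div b) (n - i))"
    by (subst sum.inter_filter) auto
  also have "\<dots> = (\<Sum>j | j \<le> n \<and> j * b \<le> n. f j (n - j * b))"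
    by (rule sum.reindex_bij_witness[of _ "\<lambda>j. j * b" "\<lambda>i. i div b"])
      (use assms(1) in \<open>auto intro: le_trans[OF div_le_dividend]\<close>)
  also have "\<dots> = (\<Sum>j | j \<in> {1..n} \<and> j * b \<le> n. f j (n - j * b))"
    by (rule sum.mono_neutral_right) (use assms(2) in \<open>auto simp: Suc_le_eq intro!: gr0I\<close>)
  finally show ?thesis .
qed

text \<open>
  Adding the parts in decreasing order, each step multiplies the generating function by one factor.
\<close>
lemma over_with_parts_gf:
  assumes "finite A" "0 \<notin> A"
  shows "Abs_fps (\<lambda>n. of_nat (card (over_with_parts A n))) = (\<Prod>k\<in>A. over_factor k)"
  using assms
proof (induction A rule: finite_linorder_min_induct)
  case empty
  have "over_with_parts {} n = (if n = 0 then {[]} else {})" for n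
    by (auto simp: over_with_parts_def overpartitions_iff)
  then show ?case by (auto simp: fps_eq_iff)
next
  case (insert b A)
  then have b: "0 < b" "b \<notin> A" by auto
  let ?F = "Abs_fps (\<lambda>n. of_nat (card (over_with_parts A n)))"
  have "Abs_fps (\<lambda>n. of_nat (card (over_with_parts (insert b A) n))) = (1 + 2 * (pos_fps oo q ^ b)) * ?F"
  proof (rule fps_ext)
    fix n
    have "fps_nth ((1 + 2 * (pos_fps oo q ^ b)) * ?F) n =
        fps_nth ?F n + 2 * fps_nth ((pos_fps oo q ^ b) * ?F) n"
    proof -
      have "(1 + 2 * (pos_fps oo q ^ b)) * ?F = ?F + fps_const 2 * ((pos_fps oo q ^ b) * ?F)"
        by (simp add: distrib_right mult.assoc flip: numeral_fps_const)
      then show ?thesis by (simp only: fps_add_nth fps_mult_left_const_nth)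
    qed
    also have "fps_nth ((pos_fps oo q ^ b) * ?F) n =
        (\<Sum>i=0..n. if b dvd i then of_bool (i div b > 0) * of_nat (card (over_with_parts A (n - i))) else 0)"
      using b unfolding fps_mult_nth by (intro sum.cong refl) (simp add: nth_compose_power pos_fps_def)
    also have "\<dots> = (\<Sum>j | j \<in> {1..n} \<and> j * b \<le> n. of_bool (j > 0) * of_nat (card (over_with_parts A (n - j * b))))"
      by (rule sum_multiples[where f = "\<lambda>j i. of_bool (j > 0) * of_nat (card (over_with_parts A i))"])
        (use b in auto)
    also have "\<dots> = (\<Sum>j | j \<in> {1..n} \<and> j * b \<le> n. of_nat (card (over_with_parts A (n - j * b))))"
      by (intro sum.cong) auto
    finally show "fps_nth (Abs_fps (\<lambda>n. of_nat (card (over_with_parts (insert b A) n)))) n =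
        fps_nth ((1 + 2 * (pos_fps oo q ^ b)) * ?F) n"
      using insert.hyps b by (simp add: card_over_with_parts_insert)
  qed
  also have "?F = (\<Prod>k\<in>A. over_factor k)" using insert by blast
  also have "(1 + 2 * (pos_fps oo q ^ b)) * (\<Prod>k\<in>A. over_factor k) = (\<Prod>k\<in>insert b A. over_factor k)"
    unfolding over_factor_eq[OF b(1), symmetric] using insert.hyps(1) b(2) by simp
  finally show ?case .
qed

text \<open>
  The sizes that may accompany a smallest part \<open>m\<close>, cut off at \<open>2 * N\<close>; the bound is even so that
  the set for \<open>m = 0\<close> consists of the first \<open>N\<close> even numbers.
\<close>
definition larger_parts :: "nat \<Rightarrow> nat \<Rightarrow> nat set" where
  "larger_parts N m = {k. m < k \<and> k \<le> 2 * N \<and> (even k \<or> k < 2 * m)}"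

text \<open>
  Classify by the smallest part \<open>m\<close> and its multiplicity \<open>j\<close>: its block is overlined, and the larger
  parts are free in \<open>larger_parts\<close>.
\<close>
lemma spt_omega_eq:
  assumes "n \<le> N"
  shows "spt_omega n = (\<Sum>m=1..N. \<Sum>j | j \<in> {1..n} \<and> j * m \<le> n.
    j * card (over_with_parts (larger_parts N m) (n - j * m)))"
proof -
  define I where "I = (SIGMA m:{1..N}. SIGMA j:{j. j \<in> {1..n} \<and> j * m \<le> n}.
    over_with_parts (larger_parts N m) (n - j * m))"
  define h where "h = (\<lambda>(m, j, ps). ps @ block m True j)"
  have smallest: "smallest_part (h (m, j, ps)) = m" "count_list (map fst (h (m, j, ps))) m = j"
    "\<forall>p\<in>set ps. m < fst p" if "(m, j, ps) \<in> I" for m j ps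
  proof -
    have ps: "\<forall>p\<in>set ps. m < fst p" and j: "0 < j"
      using that by (auto simp: I_def over_with_parts_def larger_parts_def)
    show "\<forall>p\<in>set ps. m < fst p" by (fact ps)
    have "fst ` set (h (m, j, ps)) = fst ` set ps \<union> {m}"
      using block_simps(2)[of m True j] by (auto simp: h_def image_Un)
    then show "smallest_part (h (m, j, ps)) = m"
      unfolding smallest_part_def using ps
      by (intro Min_eqI) (auto intro: less_imp_le)
    have "count_list (map fst ps) m = 0"
      using ps by (auto simp: count_list_0_iff)
    moreover have "count_list (replicate k m) m = k" for k
      by (induction k) auto
    then have "count_list (map fst (block m True j)) m = j"
      using j by (simp add: block_def)
    ultimately show "count_list (map fst (h (m, j, ps))) m = j"
      by (simp add: h_def)
  qed
  have bij: "bij_betw h I (spt_omega_overpartitions n)"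
    unfolding bij_betw_def
  proof (intro conjI equalityI subsetI)
    show "inj_on h I"
    proof (rule inj_onI)
      fix x y assume x: "x \<in> I" and y: "y \<in> I" and eq: "h x = h y"
      obtain m j ps m' j' ps' where xy: "x = (m, j, ps)" "y = (m', j', ps')" by (metis prod.exhaust)
      have "m = m'" using smallest(1) x y eq unfolding xy by metis
      moreover have "0 < j" "0 < j'" using x y by (auto simp: I_def xy)
      ultimately show "x = y"
        using eq smallest(3) x y append_block_inject[of ps m ps' j j' True True]
        unfolding xy by (auto simp: h_def)
    qed
  next
    fix L assume "L \<in> h ` I"
    then obtain m j ps where x: "(m, j, ps) \<in> I" and L: "L = h (m, j, ps)" by auto
    have m: "1 \<le> m" "1 \<le> j" "j * m \<le> n" "ps \<in> over_with_parts (larger_parts N m) (n - j * m)"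
      using x by (auto simp: I_def)
    have "L \<in> overpartitions n"
      using append_block_overpartition[OF m(4), of m j True] m by (auto simp: L h_def larger_parts_def)
    moreover have "(m, True) \<in> set L" by (simp add: L h_def block_def)
    moreover have "fst p < 2 * m" if "p \<in> set L" "odd (fst p)" for p
    proof -
      have "p \<in> set ps \<or> fst p = m"
        using that(1) block_simps(2)[of m True j] by (auto simp: L h_def)
      then show ?thesis
        using that(2) m(1,4) by (auto simp: over_with_parts_def larger_parts_def image_subset_iff)
    qed
    ultimately show "L \<in> spt_omega_overpartitions n"
      using smallest(1)[OF x] by (simp add: spt_omega_overpartitions_def L)
  next
    fix L assume "L \<in> spt_omega_overpartitions n"
    then have L: "L \<in> overpartitions n" and mem: "(smallest_part L, True) \<in> set L"
      and odd: "\<forall>p\<in>set L. odd (fst p) \<longrightarrow> fst p < 2 * smallest_part L"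
      by (auto simp: spt_omega_overpartitions_def)
    define m where "m = smallest_part L"
    have min: "\<forall>p\<in>set L. m \<le> fst p" by (auto simp: m_def smallest_part_def)
    have "m \<in> fst ` set L" using mem by (force simp: m_def)
    then obtain ps f j where *: "L = ps @ block m f j" "0 < j" "j * m \<le> n"
        "ps \<in> overpartitions (n - j * m)" "\<forall>p\<in>set ps. m < fst p"
      using overpartition_split[OF L min] by blast
    have "(m, True) \<in> set ps \<union> set (block m f j)"
      using mem unfolding m_def[symmetric] by (simp add: *(1))
    then have f: "f = True" using *(5) by (auto simp: block_def)
    have "0 < m" using L mem by (auto simp: overpartitions_iff m_def)
    have "fst p \<le> n" if "p \<in> set L" for p
      using that L member_le_sum_list[of "fst p" "map fst L"] by (auto simp: overpartitions_iff)
    then have bound: "fst p \<le> 2 * N" if "p \<in> set L" for p using that assms by fastforce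
    have "fst ` set ps \<subseteq> larger_parts N m"
    proof -
      have "set ps \<subseteq> set L" by (simp add: *(1))
      then show ?thesis
        using *(5) odd bound by (fastforce simp: larger_parts_def simp flip: m_def)
    qed
    moreover have "j \<le> n" "m \<le> n"
      using *(2,3) \<open>0 < m\<close> le_trans[of j "j * m" n] le_trans[of m "j * m" n] by simp_all
    ultimately have "(m, j, ps) \<in> I"
      using * \<open>0 < m\<close> assms by (auto simp: I_def over_with_parts_def)
    then show "L \<in> h ` I" using *(1) f by (force simp: h_def)
  qed
  have "spt_omega n = (\<Sum>x\<in>I. count_list (map fst (h x)) (smallest_part (h x)))"
    unfolding spt_omega_def using sum.reindex_bij_betw[OF bij, of "\<lambda>L. count_list (map fst L) (smallest_part L)"] by simp
  also have "\<dots> = (\<Sum>(m, j, ps)\<in>I. j)"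
    using smallest by (intro sum.cong refl) auto
  also have "\<dots> = (\<Sum>m=1..N. \<Sum>(j, ps)\<in>(SIGMA j:{j. j \<in> {1..n} \<and> j * m \<le> n}. over_with_parts (larger_parts N m) (n - j * m)). j)"
    unfolding I_def by (subst sum.Sigma) (auto intro!: finite_SigmaI finite_over_with_parts simp: case_prod_unfold)
  also have "\<dots> = (\<Sum>m=1..N. \<Sum>j | j \<in> {1..n} \<and> j * m \<le> n. \<Sum>ps\<in>over_with_parts (larger_parts N m) (n - j * m). j)"
    by (intro sum.cong refl, subst sum.Sigma) (auto intro!: finite_over_with_parts)
  finally show ?thesis by (simp add: mult.commute)
qed

lemma finite_larger_parts: "finite (larger_parts N m)" and zero_notin_larger_parts: "0 \<notin> larger_parts N m"
  by (auto simp: larger_parts_def)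

theorem spt_omega_gf:
  "eq_upto N (Abs_fps (\<lambda>n. of_nat (spt_omega n)))
     (\<Sum>m=1..N. (nat_fps oo q ^ m) * (\<Prod>k\<in>larger_parts N m. over_factor k))"
  unfolding eq_upto_def
proof (intro allI impI)
  fix n assume n: "n \<le> N"
  have "fps_nth ((nat_fps oo q ^ m) * (\<Prod>k\<in>larger_parts N m. over_factor k)) n =
      (\<Sum>j | j \<in> {1..n} \<and> j * m \<le> n. of_nat j * of_nat (card (over_with_parts (larger_parts N m) (n - j * m))))"
    if "m \<ge> 1" for m
  proof -
    have "fps_nth ((nat_fps oo q ^ m) * (\<Prod>k\<in>larger_parts N m. over_factor k)) n =
        (\<Sum>i=0..n. if m dvd i then of_nat (i div m) * of_nat (card (over_with_parts (larger_parts N m) (n - i))) else 0)"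
      unfolding over_with_parts_gf[OF finite_larger_parts zero_notin_larger_parts, symmetric] fps_mult_nth
      using that by (intro sum.cong refl) (simp add: nth_compose_power nat_fps_def)
    also have "\<dots> = (\<Sum>j | j \<in> {1..n} \<and> j * m \<le> n. of_nat j * of_nat (card (over_with_parts (larger_parts N m) (n - j * m))))"
      by (rule sum_multiples[where f = "\<lambda>j i. of_nat j * of_nat (card (over_with_parts (larger_parts N m) i))"])
        (use that in auto)
    finally show ?thesis .
  qed
  then show "fps_nth (Abs_fps (\<lambda>n. of_nat (spt_omega n))) n =
      fps_nth (\<Sum>m=1..N. (nat_fps oo q ^ m) * (\<Prod>k\<in>larger_parts N m. over_factor k)) n"
    by (simp add: spt_omega_eq[OF n] fps_sum_nth)
qed

section \<open>A Bailey pair\<close>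

text \<open>
  For \<open>r = 2 * s\<close> this is \<open>(-1)^s * q^(2 * s^2)\<close>.
\<close>
definition bailey_coeff :: "int \<Rightarrow> rat fps" where
  "bailey_coeff r = (if even r then fps_const (int_sign (r div 2)) * q ^ nat (r * r div 2) else 0)"

lemma bailey_coeff_uminus [simp]: "bailey_coeff (- r) = bailey_coeff r"
proof (cases "even r")
  case True
  then obtain s where "r = 2 * s" by (elim evenE)
  moreover have "- (2 * s) div 2 = - s" for s :: int by simp
  ultimately show ?thesis by (simp add: bailey_coeff_def)
qed (simp add: bailey_coeff_def)

lemma bailey_coeff_0 [simp]: "bailey_coeff 0 = 1"
  by (simp add: bailey_coeff_def int_sign_def)

text \<open>
  For odd \<open>r\<close>, both terms have exponent \<open>n + (r^2 + 1) / 2\<close> and they have opposite signs.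
\<close>
lemma bailey_coeff_cancel:
  assumes "r = int i - int n" "i \<le> 2 * n"
  shows "q ^ i * bailey_coeff (r - 1) + q ^ (2 * n - i) * bailey_coeff (r + 1) = 0"
proof (cases "even r")
  case False
  then obtain s where s: "r = 2 * s + 1" by (elim oddE)
  have "int i = int n + 2 * s + 1" "0 \<le> 2 * s * s" "0 \<le> 2 * (s + 1) * (s + 1)"
    using assms s zero_le_square[of s] zero_le_square[of "s + 1"] by (auto simp: mult.assoc simp del: distrib_right_numeral distrib_left_numeral)
  then have "int (i + nat (2 * s * s)) = int (2 * n - i + nat (2 * (s + 1) * (s + 1)))"
    using assms(2) by (simp only: of_nat_add of_nat_diff int_nat_eq if_True) (simp add: algebra_simps)
  then have "i + nat (2 * s * s) = 2 * n - i + nat (2 * (s + 1) * (s + 1))"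
    by (simp only: of_nat_eq_iff)
  moreover have "(2 * s * (2 * s)) div 2 = 2 * s * s" "(2 * s + 2) * (2 * s + 2) div 2 = 2 * (s + 1) * (s + 1)"
    by (simp_all add: algebra_simps)
  ultimately have "q ^ i * q ^ nat (2 * s * (2 * s) div 2) =
      q ^ (2 * n - i) * (q ^ nat ((2 * s + 2) * (2 * s + 2) div 2) :: rat fps)"
    by (simp flip: power_add)
  moreover have "int_sign ((2 * s + 2) div 2) = - int_sign (2 * s div 2)"
    by (simp add: int_sign_def)
  ultimately show ?thesis
    by (simp add: bailey_coeff_def s mult.left_commute[of "q ^ _"] add.commute flip: fps_const_neg)
qed (simp add: bailey_coeff_def)

lemma qbinom_double_step:
  fixes p :: "'a :: comm_ring_1"
  assumes "i \<le> 2 * n"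
  shows "qbinom p (Suc (Suc (2 * n))) (Suc (Suc i)) =
    (1 + p ^ (2 * n + 1)) * qbinom p (2 * n) (Suc i) + p ^ Suc (Suc i) * qbinom p (2 * n) (Suc (Suc i)) +
    p ^ (2 * n - i) * qbinom p (2 * n) i"
proof -
  have 1: "qbinom p (Suc (2 * n)) (Suc i) = qbinom p (2 * n) (Suc i) + p ^ (2 * n - i) * qbinom p (2 * n) i"
    by (rule qbinom_Suc_Suc'[OF assms])
  have 2: "p ^ Suc (Suc i) * qbinom p (Suc (2 * n)) (Suc (Suc i)) =
      p ^ Suc (Suc i) * qbinom p (2 * n) (Suc (Suc i)) + p ^ (2 * n + 1) * qbinom p (2 * n) (Suc i)"
  proof (cases "Suc i \<le> 2 * n")
    case True
    then have "Suc (Suc i) + (2 * n - Suc i) = 2 * n + 1" by simp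
    then show ?thesis
      unfolding qbinom_Suc_Suc'[OF True] distrib_left mult.assoc[symmetric] power_add[symmetric] by (rule arg_cong)
  next
    case False
    then show ?thesis by (simp add: qbinom_eq_0)
  qed
  show ?thesis
    unfolding qbinom.simps(3)[of p "Suc (2 * n)"] 1 2 by (simp add: algebra_simps)
qed

lemma sum_atMost_shift2:
  fixes f :: "nat \<Rightarrow> 'a :: comm_monoid_add"
  shows "sum f {..Suc (Suc N)} = f 0 + f 1 + (\<Sum>i\<le>N. f (Suc (Suc i)))"
  by (simp add: sum.atMost_Suc_shift[of _ "Suc N"] sum.atMost_Suc_shift[of _ N] add.assoc del: sum.atMost_Suc)

text \<open>
  By induction: the row \<open>2 * n + 2\<close> is expressed by three shifts of the row \<open>2 * n\<close>.  The middle shift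
  reproduces the sum with the new factor, and the two outer shifts cancel by \<open>bailey_coeff_cancel\<close>.
\<close>
lemma bailey_sum:
  "(\<Sum>j\<le>2 * n. bailey_coeff (int j - int n) * qbinom q (2 * n) j) = (\<Prod>k<n. 1 + q ^ (2 * k + 1))"
proof (induction n)
  case (Suc n)
  define b where "b = qbinom q (2 * n)"
  define c where "c = (\<lambda>j. bailey_coeff (int j - int (Suc n)))"
  define Q where "Q = 1 + q ^ (2 * n + 1)"
  have b0: "b j = 0" if "j > 2 * n" for j using that by (simp add: b_def qbinom_eq_0)
  have step: "qbinom q (Suc (Suc (2 * n))) 0 = b 0" "qbinom q (Suc (Suc (2 * n))) 1 = Q * b 0 + q * b 1"
    "qbinom q (Suc (Suc (2 * n))) (Suc (Suc i)) = Q * b (Suc i) + q ^ Suc (Suc i) * b (Suc (Suc i)) +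
      q ^ (2 * n - i) * b i" if "i \<le> 2 * n" for i
    using qbinom_double_step[OF that, of q] qbinom_Suc_Suc'[of 0 "2 * n" q]
    by (simp_all add: b_def Q_def algebra_simps)
  have "(\<Sum>j\<le>Suc (Suc (2 * n)). c j * qbinom q (Suc (Suc (2 * n))) j) =
      c 0 * b 0 + c 1 * (Q * b 0 + q * b 1) + (\<Sum>i\<le>2 * n. c (Suc (Suc i)) *
        (Q * b (Suc i) + q ^ Suc (Suc i) * b (Suc (Suc i)) + q ^ (2 * n - i) * b i))"
    unfolding sum_atMost_shift2 step(1)[OF le0] step(2)[OF le0]
    by (intro arg_cong2[of _ _ _ _ "(+)"] sum.cong refl) (simp only: step(3) atMost_iff)
  also have "\<dots> = Q * (c 1 * b 0 + (\<Sum>i\<le>2 * n. c (Suc (Suc i)) * b (Suc i))) +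
      (c 0 * b 0 + c 1 * (q * b 1) + (\<Sum>i\<le>2 * n. c (Suc (Suc i)) * (q ^ Suc (Suc i) * b (Suc (Suc i))))) +
      (\<Sum>i\<le>2 * n. c (Suc (Suc i)) * (q ^ (2 * n - i) * b i))"
    by (simp add: sum.distrib sum_distrib_left algebra_simps)
  also have "c 1 * b 0 + (\<Sum>i\<le>2 * n. c (Suc (Suc i)) * b (Suc i)) = (\<Sum>j\<le>2 * n. c (Suc j) * b j)"
  proof -
    have "c 1 * b 0 + (\<Sum>i\<le>2 * n. c (Suc (Suc i)) * b (Suc i)) = (\<Sum>j\<le>Suc (2 * n). c (Suc j) * b j)"
      by (simp only: sum.atMost_Suc_shift One_nat_def)
    then show ?thesis by (simp add: b0)
  qed
  also have "(\<Sum>j\<le>2 * n. c (Suc j) * b j) = (\<Prod>k<n. 1 + q ^ (2 * k + 1))"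
    using Suc.IH by (simp add: c_def b_def)
  also have "c 0 * b 0 + c 1 * (q * b 1) + (\<Sum>i\<le>2 * n. c (Suc (Suc i)) * (q ^ Suc (Suc i) * b (Suc (Suc i)))) =
      (\<Sum>i\<le>2 * n. c i * (q ^ i * b i))"
  proof -
    have "(\<Sum>j\<le>Suc (Suc (2 * n)). c j * (q ^ j * b j)) = c 0 * b 0 + c 1 * (q * b 1) +
        (\<Sum>i\<le>2 * n. c (Suc (Suc i)) * (q ^ Suc (Suc i) * b (Suc (Suc i))))"
      unfolding sum_atMost_shift2 by simp
    then show ?thesis by (simp add: b0)
  qed
  finally have "(\<Sum>j\<le>Suc (Suc (2 * n)). c j * qbinom q (Suc (Suc (2 * n))) j) =
      Q * (\<Prod>k<n. 1 + q ^ (2 * k + 1)) +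
      (\<Sum>i\<le>2 * n. (q ^ i * c i + q ^ (2 * n - i) * c (Suc (Suc i))) * b i)"
    by (simp add: sum.distrib algebra_simps)
  also have "(\<Sum>i\<le>2 * n. (q ^ i * c i + q ^ (2 * n - i) * c (Suc (Suc i))) * b i) = 0"
  proof (rule sum.neutral, rule ballI)
    fix i assume "i \<in> {..2 * n}"
    then show "(q ^ i * c i + q ^ (2 * n - i) * c (Suc (Suc i))) * b i = 0"
      using bailey_coeff_cancel[OF refl, of i n] by (simp add: c_def diff_diff_add add.commute)
  qed
  finally show ?case by (simp add: c_def Q_def mult.commute)
qed simp

text \<open>
  Up to the factor \<open>qpoch q m ^ 2\<close>, the \<open>beta\<close> side of the Bailey pair; \<open>bailey_term\<close> contains the
  kernel, made zero beyond the range of \<open>r\<close>.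
\<close>
definition bailey_weight :: "nat \<Rightarrow> rat fps" where
  "bailey_weight m = (\<Prod>k<m. 1 + q ^ (2 * k + 1)) * qpoch q m ^ 2 * inverse (qpoch q (2 * m))"

definition bailey_term :: "nat \<Rightarrow> nat \<Rightarrow> rat fps" where
  "bailey_term m r =
    (if r \<le> m then qpoch q m ^ 2 * inverse (qpoch q (m - r) * qpoch q (m + r)) else 0)"

lemma qpoch_q_nth_0: "fps_nth (qpoch q m) 0 = 1"
  using qpoch_nth_0[of 1 m] by simp

lemma qpoch_inverse: "qpoch q m * inverse (qpoch q m) = 1"
  by (rule inverse_mult_eq_1') (simp add: qpoch_q_nth_0)

lemma qbinom_central:
  assumes "r \<le> m"
  shows "qpoch q m ^ 2 * inverse (qpoch q (2 * m)) * qbinom q (2 * m) (m + r) = bailey_term m r"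
    and "qpoch q m ^ 2 * inverse (qpoch q (2 * m)) * qbinom q (2 * m) (m - r) = bailey_term m r"
proof -
  have *: "a * inverse p * b = a * inverse (x * y)"
    if "b * u * v = p" "p * inverse p = 1" "x * inverse x = 1" "y * inverse y = 1" "u * v = x * y" for a b p x y u v :: "rat fps"
  proof -
    have p: "p = b * (x * y)" using that(1,5) by (simp add: mult.assoc)
    have "(x * y) * inverse (x * y) = 1" using that(3,4) by (simp add: fps_inverse_mult) algebra
    then have "a * inverse p * b = a * (inverse p * p) * inverse (x * y)"
      unfolding p by algebra
    then show ?thesis using that(2) by (simp add: mult.commute)
  qed
  show "qpoch q m ^ 2 * inverse (qpoch q (2 * m)) * qbinom q (2 * m) (m + r) = bailey_term m r"
    using *[OF qbinom_qpoch[of "m + r" "2 * m" q] qpoch_inverse qpoch_inverse qpoch_inverse] assms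
    by (simp add: bailey_term_def mult.commute)
  show "qpoch q m ^ 2 * inverse (qpoch q (2 * m)) * qbinom q (2 * m) (m - r) = bailey_term m r"
    using *[OF qbinom_qpoch[of "m - r" "2 * m" q] qpoch_inverse qpoch_inverse qpoch_inverse] assms
    by (simp add: bailey_term_def mult.commute)
qed

lemma bailey_term_0: "bailey_term m 0 = 1"
  using qpoch_inverse[of m] by (simp add: bailey_term_def fps_inverse_mult power2_eq_square) algebra

lemma sum_fold_symmetric:
  fixes f :: "nat \<Rightarrow> 'a :: comm_ring_1"
  assumes "\<And>r. r \<le> m \<Longrightarrow> f (m - r) = g r" "\<And>r. r \<le> m \<Longrightarrow> f (m + r) = g r"
  shows "(\<Sum>j\<le>2 * m. f j) = g 0 + 2 * (\<Sum>r=1..m. g r)"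
proof -
  have "{..2 * m} = {..<m} \<union> ({m} \<union> {m<..2 * m})" by auto
  then have "(\<Sum>j\<le>2 * m. f j) = (\<Sum>j<m. f j) + (f m + (\<Sum>j\<in>{m<..2 * m}. f j))"
    by (simp only:) (subst sum.union_disjoint; auto)+
  also have "(\<Sum>j<m. f j) = (\<Sum>r=1..m. g r)"
    by (rule sum.reindex_bij_witness[of _ "\<lambda>r. m - r" "\<lambda>j. m - j"]) (auto simp flip: assms(1))
  also have "(\<Sum>j\<in>{m<..2 * m}. f j) = (\<Sum>r=1..m. g r)"
    by (rule sum.reindex_bij_witness[of _ "\<lambda>r. m + r" "\<lambda>j. j - m"]) (auto simp flip: assms(2))
  also have "f m = g 0" using assms(1)[of 0] by simp
  finally show ?thesis by (simp add: algebra_simps)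
qed

text \<open>
  The sum \<open>bailey_sum\<close>, with the terms for \<open>r\<close> and \<open>- r\<close> collected.
\<close>
lemma bailey_weight_eq:
  assumes "m \<le> N"
  shows "bailey_weight m = 1 + 2 * (\<Sum>r=1..N. bailey_coeff (int r) * bailey_term m r)"
proof -
  let ?a = "qpoch q m ^ 2 * inverse (qpoch q (2 * m))"
  have "bailey_weight m = (\<Sum>j\<le>2 * m. bailey_coeff (int j - int m) * (?a * qbinom q (2 * m) j))"
    unfolding bailey_weight_def bailey_sum[symmetric] by (simp add: sum_distrib_left sum_distrib_right mult_ac)
  also have "\<dots> = bailey_coeff (int 0) * bailey_term m 0 + 2 * (\<Sum>r=1..m. bailey_coeff (int r) * bailey_term m r)"
    by (rule sum_fold_symmetric) (simp_all add: qbinom_central of_nat_diff)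
  also have "(\<Sum>r=1..m. bailey_coeff (int r) * bailey_term m r) = (\<Sum>r=1..N. bailey_coeff (int r) * bailey_term m r)"
    using assms by (intro sum.mono_neutral_left) (auto simp: bailey_term_def)
  finally show ?thesis by (simp add: bailey_term_0)
qed

text \<open>
  With \<open>R = q^r\<close> and \<open>X = q^(m + 1 - r)\<close> both sides are the same multiple of one term, since
  \<open>(1 - X * R)^2 - (1 - X) * (1 - X * R^2) = X * (1 - R)^2\<close>.  For \<open>r = m + 1\<close> the factor
  \<open>1 - X\<close> vanishes, in accordance with \<open>bailey_term m r = 0\<close>.
\<close>
lemma bailey_telescope:
  assumes "0 < r"
  shows "(nat_fps oo q ^ Suc m) * bailey_term (Suc m) r =
    (nat_fps oo q ^ r) * (bailey_term (Suc m) r - bailey_term m r)"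
proof (cases "r \<le> Suc m")
  case True
  then obtain d where d: "Suc m = r + d" using le_Suc_ex by blast
  define X R where "X = q ^ d" and "R = q ^ r"
  define P A B where "P = qpoch q m" and "A = inverse (qpoch q (Suc m - r))" and "B = inverse (qpoch q (Suc m + r))"
  have qm: "q ^ Suc m = X * R" by (simp only: X_def R_def d power_add mult.commute)
  have qmr: "q ^ (Suc m + r) = X * R ^ 2" by (simp only: X_def R_def d power_add power2_eq_square mult_ac)
  have T1: "bailey_term (Suc m) r = (P * (1 - X * R)) ^ 2 * (A * B)"
    using True unfolding bailey_term_def qpoch_Suc[of q m] qm A_def B_def P_def fps_inverse_mult by simp
  have T0: "bailey_term m r = P ^ 2 * ((1 - X) * A) * ((1 - X * R ^ 2) * B)"
  proof (cases d)
    case 0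
    then show ?thesis using d by (simp add: bailey_term_def X_def)
  next
    case (Suc e)
    then have e: "m = r + e" using d by simp
    have cancel: "(1 - q ^ Suc k) * inverse (qpoch q (Suc k)) = inverse (qpoch q k)" for k
      unfolding qpoch_Suc fps_inverse_mult
      using inverse_one_minus_power[of "Suc k"] by (simp add: mult.left_commute)
    have "X = q ^ Suc e" by (simp add: X_def Suc)
    then have "(1 - X) * A = inverse (qpoch q (m - r))"
      using cancel[of e] by (simp add: A_def e)
    moreover have "(1 - X * R ^ 2) * B = inverse (qpoch q (m + r))"
      using cancel[of "m + r"] unfolding B_def qmr[symmetric] by simp
    ultimately show ?thesis
      using e by (simp add: bailey_term_def P_def fps_inverse_mult mult.assoc)
  qed
  have u1: "nat_fps oo q ^ Suc m = X * R * inverse (1 - X * R) ^ 2"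
    unfolding qm[symmetric] by (rule nat_fps_compose[OF zero_less_Suc])
  have u2: "nat_fps oo q ^ r = R * inverse (1 - R) ^ 2"
    unfolding R_def by (rule nat_fps_compose[OF assms])
  have inv: "(1 - X * R) * inverse (1 - X * R) = 1" "(1 - R) * inverse (1 - R) = 1"
    using inverse_one_minus_power[of "Suc m"] inverse_one_minus_power[of r] assms unfolding qm R_def by simp_all
  have alg: "x * r * i ^ 2 * ((p * (1 - x * r)) ^ 2 * ab) =
      r * j ^ 2 * ((p * (1 - x * r)) ^ 2 * ab - p ^ 2 * ((1 - x) * (1 - x * r ^ 2)) * ab)"
    if "(1 - x * r) * i = 1" "(1 - r) * j = 1" for x r i j p ab :: "rat fps"
    using that by algebra
  show ?thesis
    using alg[OF inv, of P "A * B"] unfolding T1 T0 u1 u2 by (simp add: mult_ac)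
qed (simp add: bailey_term_def)

lemma bailey_telescope_sum:
  assumes "0 < r"
  shows "(\<Sum>m=1..N. (nat_fps oo q ^ m) * bailey_term m r) = (nat_fps oo q ^ r) * bailey_term N r"
proof (induction N)
  case (Suc N)
  have "(\<Sum>m=1..Suc N. (nat_fps oo q ^ m) * bailey_term m r) =
      (\<Sum>m=1..N. (nat_fps oo q ^ m) * bailey_term m r) + (nat_fps oo q ^ Suc N) * bailey_term (Suc N) r"
    by (rule sum.cl_ivl_Suc[THEN trans]) simp
  moreover have "a + (b - a) = b" for a b :: "rat fps" by simp
  ultimately show ?case unfolding Suc.IH bailey_telescope[OF assms] right_diff_distrib by (simp only:)
qed (use assms in \<open>simp add: bailey_term_def\<close>)

lemma bailey_term_limit:
  assumes "r \<le> N"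
  shows "eq_upto (N - r) (bailey_term N r) 1"
proof -
  have *: "eq_upto (N - r) (qpoch q M) (qpoch q (N - r))" if "N - r \<le> M" for M
    using eq_upto_qpoch[of 1 "N - r" M] that by simp
  have "eq_upto (N - r) (bailey_term N r)
      (qpoch q (N - r) ^ 2 * inverse (qpoch q (N - r) * qpoch q (N - r)))"
    using assms unfolding bailey_term_def
    by (auto intro!: eq_upto_mult eq_upto_power eq_upto_inverse * simp: qpoch_q_nth_0)
  then show ?thesis
    using bailey_term_0[of "N - r"] by (simp add: bailey_term_def)
qed

text \<open>
  Exchange the sums over \<open>m\<close> and \<open>r\<close> and telescope; the remaining factor \<open>bailey_term N r\<close> is
  \<open>1\<close> up to order \<open>N - r\<close>, and the factor \<open>q^r\<close> raises this to \<open>N\<close>.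
\<close>
lemma bailey_transform:
  "eq_upto N (\<Sum>m=1..N. (nat_fps oo q ^ m) * bailey_weight m)
    ((\<Sum>m=1..N. nat_fps oo q ^ m) + 2 * (\<Sum>r=1..N. bailey_coeff (int r) * (nat_fps oo q ^ r)))"
proof -
  have "(\<Sum>m=1..N. (nat_fps oo q ^ m) * bailey_weight m) =
      (\<Sum>m=1..N. (nat_fps oo q ^ m) +
        2 * (\<Sum>r=1..N. bailey_coeff (int r) * ((nat_fps oo q ^ m) * bailey_term m r)))"
    by (intro sum.cong refl) (simp add: bailey_weight_eq[of _ N] distrib_left sum_distrib_left mult_ac)
  also have "\<dots> = (\<Sum>m=1..N. nat_fps oo q ^ m) +
      2 * (\<Sum>m=1..N. \<Sum>r=1..N. bailey_coeff (int r) * ((nat_fps oo q ^ m) * bailey_term m r))"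
    by (simp add: sum.distrib sum_distrib_left)
  also have "(\<Sum>m=1..N. \<Sum>r=1..N. bailey_coeff (int r) * ((nat_fps oo q ^ m) * bailey_term m r)) =
      (\<Sum>r=1..N. bailey_coeff (int r) * ((nat_fps oo q ^ r) * bailey_term N r))"
  proof (subst sum.swap, intro sum.cong refl)
    fix r assume "r \<in> {1..N}"
    then show "(\<Sum>m=1..N. bailey_coeff (int r) * ((nat_fps oo q ^ m) * bailey_term m r)) =
        bailey_coeff (int r) * ((nat_fps oo q ^ r) * bailey_term N r)"
      unfolding sum_distrib_left[symmetric] by (subst bailey_telescope_sum) auto
  qed
  finally have eq: "(\<Sum>m=1..N. (nat_fps oo q ^ m) * bailey_weight m) = (\<Sum>m=1..N. nat_fps oo q ^ m) +
      2 * (\<Sum>r=1..N. bailey_coeff (int r) * ((nat_fps oo q ^ r) * bailey_term N r))" .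
  have "eq_upto N ((nat_fps oo q ^ r) * bailey_term N r) (nat_fps oo q ^ r)" if "r \<in> {1..N}" for r
  proof -
    have u: "nat_fps oo q ^ r = q ^ r * inverse (1 - q ^ r) ^ 2" using nat_fps_compose that by simp
    have "eq_upto N (q ^ r * (inverse (1 - q ^ r) ^ 2 * bailey_term N r)) (q ^ r * (inverse (1 - q ^ r) ^ 2 * 1))"
      using that by (intro eq_upto_shift eq_upto_mult eq_upto_refl bailey_term_limit) simp
    then show ?thesis by (simp add: u mult.assoc)
  qed
  then show ?thesis
    unfolding eq by (intro eq_upto_add eq_upto_mult eq_upto_sum eq_upto_refl)
qed

section \<open>The odd-indexed values of \<open>spt_omega\<close>\<close>

lemma larger_parts_Suc:
  assumes "0 < m" "Suc m \<le> N"
  shows "Suc m \<in> larger_parts N m" "2 * m + 1 \<notin> larger_parts N m" "Suc m \<noteq> 2 * m + 1"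
    "larger_parts N (Suc m) = insert (2 * m + 1) (larger_parts N m - {Suc m})"
proof -
  show "Suc m \<in> larger_parts N m"
    using assms by (cases "m = 1") (auto simp: larger_parts_def)
  show "larger_parts N (Suc m) = insert (2 * m + 1) (larger_parts N m - {Suc m})"
    using assms by (auto simp: larger_parts_def less_Suc_eq Suc_lessI)
qed (use assms in \<open>auto simp: larger_parts_def\<close>)

lemma bailey_weight_Suc:
  "bailey_weight (Suc m) * over_factor (Suc m) = bailey_weight m * over_factor (2 * m + 1)"
proof -
  have *: "pr * (1 + a) * (p * (1 - b)) ^ 2 * (ip * ia * ib2) * ((1 + b) * ib) = pr * p ^ 2 * ip * ((1 + a) * ia)"
    if "(1 - b) * ib = 1" "(1 - b ^ 2) * ib2 = 1" for pr p a b ip ia ib ib2 :: "rat fps"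
    using that by algebra
  have P: "inverse (qpoch q (2 * Suc m)) =
      inverse (qpoch q (2 * m)) * inverse (1 - q ^ (2 * m + 1)) * inverse (1 - (q ^ Suc m) ^ 2)"
  proof -
    have "2 * Suc m = Suc (Suc (2 * m))" "Suc (Suc (2 * m)) = Suc m * 2" by simp_all
    then have "qpoch q (2 * Suc m) = qpoch q (2 * m) * (1 - q ^ (2 * m + 1)) * (1 - (q ^ Suc m) ^ 2)"
      by (metis Suc_eq_plus1 power_mult qpoch_Suc)
    then show ?thesis by (simp only: fps_inverse_mult)
  qed
  have "(1 - (q ^ Suc m) ^ 2) * inverse (1 - (q ^ Suc m) ^ 2) = (1 :: rat fps)"
    unfolding power_mult[symmetric] by (rule inverse_one_minus_power) simp
  from *[OF inverse_one_minus_power[OF zero_less_Suc] this]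
  show ?thesis
    unfolding bailey_weight_def over_factor_def P qpoch_Suc[of q m] prod.lessThan_Suc .
qed

text \<open>
  Passing from \<open>m\<close> to \<open>m + 1\<close> removes the size \<open>m + 1\<close> and admits the odd size \<open>2 * m + 1\<close>; the weight
  changes by the same factors.  For \<open>m = 0\<close> the two sizes coincide and nothing changes.
\<close>
lemma prod_larger_parts:
  assumes "m \<le> N"
  shows "(\<Prod>k\<in>larger_parts N m. over_factor k) = (\<Prod>k\<in>larger_parts N 0. over_factor k) * bailey_weight m"
  using assms
proof (induction m)
  case (Suc m)
  have cancel: "(1 + a) * i * ((1 - a) * j) = 1" if "(1 + a) * j = 1" "(1 - a) * i = 1" for a i j :: "rat fps"
    using that by algebra
  have inv: "over_factor k * ((1 - q ^ k) * inverse (1 + q ^ k)) = 1" if "k > 0" for k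
  proof -
    have "(1 + q ^ k) * inverse (1 + q ^ k) = (1 :: rat fps)"
      by (rule inverse_mult_eq_1') (use that in simp)
    from cancel[OF this inverse_one_minus_power[OF that]] show ?thesis unfolding over_factor_def .
  qed
  let ?P = "\<lambda>m. \<Prod>k\<in>larger_parts N m. over_factor k"
  have "?P (Suc m) * over_factor (Suc m) = ?P m * over_factor (2 * m + 1)"
  proof (cases "m = 0")
    case True
    have "larger_parts N 1 = larger_parts N 0"
      by (auto simp: larger_parts_def elim: evenE intro: Suc_lessI)
    then show ?thesis using True by simp
  next
    case False
    then have m: "0 < m" by simp
    note parts = larger_parts_Suc[OF m Suc.prems]
    have "?P m = over_factor (Suc m) * (\<Prod>k\<in>larger_parts N m - {Suc m}. over_factor k)"
      by (rule prod.remove[OF finite_larger_parts parts(1)])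
    moreover have "?P (Suc m) = over_factor (2 * m + 1) * (\<Prod>k\<in>larger_parts N m - {Suc m}. over_factor k)"
      unfolding parts(4) using parts(2) by (subst prod.insert) (auto simp: finite_larger_parts)
    ultimately show ?thesis by (simp add: mult_ac)
  qed
  also have "\<dots> = ?P 0 * bailey_weight (Suc m) * over_factor (Suc m)"
    using Suc bailey_weight_Suc[of m] by (simp add: mult.assoc)
  finally have "?P (Suc m) * over_factor (Suc m) * ((1 - q ^ Suc m) * inverse (1 + q ^ Suc m)) =
      ?P 0 * bailey_weight (Suc m) * over_factor (Suc m) * ((1 - q ^ Suc m) * inverse (1 + q ^ Suc m))"
    by (simp only:)
  then show ?case
    unfolding mult.assoc[of _ "over_factor _"] inv[OF zero_less_Suc] by simp
qed (simp add: bailey_weight_def)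

lemma eq_upto_section:
  "eq_upto (2 * N + 1) F G \<Longrightarrow> eq_upto N (section_fps 2 1 F) (section_fps 2 1 G)"
  by (simp add: eq_upto_def section_fps_def)

lemma section_even: "section_fps 2 1 (F oo q ^ 2) = 0"
  by (simp add: section_fps_def fps_eq_iff nth_compose_power)

text \<open>
  The coefficient is zero for odd \<open>r\<close>, and for even \<open>r\<close> the term is a series in \<open>q^2\<close>.
\<close>
lemma section_bailey: "section_fps 2 1 (2 * (\<Sum>r=1..N. bailey_coeff (int r) * (nat_fps oo q ^ r))) = 0"
proof -
  have "section_fps 2 1 (bailey_coeff (int r) * (nat_fps oo q ^ r)) = 0" if "r \<in> {1..N}" for r
  proof (cases "even r")
    case True
    then obtain s where s: "r = 2 * s" by (elim evenE)
    have "bailey_coeff (int r) = (fps_const (int_sign (int s)) * q ^ (s * s)) oo q ^ 2"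
    proof -
      have "int r * int r div 2 = int (2 * (s * s))" by (simp add: s)
      then have "nat (int r * int r div 2) = 2 * (s * s)" by (simp only: nat_int)
      then show ?thesis
        by (simp add: bailey_coeff_def s compose_power_mult compose_power_power power_mult)
    qed
    moreover have "nat_fps oo q ^ r = (nat_fps oo q ^ s) oo q ^ 2"
      using that s nth_compose_power[of r nat_fps] nth_compose_power[of s nat_fps] nth_compose_power[of 2 "nat_fps oo q ^ s"]
      by (auto simp: fps_eq_iff elim!: dvdE)
    ultimately show ?thesis
      by (simp only: section_even flip: compose_power_mult[of 2])
  next
    case False
    then show ?thesis by (simp add: bailey_coeff_def section_fps_def fps_eq_iff)
  qed
  then show ?thesis
    unfolding numeral_fps_const section_fps_const_mult section_fps_sum by (simp only: sum.neutral_const mult_zero_right cong: sum.cong)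
qed

lemma prod_even_parts:
  "(\<Prod>k\<in>larger_parts N 0. over_factor k) = (\<Prod>k=1..N. over_factor k) oo q ^ 2"
proof -
  have "(\<Prod>k\<in>larger_parts N 0. over_factor k) = (\<Prod>k=1..N. over_factor (2 * k))"
    by (rule prod.reindex_bij_witness[of _ "\<lambda>k. 2 * k" "\<lambda>k. k div 2"]) (auto simp: larger_parts_def)
  also have "\<dots> = (\<Prod>k=1..N. over_factor k oo q ^ 2)"
  proof (intro prod.cong refl)
    fix k assume k: "k \<in> {1..N}"
    have "(over_factor k oo q ^ 2) * (1 - q ^ (2 * k)) = 1 + q ^ (2 * k)"
    proof -
      have "over_factor k * (1 - q ^ k) = 1 + q ^ k"
        using inverse_one_minus_power[of k] k by (simp add: over_factor_def mult_ac)
      then have "(over_factor k * (1 - q ^ k)) oo q ^ 2 = (1 + q ^ k) oo q ^ 2" by simp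
      then show ?thesis
        by (simp add: compose_power_mult fps_compose_sub_distrib fps_compose_add_distrib compose_power_power flip: power_mult)
    qed
    then show "over_factor (2 * k) = over_factor k oo q ^ 2"
      unfolding over_factor_def[of "2 * k"]
    proof -
      have cancel: "b * i = f" if "f * a = b" "a * i = 1" for a b f i :: "rat fps"
        unfolding that(1)[symmetric] mult.assoc that(2) by simp
      show "(1 + q ^ (2 * k)) * inverse (1 - q ^ (2 * k)) = over_factor k oo q ^ 2"
        by (rule cancel[OF \<open>(over_factor k oo q ^ 2) * _ = _\<close> inverse_one_minus_power]) (use k in simp)
    qed
  qed
  finally show ?thesis by (simp add: compose_power_prod)
qed

text \<open>
  The limit is the generating function \<open>E(q^2) / E(q)^2\<close> of all overpartitions.
\<close>
lemma prod_over_factor_limit: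
  assumes "N \<le> M"
  shows "eq_upto N ((\<Prod>k=1..M. over_factor k) * E q ^ 2) (E (q ^ 2))"
proof -
  have "eq_upto N ((\<Prod>k=1..M. over_factor k) * E q ^ 2) ((\<Prod>k=1..M. over_factor k) * qpoch q M ^ 2)"
    using assms by (intro eq_upto_mult eq_upto_power eq_upto_refl E_eq_upto_qpoch)
  also have "(\<Prod>k=1..M. over_factor k) * qpoch q M ^ 2 = (\<Prod>k=1..M. over_factor k * (1 - q ^ k) ^ 2)"
    by (simp add: qpoch_def prod.distrib prod_power_distrib)
  also have "\<dots> = (\<Prod>k=1..M. (1 - q ^ k) oo q ^ 2)"
  proof (intro prod.cong refl)
    fix k assume "k \<in> {1..M}"
    then have "(1 - q ^ k) * inverse (1 - q ^ k) = (1 :: rat fps)" by (intro inverse_one_minus_power) simp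
    moreover have "(1 + a) * i * (1 - a) ^ 2 = 1 - a ^ 2" if "(1 - a) * i = 1" for a i :: "rat fps"
      using that by algebra
    ultimately have "over_factor k * (1 - q ^ k) ^ 2 = 1 - (q ^ k) ^ 2"
      unfolding over_factor_def by blast
    then show "over_factor k * (1 - q ^ k) ^ 2 = (1 - q ^ k) oo q ^ 2"
      by (simp add: fps_compose_sub_distrib compose_power_power power_mult[symmetric] mult.commute)
  qed
  also have "\<dots> = qpoch q M oo q ^ 2" by (simp add: qpoch_def compose_power_prod)
  also have "eq_upto N \<dots> (E q oo q ^ 2)"
    using E_eq_upto_qpoch[OF assms] by (auto simp: eq_upto_def nth_compose_power intro: le_trans[OF div_le_dividend])
  also have "E q oo q ^ 2 = E (q ^ 2)" using E_compose_power[of 1 2] by simp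
  finally show ?thesis .
qed

text \<open>
  The factor for the even parts is a series in \<open>q^2\<close> and can be taken out of the section; of the second
  factor only the Lambert series of the sum of divisors is left.
\<close>
theorem spt_omega_odd:
  "Abs_fps (\<lambda>n. of_nat (spt_omega (2 * n + 1))) * E q ^ 6 = E (q ^ 2) ^ 9"
proof -
  define S :: "rat fps" where "S = Abs_fps (\<lambda>n. of_nat (spt_omega n))"
  have odd: "section_fps 2 1 S * E q ^ 2 = E (q ^ 2) * section_fps 2 1 sigma_fps"
  proof (rule eq_upto_all)
    fix N
    define M :: nat where "M = 2 * N + 1"
    define G where "G = (\<Prod>k=1..M. over_factor k)"
    let ?B = "2 * (\<Sum>r=1..M. bailey_coeff (int r) * (nat_fps oo q ^ r))"
    have "eq_upto M S (\<Sum>m=1..M. (nat_fps oo q ^ m) * (\<Prod>k\<in>larger_parts M m. over_factor k))"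
      unfolding S_def by (rule spt_omega_gf)
    also have "\<dots> = (G oo q ^ 2) * (\<Sum>m=1..M. (nat_fps oo q ^ m) * bailey_weight m)"
      unfolding sum_distrib_left G_def
      by (intro sum.cong refl) (simp add: prod_larger_parts prod_even_parts mult_ac)
    also have "eq_upto M \<dots> ((G oo q ^ 2) * ((\<Sum>m=1..M. nat_fps oo q ^ m) + ?B))"
      by (intro eq_upto_mult eq_upto_refl bailey_transform)
    also have "eq_upto M \<dots> ((G oo q ^ 2) * (sigma_fps + ?B))"
      by (intro eq_upto_mult eq_upto_add eq_upto_refl eq_upto_sym[OF sigma_fps_lambert(2)])
    finally have "eq_upto N (section_fps 2 1 S) (section_fps 2 1 ((G oo q ^ 2) * (sigma_fps + ?B)))"
      unfolding M_def by (rule eq_upto_section)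
    also have "section_fps 2 1 ((G oo q ^ 2) * (sigma_fps + ?B)) = G * section_fps 2 1 sigma_fps"
    proof -
      have "section_fps 2 1 ((G oo q ^ 2) * F) = G * section_fps 2 1 F" for F
        by (rule section_fps_compose_mult) simp_all
      then show ?thesis by (simp only: section_fps_add section_bailey add_0_right)
    qed
    finally have "eq_upto N (section_fps 2 1 S * E q ^ 2) (G * section_fps 2 1 sigma_fps * E q ^ 2)"
      by (intro eq_upto_mult eq_upto_refl)
    also have "G * section_fps 2 1 sigma_fps * E q ^ 2 = (G * E q ^ 2) * section_fps 2 1 sigma_fps"
      by (simp add: mult_ac)
    also have "eq_upto N \<dots> (E (q ^ 2) * section_fps 2 1 sigma_fps)"
      unfolding G_def by (intro eq_upto_mult eq_upto_refl prod_over_factor_limit) (simp add: M_def)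
    finally show "eq_upto N (section_fps 2 1 S * E q ^ 2) (E (q ^ 2) * section_fps 2 1 sigma_fps)" .
  qed
  have "section_fps 2 1 S * E q ^ 6 = (section_fps 2 1 S * E q ^ 2) * E q ^ 4"
    by (simp add: mult.assoc flip: power_add)
  also have "\<dots> = E (q ^ 2) * (section_fps 2 1 sigma_fps * E q ^ 4)"
    unfolding odd by (simp only: mult.assoc)
  also have "\<dots> = E (q ^ 2) ^ 9" unfolding sigma_odd by (simp flip: power_Suc)
  finally show ?thesis by (simp add: section_fps_def S_def)
qed

section \<open>Iterating the section\<close>

definition spt_progression :: "nat \<Rightarrow> rat fps" where
  "spt_progression k = Abs_fps (\<lambda>n. of_nat (spt_omega (2 * 5 ^ k * n + 5 ^ k)))"

lemma section_spt_progression: "section_fps 5 2 (spt_progression k) = spt_progression (Suc k)"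
proof -
  have "2 * 5 ^ k * (5 * n + 2) + 5 ^ k = 2 * 5 ^ Suc k * n + (5 ^ Suc k :: nat)" for n
    by (simp add: algebra_simps)
  then show ?thesis by (simp only: section_fps_def spt_progression_def fps_nth_Abs_fps)
qed

lemma spt_progression_1: "spt_progression 1 = gamma_q * (\<Sum>i. fps_const (coeff_vec 1 (Suc i)) * xi_q ^ i)"
proof -
  have "(\<Sum>i. fps_const (coeff_vec 1 (Suc i)) * xi_q ^ i) =
      (\<Sum>i<5. fps_const (coeff_vec 1 (Suc i)) * xi_q ^ i)"
    by (rule suminf_finite) auto
  also have "\<dots> = 18 + 720 * xi_q + 7625 * xi_q ^ 2 + 32500 * xi_q ^ 3 + 50000 * xi_q ^ 4"
    by (simp add: eval_nat_numeral(2,3) numeral_fps_const del: power_Suc)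
  finally show ?thesis
    using section_start[of "spt_progression 0"] section_spt_progression[of 0] spt_omega_odd
    by (simp add: spt_progression_def)
qed

lemma spt_progression_step:
  assumes "m \<ge> 1" "spt_progression (2 * m - 1) = gamma_q * (\<Sum>i. fps_const (coeff_vec (2 * m - 1) (Suc i)) * xi_q ^ i)"
  shows "spt_progression (2 * m) = delta_q * (\<Sum>i. fps_const (coeff_vec (2 * m) (Suc i)) * xi_q ^ i)"
    and "spt_progression (2 * m + 1) = gamma_q * (\<Sum>i. fps_const (coeff_vec (2 * m + 1) (Suc i)) * xi_q ^ i)"
proof -
  have alpha: "(\<lambda>i j. fps_nth (fps_nth (N_alpha / D_poly) i) j) = alpha"
    and beta: "(\<lambda>i j. fps_nth (fps_nth (N_beta / D_poly) i) j) = beta"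
    by (intro ext; simp add: alpha_def beta_def)+
  have "spt_progression (2 * m) = section_fps 5 2 (spt_progression (2 * m - 1))"
    using assms(1) by (simp add: section_spt_progression)
  also have "\<dots> = delta_q * (\<Sum>i. fps_const (vec_mat (coeff_vec (2 * m - 1)) alpha (Suc i)) * xi_q ^ i)"
    unfolding assms(2) alpha[symmetric] by (rule section_vec_mat[OF steep_polys(1) section_gamma_row])
  finally show even: "spt_progression (2 * m) = delta_q * (\<Sum>i. fps_const (coeff_vec (2 * m) (Suc i)) * xi_q ^ i)"
    unfolding coeff_vec_rec(1)[OF assms(1)] .
  have "spt_progression (2 * m + 1) = section_fps 5 2 (spt_progression (2 * m))"
    by (simp add: section_spt_progression)
  also have "\<dots> = gamma_q * (\<Sum>i. fps_const (vec_mat (coeff_vec (2 * m)) beta (Suc i)) * xi_q ^ i)"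
    unfolding even beta[symmetric] by (rule section_vec_mat[OF steep_polys(2) section_delta_row])
  finally show "spt_progression (2 * m + 1) = gamma_q * (\<Sum>i. fps_const (coeff_vec (2 * m + 1) (Suc i)) * xi_q ^ i)"
    unfolding coeff_vec_rec(2)[OF assms(1)] .
qed

theorem theorem1p2:
  fixes m :: nat
  assumes "m \<ge> 1"
  shows
    "Abs_fps (\<lambda>n. of_nat (spt_omega (2 * 5 ^ (2 * m - 1) * n + 5 ^ (2 * m - 1)))) =
       gamma_q * (\<Sum>i. fps_const (coeff_vec (2 * m - 1) (Suc i)) * xi_q ^ i) \<and>
     Abs_fps (\<lambda>n. of_nat (spt_omega (2 * 5 ^ (2 * m) * n + 5 ^ (2 * m)))) =
       delta_q * (\<Sum>i. fps_const (coeff_vec (2 * m) (Suc i)) * xi_q ^ i)"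
proof -
  have odd: "spt_progression (2 * m - 1) = gamma_q * (\<Sum>i. fps_const (coeff_vec (2 * m - 1) (Suc i)) * xi_q ^ i)"
    using assms
  proof (induction m rule: dec_induct)
    case base
    show ?case using spt_progression_1 by simp
  next
    case (step m)
    then show ?case using spt_progression_step(2)[of m] by simp
  qed
  with spt_progression_step(1)[OF assms odd] show ?thesis
    by (simp add: spt_progression_def)
qed

end
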